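(* The defining relations of the algebras $\mathfrak{aw}(n)$, $n\ge1$, are necessary and sufficient to satisfy requirements (1)--(4) of the context. That is: the sequence $(\mathfrak{aw}(n))_{n\ge1}$, with its generators $C_I$, satisfies requirements (1)--(4); and it is the largest such sequence, in the sense that for any sequence of algebras $(A_n)_{n\ge1}$, with $A_n$ generated by elements $C_I$ indexed by the connected subsets $I$ of $\{1,\dots,n\}$, satisfying requirements (1)--(4), the algebra $A_n$ is a quotient of $\mathfrak{aw}(n)$ for every $n$ (via the surjective algebra morphism $\mathfrak{aw}(n)\to A_n$, $C_I\mapsto C_I$).
   Context: Base field $\mathbb{C}(q)$, $q$ an indeterminate. $[A,B]=AB-BA$, $[A,B]_q=\frac{1}{q-q^{-1}}(qAB-q^{-1}BA)$. For $I,J\subseteq\{1,\dots,n\}$, $I<J$ means every element of $I$ is strictly smaller than every element of $J$. A connected subset is a non-empty set of consecutive integers. Two disjoint connected subsets are adjacent if their union is connected. A sequence $(I_1,\dots,I_k)$ of connected subsets is monotonic if $I_1<\dots<I_k$ or $I_1>\dots>I_k$; it is a monotonic sequence of adjacent subsets if moreover $I_j,I_{j+1}$ are adjacent for all $j$. Elements: $C_I$ for $I\subseteq\{1,\dots,n\}$ connected; $C_\varnothing:=1$; $C_{j\dots k}:=C_{\{j,j+1,\dots,k\}}$. Adjacent sets in an index are merged: if $I_1,I_2$ are disjoint, connected and adjacent then $C_{I_1I_2}=C_{I_2I_1}:=C_{I_1\cup I_2}$ (similarly for more sets; e.g. $C_{I_1I_3I_4}$ with $I_3,I_4$ adjacent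 means $C_{I_1(I_3\cup I_4)}$). If $I_1,I_2$ are disjoint connected subsets and the hole $H$ between them (the set of integers strictly between $I_1$ and $I_2$) is non-empty, then $$C_{I_1I_2}:=-[C_{I_1H},C_{HI_2}]_q+C_{I_1}C_{I_2}+C_HC_{I_1HI_2}$$ (the order of the pair $(I_1,I_2)$ matters). The algebra $\mathfrak{aw}(n)$ is the unital associative algebra generated by the $C_I$, $I$ a connected subset of $\{1,\dots,n\}$, with relations: (i) $[C_I,C_J]=0$ for connected $I,J$ with $I\cap J=\varnothing$ or $I\subset J$; (ii) $C_{I_1I_2}=-[C_{I_2I_3},C_{I_1I_3}]_q+C_{I_1}C_{I_2}+C_{I_3}C_{I_1I_2I_3}$ for every monotonic sequence $(I_1,I_2,I_3)$ of adjacent connected subsets; (iii) $C_{I_1I_4}=-[C_{I_1I_3},C_{I_3I_4}]_q+C_{I_1}C_{I_4}+C_{I_3}C_{I_1I_3I_4}$ for every monotonic sequence $(I_1,I_2,I_3,I_4)$ of adjacent connected subsets. Requirements on a sequence of unital associative algebras $(A_n)_{n\ge1}$, where $A_n$ is generated by elements $C_I$, $I$ a connected subset of $\{1,\dots,n\}$. On generators of $A_n$ consider the assignments $\iota_n(C_I)=C_I\in A_{n+1}$ and, for $1\le a\le n$, $\delta_a(C_{j\dots k})=C_{j\dots k}$ if $k<a$, $=C_{j\dots k+1}$ if $j\le a\le k$, $=C_{j+1\dots k+1}$ if $a<j$ (elements of $A_{n+1}$). (1) For all $n\ge1$, $\iota_n$ and $\delta_1,\dots,\delta_n$ extend to algebra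 morphisms $A_n\to A_{n+1}$. (2) For all $n\ge1$ there exist automorphisms $r_1,\dots,r_{n-1}$ of $A_n$, with inverses $\bar r_1,\dots,\bar r_{n-1}$, commuting with $\iota_n$ (i.e. $\iota_n r_i=r_i\iota_n$), and satisfying, as morphisms $A_n\to A_{n+1}$ (all indices being $\geq 1$): $r_i\delta_i=\delta_i=\bar r_i\delta_i$ for $1\le i\le n$; $\delta_ir_i=r_{i+1}r_i\delta_{i+1}$, $\ \bar r_i\bar r_{i+1}\delta_i=\delta_{i+1}\bar r_i$, $\ \delta_{i+1}r_i=r_ir_{i+1}\delta_i$, $\ \bar r_{i+1}\bar r_i\delta_{i+1}=\delta_i\bar r_i$ for $1\le i\le n-1$; $\delta_ir_j=r_j\delta_i$ and $\delta_i\bar r_j=\bar r_j\delta_i$ for $1\le j<i-1$, $i\le n$; $\delta_ir_j=r_{j+1}\delta_i$ and $\delta_i\bar r_j=\bar r_{j+1}\delta_i$ for $1\le i<j\le n-1$. (3) $A_2$ is commutative, and the automorphism $r_1$ of $A_2$ exchanges $C_1$ and $C_2$. (4) In $A_3$: $r_1(C_{23})=-[C_{12},C_{23}]_q+C_1C_3+C_2C_{123}$ and $\bar r_1(C_{23})=-[C_{23},C_{12}]_q+C_1C_3+C_2C_{123}$. *)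

theory Defs
  imports
    "HOL-Algebra.Algebraic_Closure_Type"
    "HOL-Algebra.QuotRing"
    "HOL-Algebra.Subrings"
    "HOL-Computational_Algebra.Computational_Algebra"
    "HOL-Library.Poly_Mapping"
begin

section \<open>Unital associative algebras over \<open>\<complex>(q)\<close>\<close>

type_synonym Cq = "complex poly fract"

definition qq :: Cq where
  "qq = Fract [:0, 1:] 1"

text \<open>The locale \<^locale>\<open>algebra\<close> of HOL-Algebra requires commutativity, so associative algebras are
  introduced here. The scalars form the type \<^typ>\<open>Cq\<close>; only its ring structure matters in
  \<^locale>\<open>module\<close>.\<close>

definition assoc_algebra :: "(Cq, 'a) module \<Rightarrow> bool" where
  "assoc_algebra A \<longleftrightarrow>
     ring A \<and> module ring_of_type_algebra A \<and>
     (\<forall>c. \<forall>x\<in>carrier A. \<forall>y\<in>carrier A.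
        (c \<odot>\<^bsub>A\<^esub> x) \<otimes>\<^bsub>A\<^esub> y = c \<odot>\<^bsub>A\<^esub> (x \<otimes>\<^bsub>A\<^esub> y) \<and>
        x \<otimes>\<^bsub>A\<^esub> (c \<odot>\<^bsub>A\<^esub> y) = c \<odot>\<^bsub>A\<^esub> (x \<otimes>\<^bsub>A\<^esub> y))"

definition alg_hom :: "(Cq, 'a) module \<Rightarrow> (Cq, 'b) module \<Rightarrow> ('a \<Rightarrow> 'b) set" where
  "alg_hom A B = {f \<in> ring_hom A B. \<forall>c. \<forall>x\<in>carrier A. f (c \<odot>\<^bsub>A\<^esub> x) = c \<odot>\<^bsub>B\<^esub> f x}"

definition alg_aut :: "(Cq, 'a) module \<Rightarrow> ('a \<Rightarrow> 'a) set" where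
  "alg_aut A = {f \<in> alg_hom A A. bij_betw f (carrier A) (carrier A)}"

definition subalg :: "'a set \<Rightarrow> (Cq, 'a) module \<Rightarrow> bool" where
  "subalg S A \<longleftrightarrow> subring S A \<and> (\<forall>c. \<forall>x\<in>S. c \<odot>\<^bsub>A\<^esub> x \<in> S)"

definition generated_by :: "(Cq, 'a) module \<Rightarrow> 'a set \<Rightarrow> bool" where
  "generated_by A G \<longleftrightarrow> G \<subseteq> carrier A \<and> \<Inter>{S. subalg S A \<and> G \<subseteq> S} = carrier A"

definition comm :: "(Cq, 'a) module \<Rightarrow> 'a \<Rightarrow> 'a \<Rightarrow> 'a" where
  "comm A x y = (x \<otimes>\<^bsub>A\<^esub> y) \<ominus>\<^bsub>A\<^esub> (y \<otimes>\<^bsub>A\<^esub> x)"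

definition qcomm :: "(Cq, 'a) module \<Rightarrow> 'a \<Rightarrow> 'a \<Rightarrow> 'a" where
  "qcomm A x y =
     (1 / (qq - inverse qq)) \<odot>\<^bsub>A\<^esub>
       ((qq \<odot>\<^bsub>A\<^esub> (x \<otimes>\<^bsub>A\<^esub> y)) \<ominus>\<^bsub>A\<^esub> (inverse qq \<odot>\<^bsub>A\<^esub> (y \<otimes>\<^bsub>A\<^esub> x)))"


section \<open>Algebras given by generators and relations\<close>

text \<open>The free monoid on a set of letters is the list monoid, written additively so that
  finitely supported functions on it (\<^type>\<open>poly_mapping\<close>) with the convolution product are
  the noncommutative polynomials.\<close>

datatype 'x free_monoid = Word (letters: "'x list")

instantiation free_monoid :: (type) monoid_add
begin
definition zero_free_monoid :: "'a free_monoid" where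
  "0 = Word []"
definition plus_free_monoid :: "'a free_monoid \<Rightarrow> 'a free_monoid \<Rightarrow> 'a free_monoid" where
  "v + w = Word (letters v @ letters w)"
instance
  by standard (simp_all add: zero_free_monoid_def plus_free_monoid_def)
end

type_synonym 'x ncpoly = "'x free_monoid \<Rightarrow>\<^sub>0 Cq"

definition free_algebra :: "'x set \<Rightarrow> (Cq, 'x ncpoly) module" where
  "free_algebra S =
     \<lparr> carrier = {p. \<forall>w\<in>Poly_Mapping.keys p. set (letters w) \<subseteq> S},
       monoid.mult = (*), one = 1, ring.zero = 0, add = (+),
       module.smult = (\<lambda>c p. Poly_Mapping.single 0 c * p) \<rparr>"

definition free_gen :: "'x \<Rightarrow> 'x ncpoly" where
  "free_gen x = Poly_Mapping.single (Word [x]) 1"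

text \<open>Quotient by a two-sided ideal. The scalar \<open>c\<close> acts on cosets by multiplication by the
  coset of \<open>c \<cdot> 1\<close>.\<close>

definition quot_algebra :: "(Cq, 'a) module \<Rightarrow> 'a set \<Rightarrow> (Cq, 'a set) module" where
  "quot_algebra F I =
     \<lparr> carrier = carrier (F Quot I), monoid.mult = monoid.mult (F Quot I), one = one (F Quot I),
       ring.zero = ring.zero (F Quot I), add = add (F Quot I),
       module.smult = (\<lambda>c T. (I +>\<^bsub>F\<^esub> (c \<odot>\<^bsub>F\<^esub> \<one>\<^bsub>F\<^esub>)) \<otimes>\<^bsub>F Quot I\<^esub> T) \<rparr>"

definition presented_ideal :: "'x set \<Rightarrow> 'x ncpoly set \<Rightarrow> 'x ncpoly set" where
  "presented_ideal S R = Idl\<^bsub>free_algebra S\<^esub> R"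

definition presented_algebra :: "'x set \<Rightarrow> 'x ncpoly set \<Rightarrow> (Cq, 'x ncpoly set) module" where
  "presented_algebra S R = quot_algebra (free_algebra S) (presented_ideal S R)"

definition presented_gen :: "'x set \<Rightarrow> 'x ncpoly set \<Rightarrow> 'x \<Rightarrow> 'x ncpoly set" where
  "presented_gen S R x = presented_ideal S R +>\<^bsub>free_algebra S\<^esub> free_gen x"


section \<open>Connected subsets\<close>

definition consecutive :: "nat set \<Rightarrow> bool" where
  "consecutive I \<longleftrightarrow> (\<exists>j k. j \<le> k \<and> I = {j..k})"

definition conn :: "nat \<Rightarrow> nat set set" where
  "conn n = {I. I \<subseteq> {1..n} \<and> consecutive I}"

definition set_less :: "nat set \<Rightarrow> nat set \<Rightarrow> bool" where
  "set_less I J \<longleftrightarrow> (\<forall>i\<in>I. \<forall>j\<in>J. i < j)"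

definition adjacent :: "nat set \<Rightarrow> nat set \<Rightarrow> bool" where
  "adjacent I J \<longleftrightarrow> I \<inter> J = {} \<and> consecutive (I \<union> J)"

definition hole :: "nat set \<Rightarrow> nat set \<Rightarrow> nat set" where
  "hole I J = {h. (\<forall>i\<in>I. \<forall>j\<in>J. i < h \<and> h < j) \<or> (\<forall>i\<in>I. \<forall>j\<in>J. j < h \<and> h < i)}"

definition monotonic :: "nat set list \<Rightarrow> bool" where
  "monotonic Is \<longleftrightarrow> sorted_wrt set_less Is \<or> sorted_wrt (\<lambda>I J. set_less J I) Is"

definition monotonic_adjacent :: "nat \<Rightarrow> nat set list \<Rightarrow> bool" where
  "monotonic_adjacent n Is \<longleftrightarrow>
     set Is \<subseteq> conn n \<and> monotonic Is \<and>
     (\<forall>j. Suc j < length Is \<longrightarrow> adjacent (Is ! j) (Is ! Suc j))"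

text \<open>The element \<open>C\<^bsub>I J\<^esub>\<close> for disjoint connected \<open>I\<close>, \<open>J\<close>, where \<open>C\<close> is the given family indexed by
  connected subsets. The order of \<open>I\<close> and \<open>J\<close> is relevant if there is a hole between them.\<close>

definition C_pair :: "(Cq, 'a) module \<Rightarrow> (nat set \<Rightarrow> 'a) \<Rightarrow> nat set \<Rightarrow> nat set \<Rightarrow> 'a" where
  "C_pair A C I J =
     (if adjacent I J then C (I \<union> J)
      else (let H = hole I J in
        (\<ominus>\<^bsub>A\<^esub> qcomm A (C (I \<union> H)) (C (H \<union> J)))
          \<oplus>\<^bsub>A\<^esub> (C I \<otimes>\<^bsub>A\<^esub> C J) \<oplus>\<^bsub>A\<^esub> (C H \<otimes>\<^bsub>A\<^esub> C (I \<union> H \<union> J))))"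


section \<open>The algebra \<open>aw(n)\<close>\<close>

definition aw_relators :: "nat \<Rightarrow> nat set ncpoly set" where
  "aw_relators n =
    (let F = free_algebra (conn n); C = free_gen; CC = C_pair F C in
      {comm F (C I) (C J) | I J. I \<in> conn n \<and> J \<in> conn n \<and> (I \<inter> J = {} \<or> I \<subseteq> J)}
    \<union> {CC I1 I2 \<ominus>\<^bsub>F\<^esub>
         ((\<ominus>\<^bsub>F\<^esub> qcomm F (CC I2 I3) (CC I1 I3))
           \<oplus>\<^bsub>F\<^esub> (C I1 \<otimes>\<^bsub>F\<^esub> C I2) \<oplus>\<^bsub>F\<^esub> (C I3 \<otimes>\<^bsub>F\<^esub> C (I1 \<union> I2 \<union> I3)))
       | I1 I2 I3. monotonic_adjacent n [I1, I2, I3]}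
    \<union> {CC I1 I4 \<ominus>\<^bsub>F\<^esub>
         ((\<ominus>\<^bsub>F\<^esub> qcomm F (CC I1 I3) (CC I3 I4))
           \<oplus>\<^bsub>F\<^esub> (C I1 \<otimes>\<^bsub>F\<^esub> C I4) \<oplus>\<^bsub>F\<^esub> (C I3 \<otimes>\<^bsub>F\<^esub> CC I1 (I3 \<union> I4)))
       | I1 I2 I3 I4. monotonic_adjacent n [I1, I2, I3, I4]})"

definition aw :: "nat \<Rightarrow> (Cq, nat set ncpoly set) module" where
  "aw n = presented_algebra (conn n) (aw_relators n)"

definition aw_gen :: "nat \<Rightarrow> nat set \<Rightarrow> nat set ncpoly set" where
  "aw_gen n = presented_gen (conn n) (aw_relators n)"


section \<open>Requirements on a sequence of algebras\<close>

text \<open>A sequence \<open>(A\<^sub>n)\<^bsub>n \<ge> 1\<^esub>\<close> is a function \<open>A\<close> on the naturals whose value at \<open>0\<close> is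
  ignored; \<open>C n I\<close> is the generator \<open>C\<^sub>I\<close> of \<open>A n\<close>.\<close>

definition algebra_sequence ::
  "(nat \<Rightarrow> (Cq, 'a) module) \<Rightarrow> (nat \<Rightarrow> nat set \<Rightarrow> 'a) \<Rightarrow> bool" where
  "algebra_sequence A C \<longleftrightarrow>
     (\<forall>n\<ge>1. assoc_algebra (A n) \<and> generated_by (A n) (C n ` conn n))"

definition delta_index :: "nat \<Rightarrow> nat \<Rightarrow> nat \<Rightarrow> nat set" where
  "delta_index a j k =
     (if k < a then {j..k} else if j \<le> a then {j..k + 1} else {j + 1..k + 1})"

definition requirement1 ::
  "(nat \<Rightarrow> (Cq, 'a) module) \<Rightarrow> (nat \<Rightarrow> nat set \<Rightarrow> 'a)
    \<Rightarrow> (nat \<Rightarrow> 'a \<Rightarrow> 'a) \<Rightarrow> (nat \<Rightarrow> nat \<Rightarrow> 'a \<Rightarrow> 'a) \<Rightarrow> bool" where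
  "requirement1 A C \<iota> \<delta> \<longleftrightarrow>
     (\<forall>n\<ge>1.
        \<iota> n \<in> alg_hom (A n) (A (n + 1)) \<and>
        (\<forall>I\<in>conn n. \<iota> n (C n I) = C (n + 1) I) \<and>
        (\<forall>a\<in>{1..n}.
           \<delta> n a \<in> alg_hom (A n) (A (n + 1)) \<and>
           (\<forall>j k. 1 \<le> j \<and> j \<le> k \<and> k \<le> n \<longrightarrow>
              \<delta> n a (C n {j..k}) = C (n + 1) (delta_index a j k))))"

text \<open>\<open>r n i\<close> and \<open>rb n i\<close> are the automorphisms \<open>r\<^sub>i\<close> of \<open>A n\<close> and their inverses. Equalities of
  morphisms are equalities on the carrier.\<close>

definition requirement2 ::
  "(nat \<Rightarrow> (Cq, 'a) module) \<Rightarrow> (nat \<Rightarrow> 'a \<Rightarrow> 'a) \<Rightarrow> (nat \<Rightarrow> nat \<Rightarrow> 'a \<Rightarrow> 'a)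
    \<Rightarrow> (nat \<Rightarrow> nat \<Rightarrow> 'a \<Rightarrow> 'a) \<Rightarrow> (nat \<Rightarrow> nat \<Rightarrow> 'a \<Rightarrow> 'a) \<Rightarrow> bool" where
  "requirement2 A \<iota> \<delta> r rb \<longleftrightarrow>
     (\<forall>n\<ge>1.
        (\<forall>i. 1 \<le> i \<and> i < n \<longrightarrow>
           r n i \<in> alg_aut (A n) \<and> rb n i \<in> alg_aut (A n) \<and>
           (\<forall>x\<in>carrier (A n).
              rb n i (r n i x) = x \<and> r n i (rb n i x) = x \<and>
              \<iota> n (r n i x) = r (n + 1) i (\<iota> n x))) \<and>
        (\<forall>x\<in>carrier (A n).
           (\<forall>i. 1 \<le> i \<and> i \<le> n \<longrightarrow>
              r (n + 1) i (\<delta> n i x) = \<delta> n i x \<and>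
              rb (n + 1) i (\<delta> n i x) = \<delta> n i x) \<and>
           (\<forall>i. 1 \<le> i \<and> i < n \<longrightarrow>
              \<delta> n i (r n i x) = r (n + 1) (i + 1) (r (n + 1) i (\<delta> n (i + 1) x)) \<and>
              rb (n + 1) i (rb (n + 1) (i + 1) (\<delta> n i x)) = \<delta> n (i + 1) (rb n i x) \<and>
              \<delta> n (i + 1) (r n i x) = r (n + 1) i (r (n + 1) (i + 1) (\<delta> n i x)) \<and>
              rb (n + 1) (i + 1) (rb (n + 1) i (\<delta> n (i + 1) x)) = \<delta> n i (rb n i x)) \<and>
           (\<forall>i j. 1 \<le> j \<and> j + 1 < i \<and> i \<le> n \<longrightarrow>
              \<delta> n i (r n j x) = r (n + 1) j (\<delta> n i x) \<and>
              \<delta> n i (rb n j x) = rb (n + 1) j (\<delta> n i x)) \<and>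
           (\<forall>i j. 1 \<le> i \<and> i < j \<and> j < n \<longrightarrow>
              \<delta> n i (r n j x) = r (n + 1) (j + 1) (\<delta> n i x) \<and>
              \<delta> n i (rb n j x) = rb (n + 1) (j + 1) (\<delta> n i x))))"

definition requirement3 ::
  "(nat \<Rightarrow> (Cq, 'a) module) \<Rightarrow> (nat \<Rightarrow> nat set \<Rightarrow> 'a) \<Rightarrow> (nat \<Rightarrow> nat \<Rightarrow> 'a \<Rightarrow> 'a) \<Rightarrow> bool" where
  "requirement3 A C r \<longleftrightarrow>
     (\<forall>x\<in>carrier (A 2). \<forall>y\<in>carrier (A 2). x \<otimes>\<^bsub>A 2\<^esub> y = y \<otimes>\<^bsub>A 2\<^esub> x) \<and>
     r 2 1 (C 2 {1}) = C 2 {2} \<and> r 2 1 (C 2 {2}) = C 2 {1}"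

definition requirement4 ::
  "(nat \<Rightarrow> (Cq, 'a) module) \<Rightarrow> (nat \<Rightarrow> nat set \<Rightarrow> 'a) \<Rightarrow> (nat \<Rightarrow> nat \<Rightarrow> 'a \<Rightarrow> 'a)
    \<Rightarrow> (nat \<Rightarrow> nat \<Rightarrow> 'a \<Rightarrow> 'a) \<Rightarrow> bool" where
  "requirement4 A C r rb \<longleftrightarrow>
     r 3 1 (C 3 {2..3}) =
       (\<ominus>\<^bsub>A 3\<^esub> qcomm (A 3) (C 3 {1..2}) (C 3 {2..3}))
         \<oplus>\<^bsub>A 3\<^esub> (C 3 {1} \<otimes>\<^bsub>A 3\<^esub> C 3 {3}) \<oplus>\<^bsub>A 3\<^esub> (C 3 {2} \<otimes>\<^bsub>A 3\<^esub> C 3 {1..3}) \<and>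
     rb 3 1 (C 3 {2..3}) =
       (\<ominus>\<^bsub>A 3\<^esub> qcomm (A 3) (C 3 {2..3}) (C 3 {1..2}))
         \<oplus>\<^bsub>A 3\<^esub> (C 3 {1} \<otimes>\<^bsub>A 3\<^esub> C 3 {3}) \<oplus>\<^bsub>A 3\<^esub> (C 3 {2} \<otimes>\<^bsub>A 3\<^esub> C 3 {1..3})"

definition requirements ::
  "(nat \<Rightarrow> (Cq, 'a) module) \<Rightarrow> (nat \<Rightarrow> nat set \<Rightarrow> 'a) \<Rightarrow> bool" where
  "requirements A C \<longleftrightarrow>
     (\<exists>\<iota> \<delta> r rb. requirement1 A C \<iota> \<delta> \<and> requirement2 A \<iota> \<delta> r rb \<and>
        requirement3 A C r \<and> requirement4 A C r rb)"

end

theory Submission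
  imports Defs
begin

text \<open>View \<open>C\<^bsub>a+1\<dots>b\<^esub>\<close> as a chord between the points \<open>a\<close> and \<open>b\<close> among \<open>0, \<dots>, n\<close> on a circle, with trivial chords equal to \<open>1\<close>. Then
  (i) says that noncrossing chords commute, and (ii), (iii) say that any five points in weak cyclic order satisfy one
  cubic relation, whose instances for rotated or reflected points follow from each other.

  Sufficiency. \<open>r\<^sub>p\<close> fixes the chords avoiding \<open>p\<close> and replaces \<open>x = C(p,b)\<close> by the combination \<open>x'\<close> prescribed by
  requirement (4), where \<open>K\<close> joins the neighbours of \<open>p\<close>. The new chords satisfy the relations again: this is linear in the
  old relations unless two chords at \<open>p\<close> get multiplied; those cases reduce by rotation to the relation on four points
  and to commutativity, which both follow from the formula for \<open>[x',K]\<^sub>q\<close> in the old chords. All identities in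
  requirement (2) can then be compared on generators; the braiding ones are again instances of the five point relation.

  Necessity. In \<open>A\<^sub>3\<close> the orbits of the generators under \<open>r\<^sub>1, r\<^sub>2\<close> yield (i) and (ii). In \<open>A\<^sub>4\<close> the identity
  \<open>\<delta>\<^sub>1 P = r\<^sub>1 r\<^sub>2 \<delta>\<^sub>3 P\<close> for \<open>P = r\<^sub>1 C\<^bsub>23\<^esub>\<close> and its barred version are rotations of (iii). Finally \<open>r\<^sub>1 \<cdots> r\<^sub>n \<iota>\<close> is the index shift,
  so every increasing map of points \<open>{0..k} \<rightarrow> {0..n}\<close> induces a morphism \<open>A\<^sub>k \<rightarrow> A\<^sub>n\<close>, which transports the relations.\<close>

section \<open>Unital associative algebras\<close>

text \<open>The obstacle is the product of two chords at p. Moving the q-bracket with K from one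
  twisted factor to the other leaves a multiple of the commutator of K with [f', g], where neither
  f' nor g need commute with K. So the relation on four points needs a proof that a certain
  combination of such commutators commutes with K. After multiplication by mu^2 + (1 - mu)^2, where
  mu = q / (q - 1/q), the combination becomes a polynomial in elements that visibly commute with K;
  this is where q^4 + 1 must be invertible. The invertibility of q^2 + 1 is needed when a relation
  is compared with its reflection.

  Replacing mu by 1 - mu is the substitution q -> 1/q. It exchanges the arguments of the bracket, so
  that everything proved for r_p also holds for its inverse.

  The computations take place in a type of class ring. All aw(k) are therefore components of one
  product ring; each has its own identity, which is the \<open>e\<close> of the chord locales. An
  arbitrary sequence (A_n) lives on another type and is reached only by morphisms out of presented
  algebras.\<close>

locale assoc_alg =
  fixes A :: "(Cq, 'a) module" (structure)
  assumes assoc: "assoc_algebra A"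

sublocale assoc_alg \<subseteq> ring A
  using assoc by (simp add: assoc_algebra_def)

sublocale assoc_alg \<subseteq> M: module "ring_of_type_algebra :: Cq ring" A
  using assoc by (simp add: assoc_algebra_def)

context assoc_alg
begin

lemma smult_carrier [simp, intro]: "x \<in> carrier A \<Longrightarrow> k \<odot> x \<in> carrier A"
  using M.smult_closed[of k x] by (simp add: ring_of_type_algebra_def)

lemma smult_add_scalar: "x \<in> carrier A \<Longrightarrow> (k + l) \<odot> x = k \<odot> x \<oplus> l \<odot> x"
  using M.smult_l_distr[of k l x] by (simp add: ring_of_type_algebra_def)

lemma smult_add: "x \<in> carrier A \<Longrightarrow> y \<in> carrier A \<Longrightarrow> k \<odot> (x \<oplus> y) = k \<odot> x \<oplus> k \<odot> y"
  using M.smult_r_distr[of k x y] by (simp add: ring_of_type_algebra_def)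

lemma smult_smult: "x \<in> carrier A \<Longrightarrow> k \<odot> (l \<odot> x) = (k * l) \<odot> x"
  using M.smult_assoc1[of k l x] by (simp add: ring_of_type_algebra_def)

lemma smult_1 [simp]: "x \<in> carrier A \<Longrightarrow> 1 \<odot> x = x"
  using M.smult_one[of x] by (simp add: ring_of_type_algebra_def)

lemma mult_smult_left: "x \<in> carrier A \<Longrightarrow> y \<in> carrier A \<Longrightarrow> (k \<odot> x) \<otimes> y = k \<odot> (x \<otimes> y)"
  and mult_smult_right: "x \<in> carrier A \<Longrightarrow> y \<in> carrier A \<Longrightarrow> x \<otimes> (k \<odot> y) = k \<odot> (x \<otimes> y)"
  using assoc by (simp_all add: assoc_algebra_def)

lemma smult_0 [simp]: "x \<in> carrier A \<Longrightarrow> 0 \<odot> x = \<zero>"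
  using smult_add_scalar[of x 0 0] by (metis add.l_cancel_one' add_0 smult_carrier)

lemma smult_zero [simp]: "k \<odot> \<zero> = \<zero>"
  using smult_add[of \<zero> \<zero> k] by (metis add.l_cancel_one' l_zero smult_carrier zero_closed)

lemma comm_carrier [simp, intro]: "x \<in> carrier A \<Longrightarrow> y \<in> carrier A \<Longrightarrow> comm A x y \<in> carrier A"
  and qcomm_carrier [simp, intro]: "x \<in> carrier A \<Longrightarrow> y \<in> carrier A \<Longrightarrow> qcomm A x y \<in> carrier A"
  by (simp_all add: comm_def qcomm_def)

lemma comm_zero_iff: "x \<in> carrier A \<Longrightarrow> y \<in> carrier A \<Longrightarrow> comm A x y = \<zero> \<longleftrightarrow> x \<otimes> y = y \<otimes> x"
  by (simp add: comm_def)

end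

lemma qq_nonzero: "qq \<noteq> 0"
  by (simp add: qq_def Fract_conv_to_fract)

lemma qq_diff_nonzero: "qq - inverse qq \<noteq> 0"
proof
  assume "qq - inverse qq = 0"
  then have "qq * qq = 1" using qq_nonzero by (simp add: field_simps)
  then have "Fract ([:0, 1:] * [:0, 1:]) 1 = Fract (1 :: complex poly) 1"
    unfolding qq_def by (simp add: One_fract_def)
  then show False by (simp add: eq_fract one_pCons)
qed

lemma alg_homE:
  assumes "f \<in> alg_hom A B"
  shows "f \<in> ring_hom A B" "x \<in> carrier A \<Longrightarrow> f (k \<odot>\<^bsub>A\<^esub> x) = k \<odot>\<^bsub>B\<^esub> f x"
    "x \<in> carrier A \<Longrightarrow> f x \<in> carrier B"
    "x \<in> carrier A \<Longrightarrow> y \<in> carrier A \<Longrightarrow> f (x \<otimes>\<^bsub>A\<^esub> y) = f x \<otimes>\<^bsub>B\<^esub> f y"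
    "x \<in> carrier A \<Longrightarrow> y \<in> carrier A \<Longrightarrow> f (x \<oplus>\<^bsub>A\<^esub> y) = f x \<oplus>\<^bsub>B\<^esub> f y"
    "f \<one>\<^bsub>A\<^esub> = \<one>\<^bsub>B\<^esub>"
  using assms unfolding alg_hom_def ring_hom_def by auto

lemma alg_hom_trans:
  assumes "f \<in> alg_hom A B" "g \<in> alg_hom B C"
  shows "g \<circ> f \<in> alg_hom A C"
  using assms ring_hom_trans[of f A B g C] ring_hom_closed[of f A B] unfolding alg_hom_def by auto

locale alg_morphism = A: assoc_alg A + B: assoc_alg B for A :: "(Cq, 'a) module" and B :: "(Cq, 'b) module" +
  fixes f :: "'a \<Rightarrow> 'b"
  assumes hom: "f \<in> alg_hom A B"
begin

lemmas hom_simps = alg_homE(2-6)[OF hom]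

lemma hom_zero: "f \<zero>\<^bsub>A\<^esub> = \<zero>\<^bsub>B\<^esub>"
  by (rule ring_hom_zero[OF alg_homE(1)[OF hom] A.ring_axioms B.ring_axioms])

lemma hom_uminus: "x \<in> carrier A \<Longrightarrow> f (\<ominus>\<^bsub>A\<^esub> x) = \<ominus>\<^bsub>B\<^esub> f x"
  by (metis hom_simps(2,4) hom_zero A.add.inv_closed B.add.inv_equality A.l_neg)

lemma hom_minus: "x \<in> carrier A \<Longrightarrow> y \<in> carrier A \<Longrightarrow> f (x \<ominus>\<^bsub>A\<^esub> y) = f x \<ominus>\<^bsub>B\<^esub> f y"
  by (simp add: a_minus_def hom_simps hom_uminus)

lemma hom_comm: "x \<in> carrier A \<Longrightarrow> y \<in> carrier A \<Longrightarrow> f (comm A x y) = comm B (f x) (f y)"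
  by (simp add: comm_def hom_simps hom_minus)

lemma hom_qcomm: "x \<in> carrier A \<Longrightarrow> y \<in> carrier A \<Longrightarrow> f (qcomm A x y) = qcomm B (f x) (f y)"
  by (simp add: qcomm_def hom_simps hom_minus)

lemma subalg_image: "subalg (f ` carrier A) B"
  unfolding subalg_def
proof
  show "subring (f ` carrier A) B"
  proof (rule B.subringI)
    show "f ` carrier A \<subseteq> carrier B" using hom_simps by auto
    show "\<one>\<^bsub>B\<^esub> \<in> f ` carrier A" using hom_simps(5) by (metis A.one_closed imageI)
    show "\<ominus>\<^bsub>B\<^esub> h \<in> f ` carrier A" if "h \<in> f ` carrier A" for h
      using that by (auto simp flip: hom_uminus)
    show "h1 \<otimes>\<^bsub>B\<^esub> h2 \<in> f ` carrier A" "h1 \<oplus>\<^bsub>B\<^esub> h2 \<in> f ` carrier A"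
      if "h1 \<in> f ` carrier A" "h2 \<in> f ` carrier A" for h1 h2
      using that by (auto simp flip: hom_simps(3,4))
  qed
  show "\<forall>c. \<forall>x\<in>f ` carrier A. c \<odot>\<^bsub>B\<^esub> x \<in> f ` carrier A"
    by (auto simp flip: hom_simps(1))
qed

lemma surjective_if_generated:
  assumes "generated_by B G" "G \<subseteq> f ` carrier A"
  shows "f ` carrier A = carrier B"
proof
  show "f ` carrier A \<subseteq> carrier B" using hom_simps by auto
  show "carrier B \<subseteq> f ` carrier A"
    using assms subalg_image unfolding generated_by_def by blast
qed

end

text \<open>The equalizer of two morphisms is a subalgebra. All identities between morphisms are
  checked on generators through this fact.\<close>

lemma alg_hom_eqI:
  assumes A: "assoc_algebra A" and B: "assoc_algebra B" and gen: "generated_by A G" and f: "f \<in> alg_hom A B" and g: "g \<in> alg_hom A B"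
    and eq: "\<And>x. x \<in> G \<Longrightarrow> f x = g x" and x: "x \<in> carrier A"
  shows "f x = g x"
proof -
  interpret f: alg_morphism A B f using A B f by unfold_locales
  interpret g: alg_morphism A B g using A B g by unfold_locales
  let ?S = "{x \<in> carrier A. f x = g x}"
  have "subalg ?S A"
    unfolding subalg_def
    by (auto intro!: f.A.subringI simp: f.hom_simps g.hom_simps f.hom_uminus g.hom_uminus)
  moreover have "G \<subseteq> ?S" using eq gen unfolding generated_by_def by auto
  ultimately have "carrier A \<subseteq> ?S" using gen unfolding generated_by_def by blast
  with x show ?thesis by blast
qed

text \<open>Centralizers are subalgebras. The argument is applied twice: everything commutes with
  the generators, hence the generators, and then everything, commute with the whole algebra.\<close>

lemma commutative_if_generated:
  assumes A: "assoc_algebra A" and gen: "generated_by A G"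
    and G: "\<And>x y. x \<in> G \<Longrightarrow> y \<in> G \<Longrightarrow> x \<otimes>\<^bsub>A\<^esub> y = y \<otimes>\<^bsub>A\<^esub> x"
    and x: "x \<in> carrier A" "y \<in> carrier A"
  shows "x \<otimes>\<^bsub>A\<^esub> y = y \<otimes>\<^bsub>A\<^esub> x"
proof -
  interpret assoc_alg A by unfold_locales (rule A)
  define Z where "Z H = {x \<in> carrier A. \<forall>y\<in>H. x \<otimes>\<^bsub>A\<^esub> y = y \<otimes>\<^bsub>A\<^esub> x}" for H
  have Z: "subalg (Z H) A" if "H \<subseteq> carrier A" for H
    unfolding subalg_def
  proof
    show "subring (Z H) A"
    proof (rule subringI)
      show "\<ominus>\<^bsub>A\<^esub> h \<in> Z H" if "h \<in> Z H" for h
        using that \<open>H \<subseteq> carrier A\<close> unfolding Z_def by (auto simp: l_minus r_minus)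
      show "h1 \<otimes>\<^bsub>A\<^esub> h2 \<in> Z H" if "h1 \<in> Z H" "h2 \<in> Z H" for h1 h2
        using that \<open>H \<subseteq> carrier A\<close> unfolding Z_def by (auto simp: subset_iff) (metis m_assoc)
    qed (use that in \<open>auto simp: Z_def l_distr r_distr subset_iff\<close>)
    show "\<forall>c. \<forall>x\<in>Z H. c \<odot>\<^bsub>A\<^esub> x \<in> Z H"
      using that unfolding Z_def by (auto simp: mult_smult_left mult_smult_right subset_iff)
  qed
  have GA: "G \<subseteq> carrier A" using gen unfolding generated_by_def by auto
  have min: "carrier A \<subseteq> Z H" if "G \<subseteq> Z H" "H \<subseteq> carrier A" for H
    using gen that Z[OF that(2)] unfolding generated_by_def by blast
  have "carrier A \<subseteq> Z G" by (rule min) (use G GA in \<open>auto simp: Z_def\<close>)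
  then have "carrier A \<subseteq> Z (carrier A)" using GA by (intro min) (auto simp: Z_def)
  with x show ?thesis unfolding Z_def by blast
qed

section \<open>Free algebras and presentations\<close>

lemma poly_mapping_sum_single:
  "(\<Sum>x\<in>Poly_Mapping.keys p. Poly_Mapping.single x (Poly_Mapping.lookup p x)) = p"
proof (rule poly_mapping_eqI)
  fix k
  have "Poly_Mapping.lookup (\<Sum>x\<in>Poly_Mapping.keys p. Poly_Mapping.single x (Poly_Mapping.lookup p x)) k
    = (\<Sum>x\<in>Poly_Mapping.keys p. if x = k then Poly_Mapping.lookup p x else 0)"
    unfolding lookup_sum lookup_single when_def ..
  also have "\<dots> = Poly_Mapping.lookup p k"
    by (simp add: not_in_keys_iff_lookup_eq_zero)
  finally show "Poly_Mapping.lookup (\<Sum>x\<in>Poly_Mapping.keys p. Poly_Mapping.single x (Poly_Mapping.lookup p x)) k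
    = Poly_Mapping.lookup p k" .
qed

text \<open>Scalars sit on the empty word, the neutral element of the monoid, so they commute with
  each single term.\<close>

lemma scale_central: "Poly_Mapping.single 0 k * (p * q) = p * (Poly_Mapping.single 0 k * q)"
  for p q :: "'x ncpoly"
proof -
  have "Poly_Mapping.single 0 k * p = p * Poly_Mapping.single 0 k"
  proof -
    have 1: "Poly_Mapping.single 0 k * sum f Y = sum f Y * Poly_Mapping.single 0 k"
      if "finite Y" "\<And>x. x \<in> Y \<Longrightarrow> f x = Poly_Mapping.single x (Poly_Mapping.lookup p x)" for f Y
      unfolding sum_distrib_left sum_distrib_right
      by (rule sum.cong) (auto simp: that mult_single mult.commute)
    from 1[OF finite_keys[of p] refl] show ?thesis by (simp add: poly_mapping_sum_single)
  qed
  then show ?thesis by (simp only: mult.assoc[symmetric])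
qed

lemma free_algebra_simps:
  "carrier (free_algebra S) = {p. \<forall>w\<in>Poly_Mapping.keys p. set (letters w) \<subseteq> S}"
  "p \<otimes>\<^bsub>free_algebra S\<^esub> q = p * q" "p \<oplus>\<^bsub>free_algebra S\<^esub> q = p + q" "\<one>\<^bsub>free_algebra S\<^esub> = 1"
  "\<zero>\<^bsub>free_algebra S\<^esub> = 0" "k \<odot>\<^bsub>free_algebra S\<^esub> p = Poly_Mapping.single 0 k * p"
  by (simp_all add: free_algebra_def)

lemma free_carrier_closed:
  "1 \<in> carrier (free_algebra S)" "0 \<in> carrier (free_algebra S)"
  "p \<in> carrier (free_algebra S) \<Longrightarrow> q \<in> carrier (free_algebra S) \<Longrightarrow> p + q \<in> carrier (free_algebra S)"
  "p \<in> carrier (free_algebra S) \<Longrightarrow> - p \<in> carrier (free_algebra S)"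
  "p \<in> carrier (free_algebra S) \<Longrightarrow> q \<in> carrier (free_algebra S) \<Longrightarrow> p * q \<in> carrier (free_algebra S)"
  "p \<in> carrier (free_algebra S) \<Longrightarrow> Poly_Mapping.single 0 k * p \<in> carrier (free_algebra S)"
proof -
  show "1 \<in> carrier (free_algebra S)" "0 \<in> carrier (free_algebra S)"
    by (auto simp: free_algebra_simps zero_free_monoid_def)
  show "p \<in> carrier (free_algebra S) \<Longrightarrow> q \<in> carrier (free_algebra S) \<Longrightarrow> p + q \<in> carrier (free_algebra S)" for p q
    using keys_add[of p q] by (auto simp: free_algebra_simps)
  show "p \<in> carrier (free_algebra S) \<Longrightarrow> - p \<in> carrier (free_algebra S)"
    by (auto simp: free_algebra_simps in_keys_iff)
  show m: "p \<in> carrier (free_algebra S) \<Longrightarrow> q \<in> carrier (free_algebra S) \<Longrightarrow> p * q \<in> carrier (free_algebra S)" for p q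
    using keys_mult[of p q] by (fastforce simp: free_algebra_simps plus_free_monoid_def)
  have "Poly_Mapping.single 0 k \<in> carrier (free_algebra S)"
    by (auto simp: free_algebra_simps zero_free_monoid_def)
  then show "p \<in> carrier (free_algebra S) \<Longrightarrow> Poly_Mapping.single 0 k * p \<in> carrier (free_algebra S)"
    by (rule m)
qed

lemma assoc_algebra_free: "assoc_algebra (free_algebra S)"
proof -
  have ab: "abelian_group (free_algebra S)"
    by (rule abelian_groupI) (use free_carrier_closed in \<open>auto simp: free_algebra_simps(2-5) algebra_simps
      intro!: bexI[of _ "- x" for x]\<close>)
  moreover have "monoid (free_algebra S)"
    by (rule monoidI) (use free_carrier_closed in \<open>auto simp: free_algebra_simps(2-5) mult.assoc\<close>)
  ultimately have "ring (free_algebra S)"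
    by (rule ringI) (auto simp: free_algebra_simps(2-5) algebra_simps)
  moreover have "module ring_of_type_algebra (free_algebra S)"
    by (rule moduleI[OF cring_from_type_algebra ab])
      (use free_carrier_closed in \<open>auto simp: free_algebra_simps(2-6) ring_of_type_algebra_def algebra_simps
         single_add mult_single mult.assoc[symmetric]\<close>)
  ultimately show ?thesis
    unfolding assoc_algebra_def free_algebra_simps(2,6) by (auto simp: mult.assoc scale_central[symmetric])
qed

lemma free_gen_carrier: "x \<in> S \<Longrightarrow> free_gen x \<in> carrier (free_algebra S)"
  by (simp add: free_gen_def free_algebra_simps)

lemma free_induct [consumes 1, case_names single add]:
  assumes "p \<in> carrier (free_algebra S)"
    and single: "\<And>xs k. set xs \<subseteq> S \<Longrightarrow> P (Poly_Mapping.single (Word xs) k)"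
    and add: "\<And>p q. p \<in> carrier (free_algebra S) \<Longrightarrow> q \<in> carrier (free_algebra S) \<Longrightarrow> P p \<Longrightarrow> P q \<Longrightarrow> P (p + q)"
  shows "P p"
proof -
  have "P (sum (\<lambda>x. Poly_Mapping.single x (Poly_Mapping.lookup p x)) Y) \<and>
      sum (\<lambda>x. Poly_Mapping.single x (Poly_Mapping.lookup p x)) Y \<in> carrier (free_algebra S)"
    if "finite Y" "Y \<subseteq> Poly_Mapping.keys p" for Y
    using that
  proof (induction Y rule: finite_induct)
    case empty
    show ?case using single[of "[]" 0] by (simp add: free_carrier_closed)
  next
    case (insert x Y)
    obtain xs where x: "x = Word xs" by (cases x)
    have xs: "set xs \<subseteq> S" using insert.prems assms(1) unfolding x free_algebra_simps by force
    then have c: "Poly_Mapping.single x (Poly_Mapping.lookup p x) \<in> carrier (free_algebra S)"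
      by (simp add: free_algebra_simps x)
    have "P (Poly_Mapping.single x (Poly_Mapping.lookup p x))" unfolding x by (rule single) (rule xs)
    then show ?case using insert c add free_carrier_closed(3) by auto
  qed
  from this[of "Poly_Mapping.keys p"] have "P (sum (\<lambda>x. Poly_Mapping.single x (Poly_Mapping.lookup p x)) (Poly_Mapping.keys p))"
    by simp
  also have "sum (\<lambda>x. Poly_Mapping.single x (Poly_Mapping.lookup p x)) (Poly_Mapping.keys p) = p"
    by (rule poly_mapping_sum_single)
  finally show ?thesis .
qed

lemma free_generated: "generated_by (free_algebra S) (free_gen ` S)"
  unfolding generated_by_def
proof (rule conjI)
  show gens: "free_gen ` S \<subseteq> carrier (free_algebra S)" by (auto intro: free_gen_carrier)
  interpret assoc_alg "free_algebra S" by unfold_locales (rule assoc_algebra_free)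
  have "p \<in> T" if T: "subalg T (free_algebra S)" "free_gen ` S \<subseteq> T" and p: "p \<in> carrier (free_algebra S)" for p T
    using p
  proof (induction rule: free_induct)
    case (single xs k)
    note Tc = subringE(3,6,7)[OF T(1)[unfolded subalg_def, THEN conjunct1], unfolded free_algebra_simps(2-5)]
    have "Poly_Mapping.single (Word xs) 1 \<in> T" using single
    proof (induction xs)
      case Nil then show ?case using Tc(1) by (simp flip: zero_free_monoid_def)
    next
      case (Cons x xs)
      have "Poly_Mapping.single (Word (x # xs)) 1 = free_gen x * Poly_Mapping.single (Word xs) (1 :: Cq)"
        by (simp add: free_gen_def mult_single plus_free_monoid_def)
      then show ?case using Cons T(2) Tc(2) by auto
    qed
    then have "k \<odot>\<^bsub>free_algebra S\<^esub> Poly_Mapping.single (Word xs) 1 \<in> T" using T(1) unfolding subalg_def by blast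
    then show ?case by (simp add: free_algebra_simps mult_single)
  next
    case (add p q)
    then show ?case using subringE(7)[OF T(1)[unfolded subalg_def, THEN conjunct1]] by (simp add: free_algebra_simps)
  qed
  moreover have "subalg (carrier (free_algebra S)) (free_algebra S)"
    unfolding subalg_def using carrier_is_subring by auto
  ultimately show "\<Inter> {T. subalg T (free_algebra S) \<and> free_gen ` S \<subseteq> T} = carrier (free_algebra S)"
    using gens by (intro equalityI Inter_greatest Inter_lower) auto
qed

section \<open>Evaluation of noncommutative polynomials: the universal property of the free
  algebra\<close>

context assoc_alg
begin

definition word_val :: "('x \<Rightarrow> 'a) \<Rightarrow> 'x free_monoid \<Rightarrow> 'a" where
  "word_val g w = foldr (\<lambda>x y. g x \<otimes> y) (letters w) \<one>"

definition poly_val :: "('x \<Rightarrow> 'a) \<Rightarrow> 'x ncpoly \<Rightarrow> 'a" where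
  "poly_val g p = (\<Oplus>w\<in>Poly_Mapping.keys p. Poly_Mapping.lookup p w \<odot> word_val g w)"

context
  fixes S :: "'x set" and g :: "'x \<Rightarrow> 'a"
  assumes g: "\<And>x. x \<in> S \<Longrightarrow> g x \<in> carrier A"
begin

lemma word_val_carrier:
  assumes "set (letters w) \<subseteq> S"
  shows "word_val g w \<in> carrier A"
proof -
  have "foldr (\<lambda>x y. g x \<otimes> y) xs \<one> \<in> carrier A" if "set xs \<subseteq> S" for xs
    using that by (induction xs) (simp_all add: g)
  from this[OF assms] show ?thesis unfolding word_val_def .
qed

lemma word_val_plus:
  assumes "set (letters v) \<subseteq> S" "set (letters w) \<subseteq> S"
  shows "word_val g (v + w) = word_val g v \<otimes> word_val g w"
proof -
  have "foldr (\<lambda>x y. g x \<otimes> y) (xs @ ys) \<one> = foldr (\<lambda>x y. g x \<otimes> y) xs \<one> \<otimes> foldr (\<lambda>x y. g x \<otimes> y) ys \<one>"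
    if "set xs \<subseteq> S" "set ys \<subseteq> S" for xs ys
    using that(1)
  proof (induction xs)
    case Nil
    then show ?case using word_val_carrier[of "Word ys"] that by (simp add: word_val_def)
  next
    case (Cons x xs)
    then show ?case using word_val_carrier[of "Word ys"] word_val_carrier[of "Word xs"] that g
      by (simp add: word_val_def m_assoc)
  qed
  from this[OF assms] show ?thesis by (simp add: word_val_def plus_free_monoid_def)
qed

text \<open>Words with coefficient 0 may be added to the index set; this lets the values of
  polynomials with different supports be summed over a common set.\<close>

lemma poly_val_superset:
  assumes p: "p \<in> carrier (free_algebra S)" and T: "finite T" "Poly_Mapping.keys p \<subseteq> T" "\<And>w. w \<in> T \<Longrightarrow> set (letters w) \<subseteq> S"
  shows "poly_val g p = (\<Oplus>w\<in>T. Poly_Mapping.lookup p w \<odot> word_val g w)"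
  unfolding poly_val_def
  by (rule add.finprod_mono_neutral_cong_left) (use T word_val_carrier in \<open>auto simp: in_keys_iff\<close>)

lemma poly_val_carrier: "p \<in> carrier (free_algebra S) \<Longrightarrow> poly_val g p \<in> carrier A"
  unfolding poly_val_def by (rule finsum_closed) (auto simp: free_algebra_simps word_val_carrier)

lemma poly_val_add:
  assumes "p \<in> carrier (free_algebra S)" "q \<in> carrier (free_algebra S)"
  shows "poly_val g (p + q) = poly_val g p \<oplus> poly_val g q"
proof -
  let ?T = "Poly_Mapping.keys p \<union> Poly_Mapping.keys q"
  have T: "finite ?T" "set (letters w) \<subseteq> S" if "w \<in> ?T" for w
    using assms that by (auto simp: free_algebra_simps)
  have fin: "finite ?T" by simp
  have 1: "poly_val g p = (\<Oplus>w\<in>?T. Poly_Mapping.lookup p w \<odot> word_val g w)"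
    "poly_val g q = (\<Oplus>w\<in>?T. Poly_Mapping.lookup q w \<odot> word_val g w)"
    "poly_val g (p + q) = (\<Oplus>w\<in>?T. Poly_Mapping.lookup (p + q) w \<odot> word_val g w)"
    using assms T keys_add[of p q] free_carrier_closed(3)[OF assms] fin by (intro poly_val_superset; blast)+
  show ?thesis
    unfolding 1 by (subst finsum_addf[symmetric]; (rule finsum_cong')?) (auto simp: lookup_add smult_add_scalar word_val_carrier T)
qed

lemma poly_val_single: "set xs \<subseteq> S \<Longrightarrow> poly_val g (Poly_Mapping.single (Word xs) k) = k \<odot> word_val g (Word xs)"
  unfolding poly_val_def using word_val_carrier[of "Word xs"] by (cases "k = 0") simp_all

lemma poly_val_mult:
  assumes "p \<in> carrier (free_algebra S)" "q \<in> carrier (free_algebra S)"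
  shows "poly_val g (p * q) = poly_val g p \<otimes> poly_val g q"
  using assms(1)
proof (induction rule: free_induct)
  case (single xs k)
  have sc: "Poly_Mapping.single (Word xs) k \<in> carrier (free_algebra S)" using single by (simp add: free_algebra_simps)
  show ?case using assms(2)
  proof (induction rule: free_induct)
    case (single ys l)
    then have "Poly_Mapping.single (Word xs) k * Poly_Mapping.single (Word ys) l = Poly_Mapping.single (Word (xs @ ys)) (k * l)"
      by (simp add: mult_single plus_free_monoid_def)
    moreover have "word_val g (Word (xs @ ys)) = word_val g (Word xs) \<otimes> word_val g (Word ys)"
      using word_val_plus[of "Word xs" "Word ys"] single \<open>set xs \<subseteq> S\<close> by (simp add: plus_free_monoid_def)
    ultimately show ?case
      using single \<open>set xs \<subseteq> S\<close> word_val_carrier[of "Word xs"] word_val_carrier[of "Word ys"]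
      by (simp add: poly_val_single mult_smult_left mult_smult_right smult_smult mult.commute)
  next
    case (add p q)
    then show ?case using sc
      by (simp add: distrib_left poly_val_add free_carrier_closed r_distr poly_val_carrier)
  qed
next
  case (add p q)
  then show ?case using assms(2)
    by (simp add: distrib_right poly_val_add free_carrier_closed l_distr poly_val_carrier)
qed

lemma poly_val_hom: "poly_val g \<in> alg_hom (free_algebra S) A"
proof -
  have k: "poly_val g (Poly_Mapping.single 0 k) = k \<odot> \<one>" for k
    using poly_val_single[of "[]" k] by (simp add: zero_free_monoid_def word_val_def)
  have "Poly_Mapping.single 0 k \<in> carrier (free_algebra S)" for k :: Cq
    by (auto simp: free_algebra_simps zero_free_monoid_def)
  then have "poly_val g (Poly_Mapping.single 0 k * p) = k \<odot> poly_val g p" if "p \<in> carrier (free_algebra S)" for k p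
    using that by (simp add: poly_val_mult k mult_smult_left poly_val_carrier)
  moreover have "poly_val g \<in> ring_hom (free_algebra S) A"
    by (rule ring_hom_memI)
      (use k[of 1] in \<open>simp_all add: free_algebra_simps(2-5) poly_val_mult poly_val_add poly_val_carrier\<close>)
  ultimately show ?thesis unfolding alg_hom_def by (simp add: free_algebra_simps(6))
qed

lemma poly_val_gen: "x \<in> S \<Longrightarrow> poly_val g (free_gen x) = g x"
  using poly_val_single[of "[x]" 1] g by (simp add: free_gen_def word_val_def)

end

end

section \<open>Quotients by two-sided ideals\<close>

lemma quot_algebra_simps:
  "carrier (quot_algebra F I) = carrier (F Quot I)" "T \<otimes>\<^bsub>quot_algebra F I\<^esub> U = T \<otimes>\<^bsub>F Quot I\<^esub> U"
  "T \<oplus>\<^bsub>quot_algebra F I\<^esub> U = T \<oplus>\<^bsub>F Quot I\<^esub> U" "\<one>\<^bsub>quot_algebra F I\<^esub> = \<one>\<^bsub>F Quot I\<^esub>"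
  "\<zero>\<^bsub>quot_algebra F I\<^esub> = \<zero>\<^bsub>F Quot I\<^esub>"
  "k \<odot>\<^bsub>quot_algebra F I\<^esub> T = (I +>\<^bsub>F\<^esub> (k \<odot>\<^bsub>F\<^esub> \<one>\<^bsub>F\<^esub>)) \<otimes>\<^bsub>F Quot I\<^esub> T"
  by (simp_all add: quot_algebra_def)

locale alg_ideal = assoc_alg F + I: ideal I F for F :: "(Cq, 'a) module" and I
begin

abbreviation proj :: "'a \<Rightarrow> 'a set" where "proj x \<equiv> I +>\<^bsub>F\<^esub> x"

sublocale Q: ring "F Quot I" by (rule I.quotient_is_ring)

lemma proj_hom: "proj \<in> ring_hom F (F Quot I)" by (rule I.rcos_ring_hom)

lemmas proj_simps = ring_hom_memE[OF proj_hom]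

lemma quot_carrierE: assumes "T \<in> carrier (F Quot I)" obtains x where "x \<in> carrier F" "T = proj x"
  using assms unfolding FactRing_simps by auto

lemma proj_smult: "x \<in> carrier F \<Longrightarrow> proj (k \<odot>\<^bsub>F\<^esub> x) = k \<odot>\<^bsub>quot_algebra F I\<^esub> proj x"
  by (simp add: quot_algebra_simps proj_simps(2)[symmetric] mult_smult_left)

lemma assoc_algebra_quot: "assoc_algebra (quot_algebra F I)"
proof -
  have ab: "abelian_group (quot_algebra F I)"
    by (rule abelian_groupI) (auto simp: quot_algebra_simps Q.a_ac Q.l_neg
      intro!: bexI[of _ "\<ominus>\<^bsub>F Quot I\<^esub> x" for x])
  moreover have "monoid (quot_algebra F I)"
    by (rule monoidI) (auto simp: quot_algebra_simps Q.m_assoc)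
  ultimately have "ring (quot_algebra F I)"
    by (rule ringI) (auto simp: quot_algebra_simps Q.l_distr Q.r_distr)
  moreover have "module ring_of_type_algebra (quot_algebra F I)"
  proof (rule moduleI[OF cring_from_type_algebra ab])
    fix k l :: Cq and T U
    have one: "k \<odot>\<^bsub>F\<^esub> \<one>\<^bsub>F\<^esub> \<in> carrier F" for k by simp
    assume "T \<in> carrier (quot_algebra F I)"
    then obtain x where x: "x \<in> carrier F" "T = proj x" by (auto simp: quot_algebra_simps elim: quot_carrierE)
    show "k \<odot>\<^bsub>quot_algebra F I\<^esub> T \<in> carrier (quot_algebra F I)"
      unfolding x(2) proj_smult[OF x(1), symmetric] using x(1) by (simp add: quot_algebra_simps proj_simps)
    show "(k \<oplus>\<^bsub>ring_of_type_algebra\<^esub> l) \<odot>\<^bsub>quot_algebra F I\<^esub> T = k \<odot>\<^bsub>quot_algebra F I\<^esub> T \<oplus>\<^bsub>quot_algebra F I\<^esub> l \<odot>\<^bsub>quot_algebra F I\<^esub> T"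
      "(k \<otimes>\<^bsub>ring_of_type_algebra\<^esub> l) \<odot>\<^bsub>quot_algebra F I\<^esub> T = k \<odot>\<^bsub>quot_algebra F I\<^esub> (l \<odot>\<^bsub>quot_algebra F I\<^esub> T)"
      "\<one>\<^bsub>ring_of_type_algebra\<^esub> \<odot>\<^bsub>quot_algebra F I\<^esub> T = T"
      unfolding x(2) using x(1)
      by (simp_all add: proj_smult[symmetric] ring_of_type_algebra_def smult_add_scalar proj_simps smult_smult quot_algebra_simps(3))
    assume "U \<in> carrier (quot_algebra F I)"
    then obtain y where y: "y \<in> carrier F" "U = proj y" by (auto simp: quot_algebra_simps elim: quot_carrierE)
    show "k \<odot>\<^bsub>quot_algebra F I\<^esub> (T \<oplus>\<^bsub>quot_algebra F I\<^esub> U) = k \<odot>\<^bsub>quot_algebra F I\<^esub> T \<oplus>\<^bsub>quot_algebra F I\<^esub> k \<odot>\<^bsub>quot_algebra F I\<^esub> U"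
      unfolding x(2) y(2) quot_algebra_simps(3) using x(1) y(1)
      by (simp add: proj_simps(3)[symmetric] proj_smult[symmetric] smult_add)
  qed
  moreover have "(k \<odot>\<^bsub>quot_algebra F I\<^esub> T) \<otimes>\<^bsub>quot_algebra F I\<^esub> U = k \<odot>\<^bsub>quot_algebra F I\<^esub> (T \<otimes>\<^bsub>quot_algebra F I\<^esub> U) \<and>
     T \<otimes>\<^bsub>quot_algebra F I\<^esub> (k \<odot>\<^bsub>quot_algebra F I\<^esub> U) = k \<odot>\<^bsub>quot_algebra F I\<^esub> (T \<otimes>\<^bsub>quot_algebra F I\<^esub> U)"
    if "T \<in> carrier (quot_algebra F I)" "U \<in> carrier (quot_algebra F I)" for k T U
  proof -
    obtain x y where x: "x \<in> carrier F" "T = proj x" "y \<in> carrier F" "U = proj y"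
      using \<open>T \<in> _\<close> \<open>U \<in> _\<close> by (auto simp: quot_algebra_simps elim!: quot_carrierE)
    show ?thesis unfolding x(2,4) quot_algebra_simps(2) using x(1,3)
      by (simp add: proj_simps(2)[symmetric] proj_smult[symmetric] mult_smult_left mult_smult_right)
  qed
  ultimately show ?thesis unfolding assoc_algebra_def by blast
qed

lemma proj_alg_hom: "proj \<in> alg_hom F (quot_algebra F I)"
  unfolding alg_hom_def
  by (auto intro!: ring_hom_memI simp: proj_simps quot_algebra_simps(1-5) proj_smult)

lemma proj_image: "proj ` carrier F = carrier (quot_algebra F I)"
  by (auto simp: quot_algebra_simps proj_simps elim!: quot_carrierE)

lemma proj_zero: "x \<in> I \<Longrightarrow> proj x = \<zero>\<^bsub>quot_algebra F I\<^esub>"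
  by (simp add: quot_algebra_simps FactRing_def I.a_rcos_const)

lemma factor_hom:
  assumes B: "assoc_algebra B" and f: "f \<in> alg_hom F B" and ker: "\<And>x. x \<in> I \<Longrightarrow> f x = \<zero>\<^bsub>B\<^esub>"
  obtains \<phi> where "\<phi> \<in> alg_hom (quot_algebra F I) B" "\<And>x. x \<in> carrier F \<Longrightarrow> \<phi> (proj x) = f x"
proof -
  interpret f: alg_morphism F B f using B f by unfold_locales
  \<comment> \<open>The value on a coset is taken at a chosen representative; \<open>eq\<close>
    shows that the choice does not matter, since \<open>f\<close> kills the ideal.\<close>
  define \<phi> where "\<phi> T = f (SOME x. x \<in> carrier F \<and> T = proj x)" for T
  have eq: "f x = f y" if "x \<in> carrier F" "y \<in> carrier F" "proj x = proj y" for x y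
  proof -
    have "x \<in> proj y" using that I.a_rcos_self by blast
    then obtain i where "i \<in> I" "x = i \<oplus>\<^bsub>F\<^esub> y" by (auto simp: a_r_coset_def')
    then show ?thesis using that ker f.hom_simps I.a_Hcarr by simp
  qed
  have \<phi>: "\<phi> (proj x) = f x" if "x \<in> carrier F" for x
  proof -
    have "\<exists>y. y \<in> carrier F \<and> proj x = proj y" using that by blast
    from someI_ex[OF this] show ?thesis unfolding \<phi>_def using that by (intro eq) auto
  qed
  have "\<phi> \<in> ring_hom (quot_algebra F I) B"
  proof (rule ring_hom_memI)
    fix T U assume "T \<in> carrier (quot_algebra F I)"
    then obtain x where x: "x \<in> carrier F" "T = proj x" by (auto simp: quot_algebra_simps elim: quot_carrierE)
    show "\<phi> T \<in> carrier B" using x by (simp add: \<phi> f.hom_simps)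
    assume "U \<in> carrier (quot_algebra F I)"
    then obtain y where y: "y \<in> carrier F" "U = proj y" by (auto simp: quot_algebra_simps elim: quot_carrierE)
    show "\<phi> (T \<otimes>\<^bsub>quot_algebra F I\<^esub> U) = \<phi> T \<otimes>\<^bsub>B\<^esub> \<phi> U" "\<phi> (T \<oplus>\<^bsub>quot_algebra F I\<^esub> U) = \<phi> T \<oplus>\<^bsub>B\<^esub> \<phi> U"
      using x y by (simp_all add: quot_algebra_simps proj_simps(2,3)[symmetric] \<phi> f.hom_simps)
  next
    show "\<phi> \<one>\<^bsub>quot_algebra F I\<^esub> = \<one>\<^bsub>B\<^esub>"
      using \<phi>[of "\<one>\<^bsub>F\<^esub>"] by (simp add: quot_algebra_simps proj_simps(4) f.hom_simps)
  qed
  moreover have "\<phi> (k \<odot>\<^bsub>quot_algebra F I\<^esub> T) = k \<odot>\<^bsub>B\<^esub> \<phi> T" if "T \<in> carrier (quot_algebra F I)" for k T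
  proof -
    obtain x where x: "x \<in> carrier F" "T = proj x"
      using \<open>T \<in> _\<close> by (auto simp: quot_algebra_simps elim: quot_carrierE)
    then show ?thesis by (simp add: proj_smult[symmetric] \<phi> f.hom_simps)
  qed
  ultimately have "\<phi> \<in> alg_hom (quot_algebra F I) B" unfolding alg_hom_def by blast
  with \<phi> show ?thesis using that by blast
qed

end

text \<open>The preimage of a subalgebra is a subalgebra, so a subalgebra containing the images of
  the generators pulls back to everything.\<close>

lemma generated_by_image:
  assumes A: "assoc_algebra A" and B: "assoc_algebra B" and f: "f \<in> alg_hom A B" and surj: "f ` carrier A = carrier B" and gen: "generated_by A G"
  shows "generated_by B (f ` G)"
proof -
  interpret f: alg_morphism A B f using A B f by unfold_locales
  have G: "G \<subseteq> carrier A" using gen unfolding generated_by_def by blast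
  have "carrier B \<subseteq> T" if T: "subalg T B" "f ` G \<subseteq> T" for T
  proof -
    let ?S = "{x \<in> carrier A. f x \<in> T}"
    note t = subringE[OF T(1)[unfolded subalg_def, THEN conjunct1]]
    have "subalg ?S A" unfolding subalg_def
      using t T(1) by (auto intro!: f.A.subringI simp: f.hom_simps f.hom_uminus subalg_def)
    then have "carrier A \<subseteq> ?S" using gen T(2) G unfolding generated_by_def by blast
    then show ?thesis unfolding surj[symmetric] by auto
  qed
  moreover have "subalg (carrier B) B" unfolding subalg_def using f.B.carrier_is_subring by auto
  moreover have "f ` G \<subseteq> carrier B" using G surj by blast
  ultimately show ?thesis unfolding generated_by_def
    by (intro conjI equalityI Inter_greatest Inter_lower) simp_all
qed

section \<open>Presented algebras and their universal property\<close>

context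
  fixes S :: "'x set" and R :: "'x ncpoly set"
  assumes R: "R \<subseteq> carrier (free_algebra S)"
begin

interpretation F: assoc_alg "free_algebra S" by unfold_locales (rule assoc_algebra_free)

interpretation P: alg_ideal "free_algebra S" "presented_ideal S R"
proof -
  have "ideal (presented_ideal S R) (free_algebra S)"
    unfolding presented_ideal_def by (rule F.genideal_ideal) (rule R)
  then show "alg_ideal (free_algebra S) (presented_ideal S R)"
    by (intro alg_ideal.intro F.assoc_alg_axioms)
qed

lemma assoc_algebra_presented: "assoc_algebra (presented_algebra S R)"
  unfolding presented_algebra_def by (rule P.assoc_algebra_quot)

lemma presented_generated: "generated_by (presented_algebra S R) (presented_gen S R ` S)"
proof -
  have "presented_gen S R ` S = (\<lambda>x. presented_ideal S R +>\<^bsub>free_algebra S\<^esub> x) ` free_gen ` S"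
    by (auto simp: presented_gen_def)
  then show ?thesis unfolding presented_algebra_def
    using generated_by_image[OF assoc_algebra_free P.assoc_algebra_quot P.proj_alg_hom P.proj_image free_generated] by simp
qed

lemma presented_proj:
  obtains h where "h \<in> alg_hom (free_algebra S) (presented_algebra S R)"
    "\<And>x. h (free_gen x) = presented_gen S R x" "\<And>r. r \<in> R \<Longrightarrow> h r = \<zero>\<^bsub>presented_algebra S R\<^esub>"
proof (rule that)
  show "(\<lambda>x. presented_ideal S R +>\<^bsub>free_algebra S\<^esub> x) \<in> alg_hom (free_algebra S) (presented_algebra S R)"
    unfolding presented_algebra_def by (rule P.proj_alg_hom)
  show "presented_ideal S R +>\<^bsub>free_algebra S\<^esub> free_gen x = presented_gen S R x" for x
    by (simp add: presented_gen_def)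
  show "presented_ideal S R +>\<^bsub>free_algebra S\<^esub> r = \<zero>\<^bsub>presented_algebra S R\<^esub>" if "r \<in> R" for r
    unfolding presented_algebra_def using P.proj_zero F.genideal_self[OF R] that unfolding presented_ideal_def by blast
qed

text \<open>The condition on relators is asked for every morphism with the prescribed values on the
  letters. Callers thus never meet the evaluation map and can use the translation of relators for an
  abstract morphism.\<close>

lemma presented_hom:
  assumes B: "assoc_algebra B" and g: "\<And>x. x \<in> S \<Longrightarrow> g x \<in> carrier B"
    and rel: "\<And>f r. f \<in> alg_hom (free_algebra S) B \<Longrightarrow> (\<And>x. x \<in> S \<Longrightarrow> f (free_gen x) = g x) \<Longrightarrow> r \<in> R \<Longrightarrow> f r = \<zero>\<^bsub>B\<^esub>"
  obtains \<phi> where "\<phi> \<in> alg_hom (presented_algebra S R) B" "\<And>x. x \<in> S \<Longrightarrow> \<phi> (presented_gen S R x) = g x"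
proof -
  interpret B: assoc_alg B by unfold_locales (rule B)
  let ?f = "B.poly_val g"
  have f: "?f \<in> alg_hom (free_algebra S) B" "\<And>x. x \<in> S \<Longrightarrow> ?f (free_gen x) = g x"
    using B.poly_val_hom[of S g] B.poly_val_gen[of S g] g by blast+
  interpret f: alg_morphism "free_algebra S" B ?f using B f(1) by unfold_locales
  have "ring_hom_ring (free_algebra S) B ?f"
    by (rule ring_hom_ringI2) (use F.ring_axioms B.ring_axioms alg_homE(1)[OF f(1)] in auto)
  then have "ideal (a_kernel (free_algebra S) B ?f) (free_algebra S)"
    by (rule ring_hom_ring.kernel_is_ideal)
  moreover have "R \<subseteq> a_kernel (free_algebra S) B ?f"
    using rel[OF f] R by (auto simp: a_kernel_def')
  ultimately have "presented_ideal S R \<subseteq> a_kernel (free_algebra S) B ?f"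
    unfolding presented_ideal_def by (rule F.genideal_minimal)
  then have "?f x = \<zero>\<^bsub>B\<^esub>" if "x \<in> presented_ideal S R" for x using that by (auto simp: a_kernel_def')
  from P.factor_hom[OF B f(1) this] obtain \<phi> where \<phi>: "\<phi> \<in> alg_hom (quot_algebra (free_algebra S) (presented_ideal S R)) B"
    "\<And>x. x \<in> carrier (free_algebra S) \<Longrightarrow> \<phi> (presented_ideal S R +>\<^bsub>free_algebra S\<^esub> x) = ?f x" by blast
  show ?thesis
    by (rule that[of \<phi>]) (use \<phi> f(2) in \<open>auto simp: presented_algebra_def presented_gen_def free_gen_carrier\<close>)
qed

end

section \<open>The \<open>q\<close>-commutator\<close>

text \<open>\<open>mu\<close> stands for multiplication by the central scalar \<open>q / (q - 1/q)\<close>, so that \<open>br\<close> below is the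
  \<open>q\<close>-commutator. The cancellation assumptions say that \<open>q\<^sup>2 + 1\<close> and \<open>q\<^sup>4 + 1\<close> are invertible; \<open>kap\<close> is
  multiplication by \<open>2 mu\<^sup>2 - 2 mu + 1 = (q\<^sup>4 + 1) / (q\<^sup>2 - 1)\<^sup>2\<close>.\<close>

locale qring =
  fixes mu :: "'a::ring \<Rightarrow> 'a"
  assumes mu_add: "mu (x + y) = mu x + mu y"
    and mu_mult_left: "mu x * y = mu (x * y)"
    and mu_mult_right: "x * mu y = mu (x * y)"
    and cancel_two: "mu x + mu x = x \<Longrightarrow> x = 0"
    and cancel_kappa: "mu (mu x) + mu (mu x) - mu x - mu x + x = 0 \<Longrightarrow> x = 0"
begin

lemma mu_zero [simp]: "mu 0 = 0"
  using mu_add[of 0 0] by simp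

lemma mu_minus: "mu (- x) = - mu x"
  using mu_add[of x "- x"] by (simp add: eq_neg_iff_add_eq_0 add.commute)

lemma mu_diff: "mu (x - y) = mu x - mu y"
  using mu_add[of x "- y"] by (simp add: mu_minus)

text \<open>The coefficient of y * x in the q-commutator is -(1/q) / (q - 1/q) = 1 - q / (q - 1/q),
  so the single map \<open>mu\<close> suffices to write it.\<close>

definition br :: "'a \<Rightarrow> 'a \<Rightarrow> 'a" where
  "br x y = y * x + mu (x * y - y * x)"

definition cm :: "'a \<Rightarrow> 'a \<Rightarrow> 'a" where
  "cm x y = x * y - y * x"

text \<open>With \<open>mb\<close> standing for 1 - mu this is mu^2 + mb^2.\<close>

definition kap :: "'a \<Rightarrow> 'a" where
  "kap x = mu (mu x) + mu (mu x) - mu x - mu x + x"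

definition mb :: "'a \<Rightarrow> 'a" where
  "mb x = x - mu x"

text \<open>Up to the factor 1 / (q - 1/q)^2 this is q^2 f g - q^-2 g f, a commutator for q^2 in
  place of q.\<close>

definition J :: "'a \<Rightarrow> 'a \<Rightarrow> 'a" where
  "J f g = mu (mu (f * g)) - mb (mb (g * f))"

lemmas mu_simps = mu_add mu_diff mu_minus mu_mult_left mu_mult_right
lemmas ops = br_def cm_def kap_def mb_def J_def

text \<open>Lets a commutation rule act in front of a third factor, so that the simplifier can bring
  partially commutative words to a normal form.\<close>

lemma lcomm: "a * b = b * a \<Longrightarrow> a * (b * w) = b * (a * w)" for a b w :: 'a
  by (metis mult.assoc)

lemma br_commute: "x * y = y * x \<Longrightarrow> br x y = x * y"
  by (simp add: br_def)

text \<open>In general the two bracketings differ by \<open>mu (mb (cm (cm x z) y))\<close>; the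
  assumption removes this defect.\<close>

lemma br_jac: assumes "x * z = z * x" shows "br x (br y z) = br (br x y) z"
  using assms lcomm[OF assms] by (simp add: ops mu_simps algebra_simps)

lemma br_right_comm: assumes "x * y = y * x" shows "br (br w x) y = br (br w y) x"
  using assms lcomm[OF assms] by (simp add: ops mu_simps algebra_simps)

lemma br_scale_left: assumes "s * y = y * s" shows "br (s * x) y = s * br x y"
  using assms lcomm[OF assms] by (simp add: ops mu_simps algebra_simps)

lemma br_scale_right: assumes "s * x = x * s" shows "br x (s * y) = s * br x y"
  using assms lcomm[OF assms] by (simp add: ops mu_simps algebra_simps)

lemma br_add: "br (x + y) z = br x z + br y z" "br z (x + y) = br z x + br z y"
  and br_diff: "br (x - y) z = br x z - br y z" "br z (x - y) = br z x - br z y"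
  and br_minus: "br (- x) z = - br x z" "br z (- x) = - br z x"
  by (simp_all add: ops mu_simps algebra_simps)

text \<open>The cyclic identity [f', br K g] + [K, br g f'] + [g, br f' K] = 0 holds for the
  q-bracket. Here f', g' play twisted chords, and the first assumption recovers the old f from
  f'.\<close>

lemma com_prime:
  assumes "br f' K = fb - f" and "g' = eg - br K g"
  shows "cm f' g' = cm f g - cm fb g + cm f' eg + cm K (br g f')"
proof -
  have 1: "f = fb - br f' K" using assms by simp
  show ?thesis unfolding assms(2) 1
    by (simp add: ops mu_simps algebra_simps)
qed

text \<open>The term \<open>br f' (br K g)\<close> is rebracketed as \<open>br (br f' K) g\<close>.
  The last summand is the defect of associativity; it is the obstruction that \<open>kap\<close> is
  later used to remove.\<close>

lemma br_prime:
  assumes "br f' K = fb - f" and "g' = eg - br K g"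
  shows "br f' g' = br f g - br fb g + br f' eg + mu (mb (cm K (cm f' g)))"
proof -
  have 1: "f = fb - br f' K" using assms by simp
  show ?thesis unfolding assms(2) 1
    by (simp add: ops mu_simps algebra_simps)
qed

text \<open>After applying \<open>kap\<close>, the commutator contains the crossing chords x, y, K
  only through the two double brackets that the relation on four points evaluates; the rest comes
  from e.\<close>

lemma kap_P:
  assumes "K * y = y * K" "W = e - br K x"
  shows "kap (cm (br W y) x) = - mu (mu (K * br (br x y) x)) + mb (mb (br (br x y) x * K))
     + mu (mu (br (br x K) x * y)) - mb (mb (y * br (br x K) x)) + kap (cm (br e y) x)"
  unfolding assms(2)
  using assms(1) lcomm[OF assms(1)] by (simp add: ops mu_simps algebra_simps)

text \<open>The analogue of \<open>kap_P\<close> for a single twisted chord: the double bracket and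
  the antisymmetric expression \<open>f * K * g - g * K * f\<close> are both known from the relation
  on five points.\<close>

lemma kap_f:
  assumes "f * g = g * f" "f' = e - br K f"
  shows "kap (cm f' g) = - mu (mu (K * (f * g))) + mb (mb (f * g * K))
     + (mu (br (br f K) g) - mb (br (br f K) g))
     - (mu (mu (mu (f * K * g - g * K * f))) + mb (mb (mb (f * K * g - g * K * f))))  + kap (cm e g)"
  unfolding assms(2)
  using assms(1) lcomm[OF assms(1)] by (simp add: ops mu_simps algebra_simps)

end

section \<open>Chords between points on a circle\<close>

text \<open>\<open>cyc\<close>: the points occur in this weak cyclic order; \<open>dih\<close>: up to reflection.\<close>

definition cyc4 :: "nat \<Rightarrow> nat \<Rightarrow> nat \<Rightarrow> nat \<Rightarrow> bool" where
  "cyc4 a b d f \<longleftrightarrow> (a \<le> b \<and> b \<le> d \<and> d \<le> f) \<or> (b \<le> d \<and> d \<le> f \<and> f \<le> a)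
     \<or> (d \<le> f \<and> f \<le> a \<and> a \<le> b) \<or> (f \<le> a \<and> a \<le> b \<and> b \<le> d)"

definition dih4 :: "nat \<Rightarrow> nat \<Rightarrow> nat \<Rightarrow> nat \<Rightarrow> bool" where
  "dih4 a b d f \<longleftrightarrow> cyc4 a b d f \<or> cyc4 f d b a"

definition cyc5 :: "nat \<Rightarrow> nat \<Rightarrow> nat \<Rightarrow> nat \<Rightarrow> nat \<Rightarrow> bool" where
  "cyc5 a b d f g \<longleftrightarrow> (a \<le> b \<and> b \<le> d \<and> d \<le> f \<and> f \<le> g) \<or> (b \<le> d \<and> d \<le> f \<and> f \<le> g \<and> g \<le> a)
     \<or> (d \<le> f \<and> f \<le> g \<and> g \<le> a \<and> a \<le> b) \<or> (f \<le> g \<and> g \<le> a \<and> a \<le> b \<and> b \<le> d)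
     \<or> (g \<le> a \<and> a \<le> b \<and> b \<le> d \<and> d \<le> f)"

definition dih5 :: "nat \<Rightarrow> nat \<Rightarrow> nat \<Rightarrow> nat \<Rightarrow> nat \<Rightarrow> bool" where
  "dih5 a b d f g \<longleftrightarrow> cyc5 a b d f g \<or> cyc5 g f d b a"

lemmas dih_defs = dih4_def dih5_def cyc4_def cyc5_def

lemma dih5_rotate: "dih5 a b d f g \<Longrightarrow> dih5 b d f g a"
  unfolding dih_defs by (elim disjE) simp_all

lemma dih5_reverse: "dih5 a b d f g \<Longrightarrow> dih5 g f d b a"
  unfolding dih5_def by blast

lemma dih4_rotate: "dih4 a b d f \<Longrightarrow> dih4 b d f a"
  unfolding dih_defs by (elim disjE) simp_all

lemma dih5_imp_dih4: assumes "dih5 a b d f g"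
  shows "dih4 a b d f" "dih4 a b d g" "dih4 a b f g" "dih4 a d f g" "dih4 b d f g"
  using assms unfolding dih_defs by (elim disjE; simp)+

text \<open>\<open>c a b\<close> is the chord between the points \<open>a\<close> and \<open>b\<close>; for \<open>a < b\<close> it models \<open>C\<^bsub>a+1\<dots>b\<^esub>\<close>. The unit \<open>e\<close> is only
  required to act as a unit on chords, because a component of a product of rings will be used.\<close>

locale prechordal = qring mu for mu :: "'a::ring \<Rightarrow> 'a" +
  fixes c :: "nat \<Rightarrow> nat \<Rightarrow> 'a" and e :: 'a
  assumes sym: "c a b = c b a"
    and diag: "c a a = e"
    and unit_left: "e * c a b = c a b"
    and unit_right: "c a b * e = c a b"
    and commute: "dih4 a b d f \<Longrightarrow> c a b * c d f = c d f * c a b"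
begin

text \<open>Relation (iii) is \<open>pent\<close> for five different points, with all \<open>C\<^bsub>IJ\<^esub>\<close> expanded; relation (ii) is the degenerate
  case \<open>a = g\<close>.\<close>

definition pent :: "nat \<Rightarrow> nat \<Rightarrow> nat \<Rightarrow> nat \<Rightarrow> nat \<Rightarrow> bool" where
  "pent a b d f g \<longleftrightarrow> br (br (c a d) (c b f)) (c d g) =
     c b d * br (c a f) (c d g) + c d f * br (c a d) (c b g) - br (c a f) (c b g)
     + c b f * c a g - c b d * c d f * c a g"

lemma commute_share: "c a b * c a d = c a d * c a b" "c b a * c a d = c a d * c b a"
  "c a b * c d a = c d a * c a b" "c b a * c d a = c d a * c b a"
proof -
  \<comment> \<open>Three points are always in cyclic order up to reflection, so chords with a
    common end never cross.\<close>
  have "dih4 b a a d" unfolding dih_defs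
    by (cases "b \<le> a"; cases "a \<le> d"; cases "b \<le> d"; simp)
  from commute[OF this] show "c a b * c a d = c a d * c a b" "c b a * c a d = c a d * c b a"
    "c a b * c d a = c d a * c a b" "c b a * c d a = c d a * c b a"
    by (simp_all add: sym[of b a] sym[of d a])
qed

text \<open>With \<open>a = g\<close> all brackets except the double one are taken between commuting
  chords and become products.\<close>

lemma quad_iff:
  assumes "dih4 a b d f"
  shows "pent a b d f a \<longleftrightarrow> br (br (c a d) (c b f)) (c a d) = c b f
    + c a d * (c a b * c d f + c b d * c a f) - c a b * c a f - c b d * c d f"
proof -
  have s: "c d a = c a d" "c b a = c a b" "c f a = c a f" by (simp_all add: sym)
  have 1: "br (c a f) (c a d) = c a f * c a d" "br (c a d) (c a b) = c a d * c a b"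
     "br (c a f) (c a b) = c a f * c a b"
    by (simp_all add: br_commute commute_share)
  have 2: "c d f * c a d = c a d * c d f" "c b d * c a d = c a d * c b d"
     "c a f * c a d = c a d * c a f" "c a f * c a b = c a b * c a f" "c d f * c a b = c a b * c d f"
     "c b d * c d f = c d f * c b d" "c b d * c a f = c a f * c b d"
    using commute[OF assms] dih4_rotate[OF assms, THEN commute] commute_share s by metis+
  show ?thesis
    unfolding pent_def s 1 diag
    by (simp add: unit_right algebra_simps 2 2[THEN lcomm])
qed

text \<open>A half turn of the quadrilateral preserves both diagonals and only permutes the
  sides.\<close>

lemma quad_swap:
  assumes "dih4 a b d f" "pent a b d f a"
  shows "pent d f a b d"
proof -
  have d: "dih4 d f a b" using assms(1) dih4_rotate by blast
  have s: "c d a = c a d" "c b a = c a b" "c f a = c a f" "c f b = c b f" "c f d = c d f" "c b d = c d b" by (simp_all add: sym)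
  have 2: "c d f * c a b = c a b * c d f"
     "c d b * c d f = c d f * c d b" "c d b * c a f = c a f * c d b"  "c a f * c a b = c a b * c a f"
    using commute[OF assms(1)] dih4_rotate[OF assms(1), THEN commute] commute_share s by metis+
  show ?thesis
    using assms(2) unfolding quad_iff[OF assms(1)] quad_iff[OF d] s
    by (simp add: 2 2[THEN lcomm] algebra_simps)
qed

lemma unit_br: "e * br (c a b) x = br (c a b) x" if "e * x = x"
  using that by (simp add: ops mu_simps algebra_simps unit_left mult.assoc[symmetric])

lemma br_mult_commute:
  assumes "s * x = x * s" "s * y = y * s"
  shows "br (br x y) s = s * br x y"
  using assms assms[THEN lcomm] by (simp add: ops mu_simps algebra_simps)

text \<open>If neighbouring points coincide, one chord is trivial and the relation only says that a
  commuting factor can be pulled out of a bracket. The remaining coincidence \<open>g = a\<close>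
  gives the genuine relation on four points.\<close>

lemma pent_degenerate:
  assumes "a = b \<or> b = d \<or> d = f \<or> f = g"
  shows "pent a b d f g"
proof -
  have s: "c d a = c a d" "c d b = c b d" "c f b = c b f" "c f d = c d f"
    by (simp_all add: sym)
  have br_share: "br (c x y) (c x z) = c x y * c x z" "br (c x y) (c y z) = c x y * c y z"
     "br (c x y) (c z y) = c x y * c z y" for x y z
    by (simp_all add: br_commute commute_share)
  consider "a = b" | "b = d" | "d = f" | "f = g" using assms by blast
  then show ?thesis
  proof cases
    case 1
    have "br (c a d * c a f) (c d g) = c a d * br (c a f) (c d g)"
      by (rule br_scale_left) (rule commute_share)
    then show ?thesis unfolding pent_def 1[symmetric] br_share
      by (simp add: commute_share(3)[of d f a, THEN lcomm] mult.assoc)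
  next
    case 2
    have "br (c d f * c a d) (c d g) = c d f * br (c a d) (c d g)"
      by (rule br_scale_left) (rule commute_share)
    then show ?thesis unfolding pent_def 2 br_share diag
      by (simp add: unit_br unit_left commute_share(2)[of d a f] commute_share mult.assoc)
  next
    case 3
    have "br (c b d * c a d) (c d g) = c b d * br (c a d) (c d g)"
      by (rule br_scale_left) (rule commute_share)
    then show ?thesis unfolding pent_def 3[symmetric] br_share diag
      by (simp add: unit_br unit_left unit_right commute_share(4)[of b d a] mult.assoc)
  next
    case 4
    have "br (br (c a d) (c b f)) (c d f) = c d f * br (c a d) (c b f)"
      by (rule br_mult_commute) (rule commute_share)+
    then show ?thesis unfolding pent_def 4[symmetric] br_share
      by (simp add: commute_share mult.assoc)
  qed
qed

text \<open>The given relation is bracketed on the right with x, the chord from a to d; both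
  quadrilateral relations are used to evaluate the double brackets with x that arise. This rotates
  by three places, and since 3 is prime to 5 iteration reaches every rotation.\<close>

lemma pent_rotate:
  assumes dih: "dih5 a b d f g" and p: "pent a b d f g" and q: "pent a b d f a" "pent a b d g a"
  shows "pent f g a b d"
proof -
  note d4 = dih5_imp_dih4[OF dih]
  define x y z w k where "x = c a d" "y = c b f" "z = c d g" "w = c a f" "k = c b g"
  define s1 s2 s3 s5 where "s1 = c a b" "s2 = c b d" "s3 = c d f" "s5 = c a g"
  have s: "c f a = w" "c g b = k" "c f b = y" "c g d = z" "c f d = s3" "c g a = s5"
    by (simp_all add: sym x_y_z_w_k_def s1_s2_s3_s5_def)
  have cs: "z * x = x * z" "w * x = x * w" "x * s1 = s1 * x" "x * s2 = s2 * x" "x * s3 = s3 * x" "x * s5 = s5 * x"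
    "z * s1 = s1 * z" "z * s2 = s2 * z" "z * s3 = s3 * z" "z * s5 = s5 * z" "w * s1 = s1 * w"
    "w * s2 = s2 * w" "s2 * s1 = s1 * s2" "s3 * s1 = s1 * s3" "s5 * s1 = s1 * s5" "s3 * s2 = s2 * s3"
    "s5 * s2 = s2 * s5" "s5 * s3 = s3 * s5"
    "y * s5 = s5 * y" "k * s3 = s3 * k"
    unfolding x_y_z_w_k_def s1_s2_s3_s5_def
    using d4(1,2)[THEN commute] d4(1,2,3,4,5)[THEN dih4_rotate, THEN commute]
    by (simp_all only: commute_share sym[of g a] sym[of f a] sym[of g b])
  note cs' = cs cs[THEN lcomm]
  have P: "br (br x y) z = s2 * br w z + s3 * br x k - br w k + y * s5 - s2 * s3 * s5"
    using p unfolding pent_def x_y_z_w_k_def s1_s2_s3_s5_def .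
  have X1: "br (br x y) x = y + x * (s1 * s3 + s2 * w) - s1 * w - s2 * s3"
    using q(1) unfolding quad_iff[OF d4(1)] x_y_z_w_k_def s1_s2_s3_s5_def .
  have X2: "br (br x k) x = k + x * (s1 * z + s2 * s5) - s1 * s5 - s2 * z"
    using q(2) unfolding quad_iff[OF d4(2)] x_y_z_w_k_def s1_s2_s3_s5_def .
  \<comment> \<open>x and z share the end d and commute, so the two outer brackets may be exchanged.
    The inner double bracket then belongs to the quadrilateral a, b, d, f.\<close>
  have "br (br (br x y) z) x = br (br (br x y) x) z"
    by (rule br_right_comm) (rule cs)
  then have "br (s2 * br w z + s3 * br x k - br w k + y * s5 - s2 * s3 * s5) x
      = br (y + x * (s1 * s3 + s2 * w) - s1 * w - s2 * s3) z"
    unfolding P X1 .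
  moreover have "br (s3 * br x k) x = s3 * (k + x * (s1 * z + s2 * s5) - s1 * s5 - s2 * z)"
    unfolding X2[symmetric] by (rule br_scale_left) (simp add: cs)
  ultimately have "br (br w k) x = br (s2 * br w z) x + s3 * (k + x * (s1 * z + s2 * s5) - s1 * s5 - s2 * z)
     + br (y * s5 - s2 * s3 * s5) x - br (y + x * (s1 * s3 + s2 * w) - s1 * w - s2 * s3) z"
    unfolding br_add br_diff by (simp add: algebra_simps)
  also have "\<dots> = s5 * br y x + s1 * br w z - br y z + k * s3 - s5 * s1 * s3"
    by (simp add: ops mu_simps algebra_simps cs')
  finally show ?thesis
    unfolding pent_def s x_y_z_w_k_def[symmetric] s1_s2_s3_s5_def[symmetric] .
qed

end

section \<open>Cyclic order around three consecutive points\<close>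

definition cyc6 :: "nat \<Rightarrow> nat \<Rightarrow> nat \<Rightarrow> nat \<Rightarrow> nat \<Rightarrow> nat \<Rightarrow> bool" where
  "cyc6 a b d f g h \<longleftrightarrow> (a \<le> b \<and> b \<le> d \<and> d \<le> f \<and> f \<le> g \<and> g \<le> h) \<or> (b \<le> d \<and> d \<le> f \<and> f \<le> g \<and> g \<le> h \<and> h \<le> a)
     \<or> (d \<le> f \<and> f \<le> g \<and> g \<le> h \<and> h \<le> a \<and> a \<le> b) \<or> (f \<le> g \<and> g \<le> h \<and> h \<le> a \<and> a \<le> b \<and> b \<le> d)
     \<or> (g \<le> h \<and> h \<le> a \<and> a \<le> b \<and> b \<le> d \<and> d \<le> f) \<or> (h \<le> a \<and> a \<le> b \<and> b \<le> d \<and> d \<le> f \<and> f \<le> g)"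

definition dih6 :: "nat \<Rightarrow> nat \<Rightarrow> nat \<Rightarrow> nat \<Rightarrow> nat \<Rightarrow> nat \<Rightarrow> bool" where
  "dih6 a b d f g h \<longleftrightarrow> cyc6 a b d f g h \<or> cyc6 h g f d b a"

lemma dih6_imp_dih5: assumes "dih6 a b d f g h"
  shows "dih5 a b d f g" "dih5 a b d f h" "dih5 a b d g h" "dih5 a b f g h" "dih5 a d f g h" "dih5 b d f g h"
  using assms unfolding dih6_def cyc6_def dih5_def cyc5_def by (elim disjE; simp)+

lemma dih4_reverse: "dih4 a b d f \<Longrightarrow> dih4 f d b a"
  unfolding dih4_def by blast

text \<open>No integer lies strictly between m, p, n, so all other points lie on the arc leading
  from n back to m.\<close>

lemma dih_near:
  assumes "p = Suc m" "n = Suc p" "a \<noteq> p" "b \<noteq> p"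
  shows "dih5 m p n a b \<or> dih5 m p n b a"
proof -
  have "a \<le> m \<or> n \<le> a" "b \<le> m \<or> n \<le> b" "a \<le> b \<or> b \<le> a" using assms by auto
  then show ?thesis unfolding assms(1,2) dih5_def cyc5_def by (elim disjE) simp_all
qed

lemma dih_near3:
  assumes "p = Suc m" "n = Suc p" "a \<noteq> p" "b \<noteq> p" "d \<noteq> p" "dih4 p a b d"
  shows "dih6 m p n a b d \<or> dih6 n p m a b d"
proof -
  have "a \<le> m \<or> n \<le> a" "b \<le> m \<or> n \<le> b" "d \<le> m \<or> n \<le> d" using assms by auto
  then show ?thesis using assms(6) unfolding assms(1,2) dih6_def cyc6_def dih4_def cyc4_def
    by (elim disjE) simp_all
qed

text \<open>Sliding p onto a neighbour passes no other point.\<close>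

lemma dih5_move:
  assumes "p = Suc m" "n = Suc p" "a \<noteq> p" "b \<noteq> p" "d \<noteq> p" "f \<noteq> p" "dih5 p a b d f"
  shows "dih5 m a b d f \<and> dih5 n a b d f"
  using assms unfolding dih5_def cyc5_def by (elim disjE) simp_all

locale chordal = prechordal +
  assumes pent: "dih5 a b d f g \<Longrightarrow> pent a b d f g"
begin

lemma quad:
  assumes "dih4 a b d f"
  shows "br (br (c a d) (c b f)) (c a d) = c b f
    + c a d * (c a b * c d f + c b d * c a f) - c a b * c a f - c b d * c d f"
proof -
  have "dih5 a b d f a" using assms unfolding dih5_def cyc5_def dih4_def cyc4_def
    by (elim disjE) simp_all
  then show ?thesis using quad_iff[OF assms] pent by blast
qed

text \<open>The relation minus its reflection has the common factor 2 mu - 1, which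
  \<open>cancel_two\<close> removes. What remains is an identity of ordinary commutators.\<close>

lemma pent_cm:
  assumes "dih5 a b d f g"
  shows "c a d * c b f * c d g - c d g * c b f * c a d
    = c b d * cm (c a f) (c d g) + c d f * cm (c a d) (c b g) - cm (c a f) (c b g)" (is "?l = ?r")
proof -
  have s: "c g d = c d g" "c f b = c b f" "c d a = c a d" "c f d = c d f" "c g b = c b g" "c d b = c b d"
    "c f a = c a f" "c g a = c a g" by (simp_all add: sym)
  have cs: "c d g * c a d = c a d * c d g" "c d f * c b d = c b d * c d f" by (rule commute_share)+
  note 1 = pent[OF assms, unfolded pent_def]
  note 2 = pent[OF dih5_reverse[OF assms], unfolded pent_def s]
  let ?t = "?l - ?r"
  have "mu ?t + mu ?t - ?t =
    (br (br (c a d) (c b f)) (c d g) - (c b d * br (c a f) (c d g) + c d f * br (c a d) (c b g) - br (c a f) (c b g)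
     + c b f * c a g - c b d * c d f * c a g))
   - (br (br (c d g) (c b f)) (c a d) - (c d f * br (c b g) (c a d) + c b d * br (c d g) (c a f) - br (c b g) (c a f)
     + c b f * c a g - c d f * c b d * c a g))"
    by (simp add: ops mu_simps algebra_simps cs cs[THEN lcomm])
  also have "\<dots> = 0" unfolding 1 2 by simp
  finally have "?t = 0" by (intro cancel_two) simp
  then show ?thesis by simp
qed

end

section \<open>Algebra of twisted chords: linearity and commutation\<close>

context qring
begin

text \<open>The numeral in these lemmas is the position of the moved point among the five. At these
  positions every term contains exactly one chord at that point, and the other factors commute with
  K, u, v; so the defect \<open>E\<close> of the relation depends linearly on the old defects. In
  the middle position two such chords are multiplied.\<close>

lemma pent_linear1:
  assumes p': "\<And>t. P t = u * N t + v * M t - br K (L t)"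
    and cs: "\<And>t. t \<in> {y, z, s, r, w} \<Longrightarrow> t * K = K * t \<and> t * u = u * t \<and> t * v = v * t"
    and N: "br (br (N d) y) z = s * br (N f) z + r * br (N d) w - br (N f) w + y * N g - s * r * N g"
    and M: "br (br (M d) y) z = s * br (M f) z + r * br (M d) w - br (M f) w + y * M g - s * r * M g"
    and L: "br (br (L d) y) z = s * br (L f) z + r * br (L d) w - br (L f) w + y * L g - s * r * L g"
  shows "br (br (P d) y) z = s * br (P f) z + r * br (P d) w - br (P f) w + y * P g - s * r * P g"
proof -
  define E where "E R = br (br (R d) y) z - (s * br (R f) z + r * br (R d) w - br (R f) w + y * R g - s * r * R g)" for R
  have c: "t * K = K * t" "t * u = u * t" "t * v = v * t" if "t \<in> {y, z, s, r, w}" for t using cs that by blast+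
  have cc: "y * K = K * y" "z * K = K * z" "s * K = K * s" "r * K = K * r" "w * K = K * w"
     "y * u = u * y" "z * u = u * z" "s * u = u * s" "r * u = u * r" "w * u = u * w"
     "y * v = v * y" "z * v = v * z" "s * v = v * s" "r * v = v * r" "w * v = v * w"
    by (simp_all add: c)
  have "E P = u * E N + v * E M - br K (E L)"
    unfolding E_def p'
    by (simp add: ops mu_simps algebra_simps cc cc[THEN lcomm])
  moreover have "E N = 0" "E M = 0" "E L = 0" unfolding E_def N M L by simp_all
  ultimately have "E P = 0" by (simp add: br_def)
  then show ?thesis unfolding E_def by simp
qed

lemma pent_linear2:
  assumes p': "\<And>t. P t = u * N t + v * M t - br K (L t)"
    and cs: "\<And>t. t \<in> {x, z, w, r, k} \<Longrightarrow> t * K = K * t \<and> t * u = u * t \<and> t * v = v * t"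
    and N: "br (br x (N f)) z = N d * br w z + r * br x (N g) - br w (N g) + N f * k - N d * r * k"
    and M: "br (br x (M f)) z = M d * br w z + r * br x (M g) - br w (M g) + M f * k - M d * r * k"
    and L: "br (br x (L f)) z = L d * br w z + r * br x (L g) - br w (L g) + L f * k - L d * r * k"
  shows "br (br x (P f)) z = P d * br w z + r * br x (P g) - br w (P g) + P f * k - P d * r * k"
proof -
  define E where "E R = br (br x (R f)) z - (R d * br w z + r * br x (R g) - br w (R g) + R f * k - R d * r * k)" for R
  have c: "t * K = K * t" "t * u = u * t" "t * v = v * t" if "t \<in> {x, z, w, r, k}" for t using cs that by blast+
  have cc: "x * K = K * x" "z * K = K * z" "w * K = K * w" "r * K = K * r" "k * K = K * k"
     "x * u = u * x" "z * u = u * z" "w * u = u * w" "r * u = u * r" "k * u = u * k"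
     "x * v = v * x" "z * v = v * z" "w * v = v * w" "r * v = v * r" "k * v = v * k"
    by (simp_all add: c)
  have "E P = u * E N + v * E M - br K (E L)"
    unfolding E_def p'
    by (simp add: ops mu_simps algebra_simps cc cc[THEN lcomm])
  moreover have "E N = 0" "E M = 0" "E L = 0" unfolding E_def N M L by simp_all
  ultimately have "E P = 0" by (simp add: br_def)
  then show ?thesis unfolding E_def by simp
qed

lemma pent_linear4:
  assumes p': "\<And>t. P t = u * N t + v * M t - br K (L t)"
    and cs: "\<And>t. t \<in> {x, z, s, w, k} \<Longrightarrow> t * K = K * t \<and> t * u = u * t \<and> t * v = v * t"
    and N: "br (br x (N b)) z = s * br (N a) z + N d * br x w - br (N a) w + N b * k - s * N d * k"
    and M: "br (br x (M b)) z = s * br (M a) z + M d * br x w - br (M a) w + M b * k - s * M d * k"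
    and L: "br (br x (L b)) z = s * br (L a) z + L d * br x w - br (L a) w + L b * k - s * L d * k"
  shows "br (br x (P b)) z = s * br (P a) z + P d * br x w - br (P a) w + P b * k - s * P d * k"
proof -
  define E where "E R = br (br x (R b)) z - (s * br (R a) z + R d * br x w - br (R a) w + R b * k - s * R d * k)" for R
  have c: "t * K = K * t" "t * u = u * t" "t * v = v * t" if "t \<in> {x, z, s, w, k}" for t using cs that by blast+
  have cc: "x * K = K * x" "z * K = K * z" "w * K = K * w" "s * K = K * s" "k * K = K * k"
     "x * u = u * x" "z * u = u * z" "w * u = u * w" "s * u = u * s" "k * u = u * k"
     "x * v = v * x" "z * v = v * z" "w * v = v * w" "s * v = v * s" "k * v = v * k"
    by (simp_all add: c)
  have "E P = u * E N + v * E M - br K (E L)"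
    unfolding E_def p'
    by (simp add: ops mu_simps algebra_simps cc cc[THEN lcomm])
  moreover have "E N = 0" "E M = 0" "E L = 0" unfolding E_def N M L by simp_all
  ultimately have "E P = 0" by (simp add: br_def)
  then show ?thesis unfolding E_def by simp
qed

lemma pent_linear5:
  assumes p': "\<And>t. P t = u * N t + v * M t - br K (L t)"
    and cs: "\<And>t. t \<in> {x, y, s, r, w} \<Longrightarrow> t * K = K * t \<and> t * u = u * t \<and> t * v = v * t"
    and N: "br (br x y) (N d) = s * br w (N d) + r * br x (N b) - br w (N b) + y * N a - s * r * N a"
    and M: "br (br x y) (M d) = s * br w (M d) + r * br x (M b) - br w (M b) + y * M a - s * r * M a"
    and L: "br (br x y) (L d) = s * br w (L d) + r * br x (L b) - br w (L b) + y * L a - s * r * L a"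
  shows "br (br x y) (P d) = s * br w (P d) + r * br x (P b) - br w (P b) + y * P a - s * r * P a"
proof -
  define E where "E R = br (br x y) (R d) - (s * br w (R d) + r * br x (R b) - br w (R b) + y * R a - s * r * R a)" for R
  have c: "t * K = K * t" "t * u = u * t" "t * v = v * t" if "t \<in> {x, y, s, r, w}" for t using cs that by blast+
  have cc: "x * K = K * x" "y * K = K * y" "w * K = K * w" "s * K = K * s" "r * K = K * r"
     "x * u = u * x" "y * u = u * y" "w * u = u * w" "s * u = u * s" "r * u = u * r"
     "x * v = v * x" "y * v = v * y" "w * v = v * w" "s * v = v * s" "r * v = v * r"
    by (simp_all add: c)
  have "E P = u * E N + v * E M - br K (E L)"
    unfolding E_def p'
    by (simp add: ops mu_simps algebra_simps cc cc[THEN lcomm])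
  moreover have "E N = 0" "E M = 0" "E L = 0" unfolding E_def N M L by simp_all
  ultimately have "E P = 0" by (simp add: br_def)
  then show ?thesis unfolding E_def by simp
qed

text \<open>By \<open>com_prime\<close> the commutator of the two twisted chords collapses, after
  inserting the relation \<open>B\<close> on five points, to v times the difference of the two sides
  of its antisymmetric form \<open>D\<close>.\<close>

lemma primes_commute:
  assumes x': "x' = u * N + v * M - br K x" and z': "z' = u * P + v * Q - br K z"
    and x'K: "br x' K = v * N + u * M - x"
    and B: "br (br z K) x = v * br Q x + u * br z N - br Q N + K * h - v * u * h"
    and D: "Q * x * K - K * x * Q = M * cm z K + u * cm Q N - cm z N"
    and cs: "z * x = x * z" "K * N = N * K" "K * M = M * K" "K * P = P * K" "K * Q = Q * K" "K * h = h * K"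
      "z * M = M * z" "x * N = N * x" "x * M = M * x" "x * P = P * x" "z * P = P * z" "z * Q = Q * z"
      "N * M = M * N" "Q * M = M * Q" "P * M = M * P" "N * P = P * N"
    and us: "K * u = u * K" "x * u = u * x" "z * u = u * z" "N * u = u * N" "M * u = u * M" "P * u = u * P"
      "Q * u = u * Q" "h * u = u * h" "v * u = u * v"
    and vs: "K * v = v * K" "x * v = v * x" "z * v = v * z" "N * v = v * N" "M * v = v * M" "P * v = v * P"
      "Q * v = v * Q" "h * v = v * h"
  shows "x' * z' = z' * x'"
proof -
  have zx: "br z x' = br z (u * N + v * M) - (v * br Q x + u * br z N - br Q N + K * h - v * u * h)"
    unfolding x' br_diff B[symmetric] by (simp add: br_jac cs)
  have "cm x' z' = cm x z - cm (v * N + u * M) z + cm x' (u * P + v * Q) + cm K (br z x')"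
    by (rule com_prime[OF x'K z'])
  also have "\<dots> = v * ((Q * x * K - K * x * Q) - (M * cm z K + u * cm Q N - cm z N))"
    unfolding zx unfolding x'
    by (simp add: ops mu_simps algebra_simps cs us vs cs[THEN lcomm] us[THEN lcomm] vs[THEN lcomm])
  finally show ?thesis using D by (simp add: cm_def)
qed

end

section \<open>The half twist at a point\<close>

text \<open>\<open>prime\<close> below is the image of the chords under the half twist that moves \<open>p\<close> across the chord \<open>K\<close> joining its
  neighbours. Both orientations of \<open>m\<close>, \<open>p\<close>, \<open>n\<close> are admitted since reflections are used.\<close>

locale chord_at = chordal mu c e for mu :: "'a::ring \<Rightarrow> 'a" and c e +
  fixes m p n :: nat
  assumes adj: "p = Suc m \<and> n = Suc p \<or> p = Suc n \<and> m = Suc p"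
begin

lemma near: assumes "a \<noteq> p" "b \<noteq> p" shows "dih5 m p n a b \<or> dih5 m p n b a"
  using adj
proof
  assume "p = Suc m \<and> n = Suc p"
  then show ?thesis using dih_near assms by blast
next
  assume "p = Suc n \<and> m = Suc p"
  then have "dih5 n p m a b \<or> dih5 n p m b a" using dih_near[of p n m a b] assms by blast
  then show ?thesis by (blast dest: dih5_reverse dih5_rotate)
qed

lemma near3: assumes "a \<noteq> p" "b \<noteq> p" "d \<noteq> p" "dih4 p a b d"
  shows "dih6 m p n a b d \<or> dih6 n p m a b d"
  using adj dih_near3[of p m n a b d] dih_near3[of p n m a b d] assms by blast

lemma move: assumes "a \<noteq> p" "b \<noteq> p" "d \<noteq> p" "f \<noteq> p" "dih5 p a b d f"
  shows "dih5 m a b d f" "dih5 n a b d f"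
  using adj dih5_move[of p m n a b d f] dih5_move[of p n m a b d f] assms by blast+

abbreviation K :: 'a where "K \<equiv> c m n"
abbreviation u :: 'a where "u \<equiv> c m p"
abbreviation v :: 'a where "v \<equiv> c p n"

lemma neq: "m \<noteq> p" "n \<noteq> p" "m \<noteq> n" using adj by auto

lemma K_comm: assumes "a \<noteq> p" "b \<noteq> p" shows "c a b * K = K * c a b"
proof -
  from assms have "a \<noteq> p \<and> b \<noteq> p" by blast
  then have "dih5 m p n a b \<or> dih5 m p n b a" using near by blast
  then show ?thesis
  proof
    assume "dih5 m p n a b"
    from commute[OF dih5_imp_dih4(4)[OF this]] show ?thesis by simp
  next
    assume "dih5 m p n b a"
    from commute[OF dih5_imp_dih4(4)[OF this]] show ?thesis by (simp add: sym[of b a])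
  qed
qed

lemma u_comm: "c a b * u = u * c a b"
proof (cases "a = p \<or> b = p")
  case True then show ?thesis by (auto simp: commute_share)
next
  case False
  then have "dih5 m p n a b \<or> dih5 m p n b a" using near by blast
  then show ?thesis
  proof
    assume "dih5 m p n a b"
    from commute[OF dih5_imp_dih4(3)[OF this]] show ?thesis by simp
  next
    assume "dih5 m p n b a"
    from commute[OF dih5_imp_dih4(3)[OF this]] show ?thesis by (simp add: sym[of b a])
  qed
qed

lemma v_comm: "c a b * v = v * c a b"
proof (cases "a = p \<or> b = p")
  case True then show ?thesis by (auto simp: commute_share)
next
  case False
  then have "dih5 m p n a b \<or> dih5 m p n b a" using near by blast
  then show ?thesis
  proof
    assume "dih5 m p n a b"
    from commute[OF dih5_imp_dih4(5)[OF this]] show ?thesis by simp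
  next
    assume "dih5 m p n b a"
    from commute[OF dih5_imp_dih4(5)[OF this]] show ?thesis by (simp add: sym[of b a])
  qed
qed
text \<open>For the points m, p, n, b = 0, 1, 2, 3 this is the right-hand side of the formula for
  r_1(C_23) in requirement (4).\<close>

definition pr :: "nat \<Rightarrow> 'a" where
  "pr b = u * c n b + v * c m b - br K (c p b)"

text \<open>The half twist exchanges the chords joining p to its two neighbours.\<close>

lemma pr_near: "pr n = u" "pr m = v"
proof -
  have "br K v = v * K" "br K u = u * K"
    using u_comm[of m n] v_comm[of m n] by (simp_all add: br_commute)
  then show "pr n = u" "pr m = v"
    by (simp_all add: pr_def diag unit_right sym[of n m] sym[of p m])
qed

text \<open>This is the relation on the four points m, p, n, b. It recovers the old chord from the
  twisted one, and will also provide the inverse of the half twist.\<close>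

lemma pr_K: assumes "b \<noteq> p" shows "br (pr b) K = v * c n b + u * c m b - c p b"
proof -
  have "dih4 m p n b" using near[OF assms assms] dih5_imp_dih4(1) by blast
  from quad[OF this] have 1: "br (br K (c p b)) K = c p b + K * (u * c n b + v * c m b) - u * c m b - v * c n b" .
  have "br (pr b) K = (u * c n b + v * c m b) * K - br (br K (c p b)) K"
    unfolding pr_def br_diff br_add
    using K_comm[of n b] K_comm[of m b] u_comm[of m n] v_comm[of m n] neq assms
    by (simp add: br_commute algebra_simps br_scale_left)
  then show ?thesis unfolding 1
    using K_comm[of n b] K_comm[of m b] u_comm[of m n] v_comm[of m n] neq assms
    by (simp add: algebra_simps lcomm)
qed

text \<open>A chord that does not cross p b crosses neither m b nor n b, because p can be slid onto
  its neighbours; it therefore commutes with every constituent of \<open>pr b\<close>.\<close>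

lemma pr_commute:
  assumes "b \<noteq> p" "d \<noteq> p" "f \<noteq> p" "dih4 p b d f"
  shows "pr b * c d f = c d f * pr b"
proof -
  have "dih5 p b d f f" using assms(4) unfolding dih_defs by (elim disjE) simp_all
  from move[OF assms(1,2,3,3) this] have 1: "dih4 m b d f" "dih4 n b d f"
    using dih5_imp_dih4(1) by blast+
  note cs = 1[THEN commute] assms(4)[THEN commute] K_comm[OF assms(2,3), symmetric] u_comm[of d f, symmetric] v_comm[of d f, symmetric]
  show ?thesis unfolding pr_def
    by (simp add: ops mu_simps algebra_simps cs cs[THEN lcomm])
qed

lemma pr_pr_commute_aux:
  assumes d: "dih5 a m p n g" and ne: "a \<noteq> p" "g \<noteq> p"
  shows "pr a * pr g = pr g * pr a"
proof (rule primes_commute[OF pr_def pr_def pr_K[OF ne(1)], where h = "c a g"])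
  note d' = d[THEN dih5_reverse]
  show "br (br (c p g) K) (c p a) = v * br (c m g) (c p a) + u * br (c p g) (c n a) - br (c m g) (c n a) + K * c a g - v * u * c a g"
    using pent[OF d'] unfolding pent_def by (simp only: sym)
  have "dih5 g a m p n" using d dih5_rotate by blast
  from pent_cm[OF this]
  show "c m g * c p a * K - K * c p a * c m g = c m a * cm (c p g) K + u * cm (c m g) (c n a) - cm (c p g) (c n a)"
    by (simp only: sym)
  note d4 = dih5_imp_dih4[OF d]
  note d4r = d4[THEN dih4_rotate]
  have "dih4 m p n g" "dih4 m p n a" using d4 d4r dih4_reverse by blast+
  show "c p g * c m a = c m a * c p g" "c p a * c n g = c n g * c p a" "c n g * c m a = c m a * c n g"
    using d4[THEN commute] d4r[THEN commute] by (simp_all only: sym)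
  show "K * c n a = c n a * K" "K * c m a = c m a * K" "K * c n g = c n g * K" "K * c m g = c m g * K"
    "K * c a g = c a g * K"
    by (simp_all add: K_comm ne neq)
qed (rule commute_share u_comm v_comm)+

lemma pr_pr_commute:
  assumes "a \<noteq> p" "g \<noteq> p"
  shows "pr a * pr g = pr g * pr a"
proof -
  have "dih5 m p n g a \<or> dih5 m p n a g" using near assms by blast
  then have "dih5 a m p n g \<or> dih5 g m p n a" using dih5_rotate by blast
  then show ?thesis using pr_pr_commute_aux assms by metis
qed

definition prime :: "nat \<Rightarrow> nat \<Rightarrow> 'a" where
  "prime a b = (if a = b then e else if a = p then pr b else if b = p then pr a else c a b)"

lemma prime_simps:
  "prime a a = e" "b \<noteq> p \<Longrightarrow> prime p b = pr b" "b \<noteq> p \<Longrightarrow> prime b p = pr b"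
  "a \<noteq> p \<Longrightarrow> b \<noteq> p \<Longrightarrow> prime a b = c a b"
  by (auto simp: prime_def diag)

lemma pr_unit: "e * pr b = pr b" "pr b * e = pr b"
  by (simp_all add: pr_def ops mu_simps algebra_simps unit_left unit_right
     unit_left[THEN arg_cong[where f = "\<lambda>t. t * x" for x], unfolded mult.assoc])

sublocale P: prechordal mu prime e
proof
  have psym: "prime a b = prime b a" for a b by (auto simp: prime_def sym)
  fix a b d f
  show "prime a b = prime b a" by (auto simp: prime_def sym)
  show "prime a a = e" by (simp add: prime_def)
  have "e * e = e" using unit_left[of a a] by (simp add: diag)
  then show "e * prime a b = prime a b" "prime a b * e = prime a b"
    by (auto simp: prime_def pr_unit unit_left unit_right)
  assume d: "dih4 a b d f"
  \<comment> \<open>Rotation and reflection preserve \<open>dih4\<close>; they bring the cases with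
    p at another end to this one.\<close>
  have *: "prime a b * prime d f = prime d f * prime a b"
     if d: "dih4 a b d f" and ne: "a = p" "b \<noteq> p" "d \<noteq> f" "d \<noteq> p" for a b d f
  proof (cases "f = p")
    case True then show ?thesis using pr_pr_commute that by (simp add: prime_simps)
  next
    case False then show ?thesis using pr_commute that by (simp add: prime_simps)
  qed
  consider "a = b \<or> d = f" | "a \<noteq> p" "b \<noteq> p" "d \<noteq> p" "f \<noteq> p"
    | "a \<noteq> b" "d \<noteq> f" "a = p" "d \<noteq> p" | "a \<noteq> b" "d \<noteq> f" "a = p" "d = p" | "a \<noteq> b" "d \<noteq> f" "a \<noteq> p" "b = p" "f \<noteq> p"
    | "a \<noteq> b" "d \<noteq> f" "b = p" "f = p" | "a \<noteq> b" "d \<noteq> f" "a \<noteq> p" "b \<noteq> p" "d = p" | "a \<noteq> b" "d \<noteq> f" "a \<noteq> p" "b \<noteq> p" "f = p"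
    by blast
  then show "prime a b * prime d f = prime d f * prime a b"
  proof cases
    case 1
    have "e * e = e" using unit_left[of a a] by (simp add: diag)
    with 1 show ?thesis by (auto simp: prime_def pr_unit unit_left unit_right)
  next
    case 2 then show ?thesis using commute[OF d] by (simp add: prime_simps)
  next
    case 3 then show ?thesis using *[OF d] by simp
  next
    case 4 then show ?thesis using pr_pr_commute by (simp add: prime_simps)
  next
    case 5
    have "dih4 b a f d" using d dih4_reverse dih4_rotate by blast
    from *[OF this] 5 show ?thesis by (simp add: psym[of a p] psym[of d f])
  next
    case 6 then show ?thesis using pr_pr_commute by (simp add: prime_simps)
  next
    case 7
    have "dih4 d f a b" using d dih4_rotate by blast
    from *[OF this] 7 show ?thesis by simp
  next
    case 8
    have "dih4 f d b a" using d dih4_reverse by blast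
    from *[OF this] 8 show ?thesis by (simp add: psym[of a b] psym[of d p])
  qed
qed

end

section \<open>The relation on four points for twisted chords: algebra of commutators with K\<close>

context qring
begin

lemma J_alt: "J f g = mu (br f g) - mb (br f g) + mu (mb (cm f g))"
  by (simp add: ops mu_simps algebra_simps)

text \<open>\<open>A\<close> and \<open>D\<close> are the relation on five points and its
  antisymmetric form. Substituted into \<open>kap_f\<close>, they leave \<open>J\<close>-terms and a
  last group that does not involve the chords f, g being twisted.\<close>

lemma kap_pair_alg:
  assumes cs: "f * g = g * f" "M * g = g * M" and p': "f' = u * N + v * M - br K f"
    and A: "br (br f K) g = u * br N g + v * br f Q - br N Q + K * h - u * v * h"
    and D: "f * K * g - g * K * f = u * cm N g + v * cm f Q - cm N Q"
    and us: "u * g = g * u" "v * g = g * v"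
  shows "kap (cm f' g) = - mu (mu (K * (f * g))) + mb (mb (f * g * K)) + u * J N g + v * J Q f
    + (mu (K * h - u * v * h - br N Q) - mb (K * h - u * v * h - br N Q) + mu (mu (mu (cm N Q))) + mb (mb (mb (cm N Q))))"
  unfolding kap_f[OF cs(1) p'] A D
  using cs us
  by (simp add: ops mu_simps algebra_simps cs[THEN lcomm] us[THEN lcomm])

text \<open>In \<open>kap_P\<close> with e = u N + v M, the left side is what the summand N
  contributes, partly through e and partly through the double bracket of x with K.\<close>

lemma kap_side:
  assumes cs: "N * x = x * N"
    and A: "br (br N y) x = R + h" and D: "N * y * x - x * y * N = D"
  shows "mu (mu (x * N * y)) - mb (mb (y * x * N)) + kap (cm (br N y) x) = mu R - mb R + mu (mb D) + (mu h - mb h)"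
proof -
  have "mu (mu (x * N * y)) - mb (mb (y * x * N)) + kap (cm (br N y) x) =
     mu (br (br N y) x) - mb (br (br N y) x) + mu (mb (N * y * x - x * y * N))"
    using cs cs[THEN lcomm] by (simp add: ops mu_simps algebra_simps)
  then show ?thesis unfolding A D by (simp add: ops mu_simps algebra_simps)
qed

text \<open>Commutation with K is kept as a predicate so that its closure under all operations can
  be applied as introduction rules to large expressions.\<close>

definition kc :: "'a \<Rightarrow> 'a \<Rightarrow> bool" where "kc K t \<longleftrightarrow> K * t = t * K"

lemma kc_intros:
  "kc K s \<Longrightarrow> kc K t \<Longrightarrow> kc K (s + t)" "kc K s \<Longrightarrow> kc K t \<Longrightarrow> kc K (s - t)" "kc K s \<Longrightarrow> kc K t \<Longrightarrow> kc K (s * t)"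
  "kc K t \<Longrightarrow> kc K (mu t)" "kc K t \<Longrightarrow> kc K (mb t)" "kc K t \<Longrightarrow> kc K (- t)" "kc K K"
  "kc K s \<Longrightarrow> kc K t \<Longrightarrow> kc K (br s t)" "kc K s \<Longrightarrow> kc K t \<Longrightarrow> kc K (cm s t)"
proof -
  show m: "kc K s \<Longrightarrow> kc K t \<Longrightarrow> kc K (s * t)" for s t unfolding kc_def by (metis mult.assoc)
  show a: "kc K s \<Longrightarrow> kc K t \<Longrightarrow> kc K (s + t)" "kc K s \<Longrightarrow> kc K t \<Longrightarrow> kc K (s - t)"
    "kc K t \<Longrightarrow> kc K (mu t)" "kc K t \<Longrightarrow> kc K (- t)" "kc K K" for s t
    unfolding kc_def by (simp_all add: algebra_simps mu_simps)
  show "kc K t \<Longrightarrow> kc K (mb t)" unfolding mb_def by (intro a)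
  show "kc K s \<Longrightarrow> kc K t \<Longrightarrow> kc K (br s t)" "kc K s \<Longrightarrow> kc K t \<Longrightarrow> kc K (cm s t)"
    unfolding br_def cm_def by (intro a m; assumption)+
qed

text \<open>\<open>kap\<close> is linear over K and injective.\<close>

lemma kc_cancel_kap: assumes "kc K (kap t)" shows "kc K t"
proof -
  have "kap (K * t - t * K) = K * kap t - kap t * K"
    unfolding kap_def by (simp add: mu_simps algebra_simps)
  also have "\<dots> = 0" using assms unfolding kc_def by simp
  finally have "kap (K * t - t * K) = 0" .
  then have "K * t - t * K = 0" by (rule cancel_kappa[folded kap_def])
  then show ?thesis unfolding kc_def by simp
qed

text \<open>All of \<open>x\<close>, \<open>W\<close>, \<open>T\<close> involve chords crossing \<open>K\<close>, so the claim is not visible termwise; after applying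
  the injective map \<open>kap\<close> the left side becomes a polynomial in elements that commute with \<open>K\<close>.\<close>

lemma quad_prime_alg:
  assumes y: "K * y = y * K"
    and W: "W = u * N + v * M - br K x"
    and Ry: "br (br x y) x = y + x * (s1 * s3 + s2 * s4) - s1 * s4 - s2 * s3"
    and RK: "br (br x K) x = K + x * (u * N + v * M) - u * v - N * M"
    and Td: "kap (cm T x) = - mu (mu (K * (s4 * x))) + mb (mb (s4 * x * K)) + u * J nd x + v * J M s4 + Z1"
    and Wa: "kap (cm W s1) = - mu (mu (K * (x * s1))) + mb (mb (x * s1 * K)) + u * J N s1 + v * J ma x + Z2"
    and Ta: "kap (cm T s1) = - mu (mu (K * (s4 * s1))) + mb (mb (s4 * s1 * K)) + u * J nd s1 + v * J ma s4 + Z3"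
    and Np: "mu (mu (x * N * y)) - mb (mb (y * x * N)) + kap (cm (br N y) x) = s2 * J nd x + s3 * J N s1 - J nd s1 + H1"
    and Mp: "mu (mu (x * M * y)) - mb (mb (y * x * M)) + kap (cm (br M y) x) = s2 * J M s4 + s3 * J ma x - J ma s4 + H2"
    and cs: "s4 * x = x * s4" "s1 * x = x * s1" "s1 * s4 = s4 * s1"
      "s1 * s3 = s3 * s1" "K * s3 = s3 * K" "x * s3 = s3 * x" "K * s2 = s2 * K" "x * s2 = s2 * x"
      "s2 * u = u * s2" "s3 * u = u * s3" "s2 * v = v * s2" "s3 * v = v * s3" "x * u = u * x" "x * v = v * x"
      "y * u = u * y" "y * v = v * y" "s4 * s2 = s2 * s4" "s4 * s3 = s3 * s4"
    and Z: "kc K Z1" "kc K Z2" "kc K Z3" "kc K H1" "kc K H2" "kc K u" "kc K v" "kc K s2" "kc K s3" "kc K y" "kc K N" "kc K M"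
  shows "kc K (cm (br W y - s2 * T) x - s3 * cm W s1 + cm T s1)"
proof (rule kc_cancel_kap)
  have 1: "cm (s2 * T) x = s2 * cm T x" unfolding cm_def using cs by (simp add: algebra_simps lcomm)
  have 2: "kap (s2 * t) = s2 * kap t" "kap (s3 * t) = s3 * kap t" "kap (r + t) = kap r + kap t" "kap (r - t) = kap r - kap t" for r t
    by (simp_all add: ops mu_simps algebra_simps)
  have 3: "kap (cm (br (u * N + v * M) y) x) = u * kap (cm (br N y) x) + v * kap (cm (br M y) x)"
    using cs(13-16) by (simp add: ops mu_simps algebra_simps cs(13-16)[THEN lcomm])
  have 4: "cm (br W y - s2 * T) x = cm (br W y) x - s2 * cm T x"
    unfolding 1[symmetric] by (simp add: cm_def algebra_simps)
  define Z0 where "Z0 = mu (mu (K * (s2 * s3))) - mb (mb (s2 * s3 * K)) - mu (mu (u * v * y)) + mb (mb (y * (u * v)))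
     - mu (mu (N * M * y)) + mb (mb (y * (N * M)))"
  have "kap (cm (br W y - s2 * T) x - s3 * cm W s1 + cm T s1) =
     kap (cm (br W y) x) - s2 * kap (cm T x) - s3 * kap (cm W s1) + kap (cm T s1)"
    unfolding 4 2 ..
  also have "kap (cm (br W y) x) = Z0 - mu (mu (K * (x * (s1 * s3 + s2 * s4) - s1 * s4)))
     + mb (mb ((x * (s1 * s3 + s2 * s4) - s1 * s4) * K)) + u * (mu (mu (x * N * y)) - mb (mb (y * x * N)) + kap (cm (br N y) x))
     + v * (mu (mu (x * M * y)) - mb (mb (y * x * M)) + kap (cm (br M y) x))"
    unfolding kap_P[OF y W] Ry RK 3 Z0_def using y cs(13-16)
    by (simp add: ops mu_simps algebra_simps cs(13-16)[THEN lcomm])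
  finally have "kap (cm (br W y - s2 * T) x - s3 * cm W s1 + cm T s1) = Z0 + u * H1 + v * H2 - s2 * Z1 - s3 * Z2 + Z3"
    unfolding Np Mp Td Wa Ta unfolding mb_def
    by (simp add: mu_simps algebra_simps cs cs[THEN lcomm])
  then show "kc K (kap (cm (br W y - s2 * T) x - s3 * cm W s1 + cm T s1))"
    unfolding Z0_def by (simp only:) (intro kc_intros Z)
qed

end

context prechordal
begin

lemma commute_quad:
  assumes "dih4 i j k l"
  shows "c i j * c k l = c k l * c i j" "c j k * c i l = c i l * c j k"
  using commute[OF assms] commute[OF dih4_rotate[OF assms]] by (simp_all add: sym[of l i])

end

context qring
begin

text \<open>Expanding W produces the double bracket of K, x, nd, which the relation \<open>B\<close>
  on five points removes; then all terms with u and v cancel. The result trades twisted chords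
  against those at n for old chords against those at m.\<close>

lemma theta_alg:
  assumes B: "br (br K x) nd = v * br M nd + N * br K s4 - br M s4 + x * md - v * N * md"
    and W: "W = u * N + v * M - br K x" and T: "T = u * nd + v * md - br K s4"
    and cs: "nd * N = N * nd" "K * N = N * K" "s4 * N = N * s4" "nd * u = u * nd" "nd * v = v * nd"
      "md * N = N * md" "md * x = x * md"
  shows "br W nd - T * N = br M s4 - md * x"
proof -
  have "br W nd = u * br N nd + v * br M nd - br (br K x) nd"
    unfolding W br_add br_diff using cs by (simp add: br_scale_left)
  then show ?thesis unfolding B T
    using cs by (simp add: ops mu_simps algebra_simps cs[THEN lcomm])
qed

end

context chord_at
begin

text \<open>p occurs once, in the first place, so the relation is inherited linearly from those with
  p replaced by n and m.\<close>

lemma pent_prime1: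
  assumes d: "dih5 p a b d f" and ne: "a \<noteq> p" "b \<noteq> p" "d \<noteq> p" "f \<noteq> p"
  shows "P.pent p a b d f"
proof -
  note dd = move[OF ne d]
  show ?thesis
    unfolding P.pent_def prime_simps(2)[OF ne(1)] prime_simps(2)[OF ne(2)] prime_simps(2)[OF ne(3)]
      prime_simps(2)[OF ne(4)] prime_simps(4)[OF ne(1) ne(2)] prime_simps(4)[OF ne(1) ne(3)]
      prime_simps(4)[OF ne(1) ne(4)] prime_simps(4)[OF ne(2) ne(3)] prime_simps(4)[OF ne(2) ne(4)]
  proof (rule pent_linear1[where N = "c n" and M = "c m" and L = "c p"])
    fix t assume "t \<in> {c a d, c b f, c a b, c b d, c a f}"
    then obtain i j where "t = c i j" "i \<noteq> p" "j \<noteq> p" using ne by blast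
    then show "t * K = K * t \<and> t * u = u * t \<and> t * v = v * t"
      using K_comm u_comm v_comm by simp
  qed (use pent[OF d] dd[THEN pent] in \<open>simp_all add: pr_def pent_def\<close>)
qed

lemma pent_prime2:
  assumes d: "dih5 f p a b d" and ne: "a \<noteq> p" "b \<noteq> p" "d \<noteq> p" "f \<noteq> p"
  shows "P.pent f p a b d"
proof -
  have "dih5 p a b d f" using d dih5_rotate by blast
  from move[OF ne this] have dd: "dih5 f m a b d" "dih5 f n a b d" using dih5_rotate by blast+
  show ?thesis
    unfolding P.pent_def prime_simps(2)[OF ne(1)] prime_simps(2)[OF ne(2)] prime_simps(2)[OF ne(3)]
      prime_simps(4)[OF ne(4) ne(1)] prime_simps(4)[OF ne(4) ne(2)]
      prime_simps(4)[OF ne(4) ne(3)] prime_simps(4)[OF ne(1) ne(2)] prime_simps(4)[OF ne(1) ne(3)]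
  proof (rule pent_linear2[where N = "c n" and M = "c m" and L = "c p"])
    fix t assume "t \<in> {c f a, c a d, c f b, c a b, c f d}"
    then obtain i j where "t = c i j" "i \<noteq> p" "j \<noteq> p" using ne by blast
    then show "t * K = K * t \<and> t * u = u * t \<and> t * v = v * t"
      using K_comm u_comm v_comm by simp
  qed (use pent[OF d] dd[THEN pent] in \<open>simp_all add: pr_def pent_def\<close>)
qed

lemma pent_prime4:
  assumes d: "dih5 b d f p a" and ne: "a \<noteq> p" "b \<noteq> p" "d \<noteq> p" "f \<noteq> p"
  shows "P.pent b d f p a"
proof -
  have "dih5 p a b d f" using d dih5_rotate by blast
  from move[OF ne this] have dd: "dih5 b d f m a" "dih5 b d f n a" using dih5_rotate by blast+
  show ?thesis
    unfolding P.pent_def prime_simps(3)[OF ne(2)] prime_simps(3)[OF ne(3)] prime_simps(3)[OF ne(4)]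
      prime_simps(4)[OF ne(2) ne(4)] prime_simps(4)[OF ne(4) ne(1)]
      prime_simps(4)[OF ne(3) ne(4)] prime_simps(4)[OF ne(3) ne(1)] prime_simps(4)[OF ne(2) ne(1)]
  proof (rule pent_linear4[where N = "c n" and M = "c m" and L = "c p"])
    fix t assume "t \<in> {c b f, c f a, c d f, c d a, c b a}"
    then obtain i j where "t = c i j" "i \<noteq> p" "j \<noteq> p" using ne by blast
    then show "t * K = K * t \<and> t * u = u * t \<and> t * v = v * t"
      using K_comm u_comm v_comm by simp
  qed (use pent[OF d] dd[THEN pent] in \<open>simp_all add: pr_def pent_def sym[of b p] sym[of b n] sym[of b m] sym[of d p] sym[of d n] sym[of d m] sym[of f p] sym[of f n] sym[of f m]\<close>)
qed

lemma pent_prime5: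
  assumes d: "dih5 a b d f p" and ne: "a \<noteq> p" "b \<noteq> p" "d \<noteq> p" "f \<noteq> p"
  shows "P.pent a b d f p"
proof -
  have "dih5 p a b d f" using d dih5_rotate by blast
  from move[OF ne this] have dd: "dih5 a b d f m" "dih5 a b d f n" using dih5_rotate by blast+
  show ?thesis
    unfolding P.pent_def prime_simps(3)[OF ne(3)] prime_simps(3)[OF ne(2)] prime_simps(3)[OF ne(1)]
      prime_simps(4)[OF ne(1) ne(3)] prime_simps(4)[OF ne(2) ne(4)]
      prime_simps(4)[OF ne(2) ne(3)] prime_simps(4)[OF ne(1) ne(4)] prime_simps(4)[OF ne(3) ne(4)]
  proof (rule pent_linear5[where N = "c n" and M = "c m" and L = "c p"])
    fix t assume "t \<in> {c a d, c b f, c b d, c d f, c a f}"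
    then obtain i j where "t = c i j" "i \<noteq> p" "j \<noteq> p" using ne by blast
    then show "t * K = K * t \<and> t * u = u * t \<and> t * v = v * t"
      using K_comm u_comm v_comm by simp
  qed (use pent[OF d] dd[THEN pent] in \<open>simp_all add: pr_def pent_def sym[of a p] sym[of a n] sym[of a m] sym[of b p] sym[of b n] sym[of b m] sym[of d p] sym[of d n] sym[of d m]\<close>)
qed

lemma theta:
  assumes d: "dih5 m p n b d" and ne: "b \<noteq> p" "d \<noteq> p"
  shows "br (pr b) (c n d) - pr d * c n b = br (c m b) (c p d) - c m d * c p b"
proof (rule theta_alg[OF _ pr_def pr_def])
  show "br (br K (c p b)) (c n d) = v * br (c m b) (c n d) + c n b * br K (c p d) - br (c m b) (c p d) + c p b * c m d - v * c n b * c m d"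
    using pent[OF d] unfolding pent_def .
  note d4 = dih5_imp_dih4[OF d]
  show "K * c n b = c n b * K" by (simp add: K_comm ne neq)
  show "c p d * c n b = c n b * c p d" "c m d * c n b = c n b * c m d" "c m d * c p b = c p b * c m d"
    by (rule d4[THEN commute_quad(1)] d4[THEN commute_quad(2)] d4[THEN commute_quad(2), symmetric])+
qed (rule commute_share u_comm v_comm)+

end

context chord_at
begin

text \<open>The remainder \<open>Z\<close> is built from K, u, v and chords avoiding p. Only its
  commutation with K matters afterwards, so its formula is hidden.\<close>

lemma kap_pair:
  assumes d: "dih5 g m p n h" and ne: "g \<noteq> p" "h \<noteq> p"
  obtains Z where "kc K Z" "kap (cm (pr g) (c p h)) = - mu (mu (K * (c p g * c p h))) + mb (mb (c p g * c p h * K))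
     + u * J (c n g) (c p h) + v * J (c m h) (c p g) + Z"
proof -
  note d4 = dih5_imp_dih4[OF d]
  have 1: "br (br (c p g) K) (c p h) = u * br (c n g) (c p h) + v * br (c p g) (c m h) - br (c n g) (c m h) + K * c g h - u * v * c g h"
    using pent[OF d] unfolding pent_def by (simp only: sym[of g p] sym[of g n] sym[of g m])
  have 2: "c p g * K * c p h - c p h * K * c p g = u * cm (c n g) (c p h) + v * cm (c p g) (c m h) - cm (c n g) (c m h)"
    using pent_cm[OF d] by (simp only: sym[of g p] sym[of g n] sym[of g m])
  have 3: "c m g * c p h = c p h * c m g"
    using commute_quad(1)[OF d4(2)] by (simp only: sym[of g m])
  have k: "kc K (c i j)" if "i \<noteq> p" "j \<noteq> p" for i j using K_comm that unfolding kc_def by simp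
  have kuv: "kc K u" "kc K v" unfolding kc_def by (rule u_comm v_comm)+
  show ?thesis
    by (rule that[OF _ kap_pair_alg[OF commute_share(1) 3 pr_def 1 2 u_comm[symmetric] v_comm[symmetric]]])
      (intro kc_intros k kuv neq ne)
qed

text \<open>This is the one relation in which two twisted chords are genuinely bracketed.
  \<open>W\<close>, \<open>S\<close>, \<open>T\<close> are the twisted chords from p to b, a, d; the
  old chords x, s1, s4 are recovered from them by \<open>pr_K\<close>.\<close>

lemma quad_prime_aux:
  assumes d6: "dih6 m p n a b d" and ne: "a \<noteq> p" "b \<noteq> p" "d \<noteq> p"
  shows "br (br (pr b) (c a d)) (pr b) = c a d - c a b * c b d + c a b * (pr d * pr b) + c b d * (pr b * pr a) - pr d * pr a"
proof -
  note d5 = dih6_imp_dih5[OF d6]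
  note q = d5[THEN dih5_imp_dih4(1)] d5[THEN dih5_imp_dih4(2)] d5[THEN dih5_imp_dih4(3)]
    d5[THEN dih5_imp_dih4(4)] d5[THEN dih5_imp_dih4(5)]
  note cc = q[THEN commute_quad(1)] q[THEN commute_quad(2)]
  note pc = q[THEN P.commute_quad(1)] q[THEN P.commute_quad(2)]
  note nes = ne neq ne[symmetric] neq[symmetric]
  define x s1 s4 N M na ma nd md where "x = c p b" "s1 = c p a" "s4 = c p d" "N = c n b" "M = c m b"
    "na = c n a" "ma = c m a" "nd = c n d" "md = c m d"
  note defs = this
  define y s2 s3 where "y = c a d" "s2 = c a b" "s3 = c b d"
  note defs' = this
  define W S T where "W = pr b" "S = pr a" "T = pr d"
  note defs'' = this
  note D = defs defs'
  have prim: "prime p b = W" "prime p a = S" "prime p d = T" "prime n b = N" "prime m b = M"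
    "prime n a = na" "prime n d = nd" "prime m a = ma" "prime m d = md" "prime a b = s2" "prime a d = y" "prime b d = s3"
    "prime p n = u" "prime n p = u" "prime m p = v" "prime p m = v" "prime m n = K"
    unfolding D defs'' using nes by (simp_all add: prime_simps pr_near)
  have W: "W = u * N + v * M - br K x" and S: "S = u * na + v * ma - br K s1" and T: "T = u * nd + v * md - br K s4"
    unfolding D defs'' pr_def by (rule refl)+
  have WK: "br W K = v * N + u * M - x" and SK: "br S K = v * na + u * ma - s1" and TK: "br T K = v * nd + u * md - s4"
    unfolding D defs'' by (rule pr_K, rule ne)+

  have cuv: "x * u = u * x" "s1 * u = u * s1" "s4 * u = u * s4" "N * u = u * N" "M * u = u * M" "na * u = u * na"
     "ma * u = u * ma" "nd * u = u * nd" "md * u = u * md" "y * u = u * y" "s2 * u = u * s2" "s3 * u = u * s3"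
     "K * u = u * K" "v * u = u * v"
     "x * v = v * x" "s1 * v = v * s1" "s4 * v = v * s4" "N * v = v * N" "M * v = v * M" "na * v = v * na"
     "ma * v = v * ma" "nd * v = v * nd" "md * v = v * md" "y * v = v * y" "s2 * v = v * s2" "s3 * v = v * s3"
     "K * v = v * K"
    unfolding D by (rule u_comm v_comm)+
  have cK: "N * K = K * N" "M * K = K * M" "na * K = K * na" "ma * K = K * ma" "nd * K = K * nd" "md * K = K * md"
     "y * K = K * y" "s2 * K = K * s2" "s3 * K = K * s3"
    unfolding D by (rule K_comm; simp add: nes)+
  have cs2: "x * s2 = s2 * x" "s1 * s2 = s2 * s1" "s4 * s2 = s2 * s4" "N * s2 = s2 * N" "M * s2 = s2 * M"
    "na * s2 = s2 * na" "ma * s2 = s2 * ma" "nd * s2 = s2 * nd" "md * s2 = s2 * md" "y * s2 = s2 * y" "s3 * s2 = s2 * s3"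
    unfolding D by (rule commute_share cc cc[symmetric])+
  have cs3: "x * s3 = s3 * x" "s1 * s3 = s3 * s1" "s4 * s3 = s3 * s4" "N * s3 = s3 * N" "M * s3 = s3 * M"
    "na * s3 = s3 * na" "ma * s3 = s3 * ma" "nd * s3 = s3 * nd" "md * s3 = s3 * md" "y * s3 = s3 * y"
    unfolding D by (rule commute_share cc cc[symmetric])+
  have cx: "x * s1 = s1 * x" "x * s4 = s4 * x" "s4 * s1 = s1 * s4" "x * N = N * x" "x * M = M * x" "md * x = x * md"
     "M * s1 = s1 * M" "md * s1 = s1 * md"
    unfolding D by (rule commute_share cc cc[symmetric])+
  have cP: "W * s2 = s2 * W" "S * s2 = s2 * S" "T * s2 = s2 * T" "W * s3 = s3 * W" "S * s3 = s3 * S" "T * s3 = s3 * T"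
     "W * S = S * W" "W * T = T * W" "T * S = S * T" "T * N = N * T" "W * na = na * W" "T * na = na * T"
    unfolding prim[symmetric] by (rule P.commute_share pc pc[symmetric])+

  have dq: "dih4 p a b d" "dih4 p n b m" "dih5 n a b d p" "dih5 p d b a n" "dih5 m d b a p" "dih5 p a b d m"
    "dih5 m p n b d" "dih5 m p n a b" "dih5 m p n a d" "dih5 d m p n b" "dih5 b m p n a" "dih5 d m p n a"
    using q d5 d5[THEN dih5_reverse] dih4_rotate dih5_rotate by meson+

  have Ry: "br (br x y) x = y + x * (s1 * s3 + s2 * s4) - s1 * s4 - s2 * s3"
    using quad[OF dq(1)] unfolding D .
  have RK: "br (br x K) x = K + x * (u * N + v * M) - u * v - N * M"
    using quad[OF dq(2)] unfolding D
    by (simp only: sym[of n m] sym[of b m] sym[of p m] add.commute u_comm[of n b] u_comm[of p n])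
  have An: "br (br N y) x = s2 * br nd x + s3 * br N s1 - br nd s1 + y * v - s2 * s3 * v"
    using pent[OF dq(3)] unfolding pent_def D by (simp only: sym[of b p] sym[of a p] sym[of d p] sym[of n p])
  have Dn: "N * y * x - x * y * N = s2 * cm nd x + s3 * cm N s1 - cm nd s1"
    using pent_cm[OF dq(3)] unfolding D by (simp only: sym[of b p] sym[of a p] sym[of d p] sym[of n p])
  have Bm: "br (br M y) x = s3 * br ma x + s2 * br M s4 - br ma s4 + y * u - s3 * s2 * u"
    using pent[OF dq(5)] unfolding pent_def D by (simp only: sym[of b p] sym[of a p] sym[of d p] sym[of d b] sym[of b a] sym[of d a])
  have Dm: "M * y * x - x * y * M = s3 * cm ma x + s2 * cm M s4 - cm ma s4"
    using pent_cm[OF dq(5)] unfolding D by (simp only: sym[of b p] sym[of a p] sym[of d p] sym[of d b] sym[of b a] sym[of d a])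
  \<comment> \<open>The relations with p in a single place of the five are already known for the
    twisted chords.\<close>
  have Apm: "br (br W y) M = s2 * br T M + s3 * br W ma - br T ma + y * v - s2 * s3 * v"
    using pent_prime1[OF dq(6)] nes unfolding P.pent_def prim[symmetric] by (simp only: P.sym[of b m] P.sym[of a m] P.sym[of d m] P.sym[of m p] simp_thms)
  have Bpn: "br (br W y) N = s3 * br S N + s2 * br W nd - br S nd + y * u - s3 * s2 * u"
    using pent_prime1[OF dq(4)] nes unfolding P.pent_def prim[symmetric] by (simp only: P.sym[of n p] P.sym[of b n] P.sym[of a n] P.sym[of d n] P.sym[of d b] P.sym[of b a] P.sym[of d a] simp_thms)
  have th: "br W nd - T * N = br M s4 - md * x" "br S N - W * na = br ma x - M * s1" "br S nd - T * na = br ma s4 - md * s1"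
    using theta[OF dq(7)] theta[OF dq(8)] theta[OF dq(9)] ne unfolding D defs'' by simp_all

  obtain Z1 where Z1: "kc K Z1" and Td: "kap (cm T x) = - mu (mu (K * (s4 * x))) + mb (mb (s4 * x * K)) + u * J nd x + v * J M s4 + Z1"
    using kap_pair[OF dq(10) ne(3,2)] unfolding D defs'' by metis
  obtain Z2 where Z2: "kc K Z2" and Wa: "kap (cm W s1) = - mu (mu (K * (x * s1))) + mb (mb (x * s1 * K)) + u * J N s1 + v * J ma x + Z2"
    using kap_pair[OF dq(11) ne(2,1)] unfolding D defs'' by metis
  obtain Z3 where Z3: "kc K Z3" and Ta: "kap (cm T s1) = - mu (mu (K * (s4 * s1))) + mb (mb (s4 * s1 * K)) + u * J nd s1 + v * J ma s4 + Z3"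
    using kap_pair[OF dq(12) ne(3,1)] unfolding D defs'' by metis
  define H1 where "H1 = mu (y * v - s2 * s3 * v) - mb (y * v - s2 * s3 * v)"
  define H2 where "H2 = mu (y * u - s3 * s2 * u) - mb (y * u - s3 * s2 * u)"
  have kcs: "kc K u" "kc K v" "kc K s2" "kc K s3" "kc K y" "kc K N" "kc K M"
    unfolding kc_def using cuv cK by simp_all
  have Np: "mu (mu (x * N * y)) - mb (mb (y * x * N)) + kap (cm (br N y) x) = s2 * J nd x + s3 * J N s1 - J nd s1 + H1"
  proof -
    have "br (br N y) x = (s2 * br nd x + s3 * br N s1 - br nd s1) + (y * v - s2 * s3 * v)" using An by simp
    from kap_side[OF cx(4)[symmetric] this Dn]
    show ?thesis unfolding H1_def J_alt mb_def by (simp add: mu_simps algebra_simps)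
  qed
  have Mp: "mu (mu (x * M * y)) - mb (mb (y * x * M)) + kap (cm (br M y) x) = s2 * J M s4 + s3 * J ma x - J ma s4 + H2"
  proof -
    have "br (br M y) x = (s3 * br ma x + s2 * br M s4 - br ma s4) + (y * u - s3 * s2 * u)" using Bm by simp
    from kap_side[OF cx(5)[symmetric] this Dm]
    show ?thesis unfolding H2_def J_alt mb_def by (simp add: mu_simps algebra_simps)
  qed
  \<comment> \<open>The separate commutators need not commute with K; this combination does.\<close>
  have AC: "kc K (cm (br W y - s2 * T) x - s3 * cm W s1 + cm T s1)"
    by (rule quad_prime_alg[OF cK(7)[symmetric] W Ry RK Td Wa Ta Np Mp])
      (auto intro!: kcs Z1 Z2 Z3 kc_intros simp: cuv cK cs2 cs3 cx H1_def H2_def)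

  \<comment> \<open>The goal is \<open>br F' W - s3 * br W S + br T S = y - s2 * s3\<close>. The
    combination \<open>F'\<close> satisfies \<open>br F' K = Fb - F\<close>, the form of the inverse
    formula for one twisted chord, so \<open>br_prime\<close> evaluates all three brackets.\<close>
  define F F' Fb where "F = br x y - s2 * s4" "F' = br W y - s2 * T"
    "Fb = br (v * N + u * M) y - s2 * (v * nd + u * md)"
  note Fdefs = this
  have e: "br (br W y) K = br (v * N + u * M - x) y" "br (s2 * T) K = s2 * (v * nd + u * md - s4)"
    unfolding WK[symmetric] TK[symmetric] by (rule br_right_comm br_scale_left, rule cK)+
  have F'K: "br F' K = Fb - F"
    unfolding Fdefs br_diff e right_diff_distrib by simp
  note E1 = br_prime[OF F'K W] and E2 = br_prime[OF WK S] and E3 = br_prime[OF TK S]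
  \<comment> \<open>The defects of associativity produced by the three uses of
    \<open>br_prime\<close> cancel in this combination.\<close>
  have C: "cm K (cm F' x) - s3 * cm K (cm W s1) + cm K (cm T s1) = 0"
    using AC cK(9) cK(9)[THEN lcomm] unfolding kc_def Fdefs(2) cm_def by (simp add: algebra_simps)
  have "br F' W - s3 * br W S + br T S
     = (br F x - s3 * br x s1 + br s4 s1) - (br Fb x - s3 * br (v * N + u * M) s1 + br (v * nd + u * md) s1)
      + (br F' (u * N + v * M) - s3 * br W (u * na + v * ma) + br T (u * na + v * ma))
      + mu (mb (cm K (cm F' x) - s3 * cm K (cm W s1) + cm K (cm T s1)))"
    unfolding E1 E2 E3 by (simp add: mb_def mu_simps algebra_simps)
  \<comment> \<open>The contribution of the old chords alone is the old relation on four
    points.\<close>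
  also have "br F x - s3 * br x s1 + br s4 s1 = y - s2 * s3"
  proof -
    have "br (s2 * s4) x = s2 * (x * s4)" "br x s1 = x * s1" "br s4 s1 = s1 * s4"
      using cs2 cx by (simp_all add: br_commute br_scale_left)
    then show ?thesis unfolding Fdefs br_diff Ry
      by (simp add: algebra_simps cs2 cs3 cs2[THEN lcomm] cs3[THEN lcomm])
  qed
  \<comment> \<open>The relation on the points n, a, b, d, p settles the part with factor v; the
    part with factor u is kept to be matched below.\<close>
  also have "br Fb x - s3 * br (v * N + u * M) s1 + br (v * nd + u * md) s1
     = v * (y * v - s2 * s3 * v) + u * (br (br M y) x - s2 * (md * x) - s3 * (M * s1) + md * s1)"
  proof -
    have 1: "br (v * t) y = v * br t y" "br (u * t) y = u * br t y" "br (v * t) x = v * br t x" "br (u * t) x = u * br t x"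
      "br (v * t) s1 = v * br t s1" "br (u * t) s1 = u * br t s1" "br (s2 * t) x = s2 * br t x" for t
      by (rule br_scale_left, rule cuv[symmetric] cs2[symmetric])+
    have 2: "br M s1 = M * s1" "br md s1 = md * s1" "br md x = md * x"
      using cx by (simp_all add: br_commute)
    show ?thesis unfolding Fdefs br_diff br_add distrib_left 1 An 2
      by (simp add: algebra_simps cuv cs2 cs3 cuv[THEN lcomm] cs2[THEN lcomm] cs3[THEN lcomm])
  qed
  also have "br F' (u * N + v * M) - s3 * br W (u * na + v * ma) + br T (u * na + v * ma)
     = u * (br (br W y) N - s2 * (T * N) - s3 * (W * na) + T * na) + v * (y * v - s2 * s3 * v)"
  proof -
    have uW: "u * W = W * u" "u * T = T * u" "v * W = W * v" "v * T = T * v"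
      unfolding prim[symmetric] by (rule P.commute_share)+
    have "kc u (br W y)" "kc v (br W y)"
      by (rule kc_intros; simp add: kc_def uW cuv)+
    with uW have 1: "br W (u * t) = u * br W t" "br T (u * t) = u * br T t" "br W (v * t) = v * br W t" "br T (v * t) = v * br T t"
      "br (br W y) (u * t) = u * br (br W y) t" "br (br W y) (v * t) = v * br (br W y) t" for t
      by (simp_all add: br_scale_right kc_def)
    have 2: "br T N = T * N" "br W na = W * na" "br T na = T * na"
      using cP by (simp_all add: br_commute)
    have 3: "br (s2 * T) (u * N) = s2 * br T (u * N)" "br (s2 * T) (v * M) = s2 * br T (v * M)"
      by (rule br_scale_left; simp add: mult.assoc cuv cs2 cuv[THEN lcomm])+
    show ?thesis unfolding Fdefs br_diff br_add 3 1 2 Apm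
      by (simp add: algebra_simps cuv cs2 cs3 cuv[THEN lcomm] cs2[THEN lcomm] cs3[THEN lcomm])
  qed
  \<comment> \<open>The two coefficients of u agree: the left one is evaluated by the twisted
    relation at n, the right one by the old relation at m, and \<open>theta\<close> converts between
    them.\<close>
  also have "br (br W y) N - s2 * (T * N) - s3 * (W * na) + T * na = br (br M y) x - s2 * (md * x) - s3 * (M * s1) + md * s1"
  proof -
    have t: "br W nd = br M s4 - md * x + T * N" "br S N = br ma x - M * s1 + W * na" "br S nd = br ma s4 - md * s1 + T * na"
      using th by (simp_all add: algebra_simps)
    show ?thesis unfolding Bpn Bm t by (simp add: algebra_simps)
  qed
  finally have "br F' W - s3 * br W S + br T S = y - s2 * s3"
    unfolding C by (simp add: mb_def)
  moreover have "br F' W = br (br W y) W - s2 * (T * W)" "br W S = W * S" "br T S = T * S"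
    unfolding Fdefs br_diff using cP by (simp_all add: br_commute br_scale_left)
  ultimately have "br (br W y) W = y - s2 * s3 + s2 * (T * W) + s3 * (W * S) - T * S"
    by (simp add: algebra_simps)
  then show ?thesis unfolding D defs'' .
qed

lemma quad_prime:
  assumes d: "dih4 p a b d" and ne: "a \<noteq> p" "b \<noteq> p" "d \<noteq> p"
  shows "P.pent p a b d p"
proof -
  interpret swap: chord_at mu c e n p m
    using adj by unfold_locales blast
  \<comment> \<open>The twisted chord is symmetric in m and n, so the opposite orientation of the
    six points is covered by exchanging them.\<close>
  have "swap.pr = pr"
    by (rule ext) (simp add: pr_def swap.pr_def sym[of n p] sym[of p m] sym[of n m] add.commute)
  then have *: "br (br (pr b) (c a d)) (pr b) = c a d - c a b * c b d + c a b * (pr d * pr b) + c b d * (pr b * pr a) - pr d * pr a"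
    using near3[OF ne d] quad_prime_aux[OF _ ne] swap.quad_prime_aux[OF _ ne] by auto
  have s: "c a b * pr d = pr d * c a b" "c b d * pr b = pr b * c b d" "c a b * pr b = pr b * c a b" "pr d * pr b = pr b * pr d" "pr d * pr a = pr a * pr d"
     "c b d * pr a = pr a * c b d"
    using P.commute_quad[OF d] P.commute_share[of b d p] P.commute_share[of b a p] P.commute_share[of p b d] P.commute_share[of p a d]
      P.commute_share[of p a b] ne
    by (simp_all add: prime_simps sym[of b a])
  show ?thesis unfolding P.quad_iff[OF d]
    using ne by (simp add: prime_simps * algebra_simps s s[THEN lcomm])
qed

end

text \<open>If two points that are not neighbours coincide, all points on one of the two arcs
  between them coincide as well.\<close>

lemma dih5_sparse:
  assumes "dih5 a b d f g" "a \<noteq> b" "b \<noteq> d" "d \<noteq> f" "f \<noteq> g"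
  shows "a \<noteq> d" "a \<noteq> f" "b \<noteq> f" "b \<noteq> g" "d \<noteq> g"
  using assms unfolding dih5_def cyc5_def by (elim disjE; simp)+

context chord_at
begin

text \<open>The cases follow the position of p; two equal points among the five can only be the
  first and the last.\<close>

lemma pent_prime:
  assumes d: "dih5 a b d f g"
  shows "P.pent a b d f g"
proof (cases "a = b \<or> b = d \<or> d = f \<or> f = g")
  case True then show ?thesis by (rule P.pent_degenerate)
next
  case False
  then have ne: "a \<noteq> b" "b \<noteq> d" "d \<noteq> f" "f \<noteq> g" by auto
  note sp = dih5_sparse[OF d ne]
  note d4 = dih5_imp_dih4[OF d]
  consider "p \<notin> {a, b, d, f, g}" | "a = p" "g = p" | "a = p" "g \<noteq> p" | "b = p" | "d = p" "a = g" | "d = p" "a \<noteq> g"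
    | "f = p" | "a \<noteq> p" "g = p" by auto
  then show ?thesis
  proof cases
    case 1
    then show ?thesis using pent[OF d] unfolding P.pent_def pent_def by (auto simp: prime_simps)
  next
    case 2
    then show ?thesis using quad_prime[of b d f] d4(1) ne sp by auto
  next
    case 3
    then show ?thesis using pent_prime1[of b d f g] d ne sp by auto
  next
    case 4
    then show ?thesis using pent_prime2[of a d f g] d ne sp by auto
  next
    case 5
    \<comment> \<open>p is one end of the diagonal that occurs twice; a half turn makes it the first
      and last point.\<close>
    have "dih4 p f a b" using d4(1) 5 dih4_rotate by blast
    from P.quad_swap[OF this quad_prime[OF this]] show ?thesis using 5 ne sp by simp
  next
    case 6
    \<comment> \<open>With p in the middle two twisted chords are bracketed. Rotating p to the front
      makes the relation linear, and \<open>pent_rotate\<close>, applied to the twisted chords,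
      brings it back.\<close>
    have r: "dih5 p f g a b" using d 6 dih5_rotate by blast
    note r4 = dih5_imp_dih4[OF r]
    have "P.pent p f g a b" "P.pent p f g a p" "P.pent p f g b p"
      by (rule pent_prime1[OF r] quad_prime[OF r4(1)] quad_prime[OF r4(2)]; use 6 ne sp in simp)+
    then show ?thesis using P.pent_rotate[OF r] 6 by simp
  next
    case 7
    then show ?thesis using pent_prime4[of a b d g] d ne sp by auto
  next
    case 8
    then show ?thesis using pent_prime5[of a b d f] d ne sp by auto
  qed
qed

sublocale P: chordal mu prime e
  by unfold_locales (rule pent_prime)

end

section \<open>The substitution q -> 1/q\<close>

context qring
begin

text \<open>For mu = q^2 / (q^2 - 1) the substitution q -> 1/q gives 1 - mu. Both cancellation
  assumptions are invariant under it up to sign.\<close>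

lemma flip: "qring (\<lambda>x. x - mu x)"
proof
  show "x + y - mu (x + y) = x - mu x + (y - mu y)" "(x - mu x) * y = x * y - mu (x * y)"
    "x * (y - mu y) = x * y - mu (x * y)" for x y
    by (simp_all add: mu_simps algebra_simps)
  show "x = 0" if "x - mu x + (x - mu x) = x" for x
    by (rule cancel_two) (use that in \<open>simp add: algebra_simps\<close>)
  show "x = 0" if "x - mu x - mu (x - mu x) + (x - mu x - mu (x - mu x)) - (x - mu x) - (x - mu x) + x = 0" for x
    by (rule cancel_kappa) (use that in \<open>simp add: mu_simps algebra_simps\<close>)
qed

lemma flip_br: "qring.br (\<lambda>x. x - mu x) x y = br y x"
  by (simp add: qring.br_def[OF flip] ops mu_simps algebra_simps)

end

context prechordal
begin

lemma flip_prechordal: "prechordal (\<lambda>x. x - mu x) c e"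
proof -
  interpret F: qring "\<lambda>x. x - mu x" by (rule flip)
  show ?thesis by unfold_locales (fact sym diag unit_left unit_right commute)+
qed

text \<open>Exchanging the arguments of every bracket reverses the double bracket; as its outer
  chords share the point d they commute, so \<open>br_jac\<close> turns this into the reflected
  relation.\<close>

lemma flip_pent: "prechordal.pent (\<lambda>x. x - mu x) c a b d f g \<longleftrightarrow> pent g f d b a"
proof -
  interpret F: prechordal "\<lambda>x. x - mu x" c e by (rule flip_prechordal)
  have s: "c g d = c d g" "c f b = c b f" "c d a = c a d" "c f d = c d f" "c g b = c b g" "c d b = c b d"
    "c f a = c a f" "c g a = c a g" by (simp_all add: sym)
  have 1: "br (br (c d g) (c b f)) (c a d) = br (c d g) (br (c b f) (c a d))"
    by (rule br_jac[symmetric]) (rule commute_share)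
  have 2: "c d f * c b d = c b d * c d f" by (rule commute_share)
  show ?thesis
    unfolding F.pent_def pent_def flip_br s 1 by (simp add: 2 algebra_simps)
qed

end

context chordal
begin

lemma flip_chordal: "chordal (\<lambda>x. x - mu x) c e"
proof -
  interpret F: prechordal "\<lambda>x. x - mu x" c e by (rule flip_prechordal)
  show ?thesis by unfold_locales (simp add: flip_pent pent dih5_reverse)
qed

end

section \<open>Reduction to increasing points\<close>

lemma dih4_imp_dih5: "dih4 a b d f \<Longrightarrow> dih5 a b d f a"
  unfolding dih5_def cyc5_def dih4_def cyc4_def by (elim disjE) simp_all

lemma dih4_min: "dih4 a b d f \<Longrightarrow> dih4 (min a k) (min b k) (min d k) (min f k)"
  unfolding dih4_def cyc4_def by (elim disjE) (simp_all add: min.coboundedI1 min_le_iff_disj)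

lemma dih5_min: "dih5 a b d f g \<Longrightarrow> dih5 (min a k) (min b k) (min d k) (min f k) (min g k)"
  unfolding dih5_def cyc5_def by (elim disjE) (simp_all add: min.coboundedI1 min_le_iff_disj)

lemma dih4_interval:
  assumes "dih4 a b d f" "a \<noteq> b" "d \<noteq> f"
  shows "max a b \<le> min d f \<or> max d f \<le> min a b \<or> min d f \<le> min a b \<and> max a b \<le> max d f
     \<or> min a b \<le> min d f \<and> max d f \<le> max a b"
  using assms unfolding dih4_def cyc4_def by (elim disjE) (auto simp: min_def max_def)

context prechordal
begin

text \<open>For a < b < d < f this is the element C_IJ of the intervals I from a to b and J from d
  to f, expanded across the hole from b to d.\<close>

definition cpair :: "nat \<Rightarrow> nat \<Rightarrow> nat \<Rightarrow> nat \<Rightarrow> 'a" where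
  "cpair a b d f = - br (c a d) (c b f) + c a b * c d f + c b d * c a f"

lemma quad_reverse:
  assumes d: "dih4 a b d f" and p: "pent a b d f a"
  shows "pent a f d b a"
proof -
  have d': "dih4 a f d b" using d dih4_reverse dih4_rotate by blast
  have s: "c d b = c b d" "c f d = c d f" "c f b = c b f" by (simp_all add: sym)
  have 2: "c a f * c b d = c b d * c a f" "c d f * c a b = c a b * c d f"
    using commute_quad[OF d] by simp_all
  have 3: "c a f * c a b = c a b * c a f" "c d f * c b d = c b d * c d f"
    by (rule commute_share)+
  show ?thesis
    using p unfolding quad_iff[OF d] quad_iff[OF d'] s 2 3 by (simp add: algebra_simps)
qed

text \<open>The left side is the shape of relation (ii) with its nonadjacent pair expanded.
  \<open>br_jac\<close> moves the outer bracket into the position used in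
  \<open>pent\<close>.\<close>

lemma cpair_iff:
  assumes d: "dih4 a b d f"
  shows "c b f = - br (c a d) (cpair f d b a) + c b d * c d f + c a b * c a f \<longleftrightarrow> pent a b d f a"
proof -
  have s: "c d a = c a d" "c f a = c a f" "c f b = c b f" by (simp_all add: sym)
  have cs: "c a b * c a d = c a d * c a b" "c d f * c a d = c a d * c d f" "c b d * c a d = c a d * c b d"
    "c a f * c a d = c a d * c a f" "c a f * c b d = c b d * c a f" "c d f * c a b = c a b * c d f"
    by (rule commute_share commute_quad(1)[OF d, symmetric] commute_quad(2)[OF d, symmetric])+
  have "br (c a d) (br (c b f) (c a d)) = br (br (c a d) (c b f)) (c a d)"
    by (rule br_jac) simp
  moreover have "br (c a d) (c d f * c a b) = c a d * (c a b * c d f)" "br (c a d) (c b d * c a f) = c a d * (c b d * c a f)"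
    using cs cs[THEN lcomm] by (simp_all add: ops mu_simps algebra_simps)
  moreover have "cpair f d b a = - br (c b f) (c a d) + c d f * c a b + c b d * c a f"
    by (simp add: cpair_def sym[of f b] sym[of d a] sym[of f d] sym[of b a] sym[of d b] sym[of f a])
  ultimately have 1: "br (c a d) (cpair f d b a) = - br (br (c a d) (c b f)) (c a d) + c a d * (c a b * c d f) + c a d * (c b d * c a f)"
    by (simp add: br_add br_minus br_diff)
  show ?thesis unfolding 1 quad_iff[OF d] by (auto simp: algebra_simps)
qed

text \<open>The left side is the shape of relation (iii): the chords that share the point d or do
  not cross come out of the bracket with the last chord.\<close>

lemma cpair5_iff:
  assumes d: "dih5 a b d f g"
  shows "cpair a b f g = - br (cpair a b d f) (c d g) + c a b * c f g + c d f * cpair a b d g \<longleftrightarrow> pent a b d f g"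
proof -
  note d4 = dih5_imp_dih4[OF d]
  have cs: "c a b * c d f = c d f * c a b" "c b d * c a g = c a g * c b d" "c b f * c a g = c a g * c b f"
    "c b d * c d g = c d g * c b d" "c d f * c d g = c d g * c d f" "c a b * c d g = c d g * c a b"
    "c b d * c d f = c d f * c b d"
    by (rule commute_share d4[THEN commute_quad(1)] d4[THEN commute_quad(2)])+
  have h: "br (cpair a b d f) (c d g) = - br (br (c a d) (c b f)) (c d g) + c d f * (c a b * c d g) + c b d * br (c a f) (c d g)"
    unfolding cpair_def br_add br_minus using cs cs[THEN lcomm]
    by (simp add: ops mu_simps algebra_simps)
  show ?thesis unfolding pent_def h cpair_def[of a b f g] cpair_def[of a b d g]
    by (auto simp: algebra_simps cs cs[THEN lcomm])
qed

text \<open>Half turns and the reflection through the first diagonal come for free, so one relation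
  per diagonal is enough.\<close>

lemma quads_of_sorted:
  assumes quad1: "\<And>a b d f. a < b \<Longrightarrow> b < d \<Longrightarrow> d < f \<Longrightarrow> f \<le> k \<Longrightarrow> pent a b d f a"
    and quad2: "\<And>a b d f. a < b \<Longrightarrow> b < d \<Longrightarrow> d < f \<Longrightarrow> f \<le> k \<Longrightarrow> pent b d f a b"
    and d: "dih4 a b d f" and k: "a \<le> k" "b \<le> k" "d \<le> k" "f \<le> k"
  shows "pent a b d f a"
proof -
  have q1: "pent a b d f a" "pent b d f a b" "pent d f a b d" "pent f a b d f"
     if "a \<le> b" "b \<le> d" "d \<le> f" "f \<le> k" for a b d f
  proof -
    have d: "dih4 a b d f" using that unfolding dih4_def cyc4_def by blast
    show 1: "pent a b d f a" "pent b d f a b"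
      using that quad1[of a b d f] quad2[of a b d f] pent_degenerate by (metis le_neq_implies_less)+
    show "pent d f a b d" "pent f a b d f"
      using quad_swap[OF d 1(1)] quad_swap[OF dih4_rotate[OF d] 1(2)] by blast+
  qed
    have c: "pent a b d f a" if "cyc4 a b d f" "a \<le> k" "b \<le> k" "d \<le> k" "f \<le> k" for a b d f
      using that q1(1)[of a b d f] q1(4)[of b d f a] q1(3)[of d f a b] q1(2)[of f a b d]
      unfolding cyc4_def by (elim disjE) simp_all
    from d show ?thesis unfolding dih4_def
    proof
      assume "cyc4 a b d f" then show ?thesis by (rule c) (rule k)+
    next
      assume "cyc4 f d b a"
      then have 1: "cyc4 a f d b" unfolding cyc4_def by (elim disjE) simp_all
      then have "dih4 a f d b" unfolding dih4_def ..
      from quad_reverse[OF this c[OF 1 k(1,4,3,2)]] show ?thesis .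
    qed
qed

text \<open>Repeated rotation by three places reduces the claim to increasing and decreasing points.
  Coinciding neighbours are degenerate, and equal first and last points lead to four points.\<close>

lemma pent_of_sorted:
  assumes quad1: "\<And>a b d f. a < b \<Longrightarrow> b < d \<Longrightarrow> d < f \<Longrightarrow> f \<le> k \<Longrightarrow> pent a b d f a"
    and quad2: "\<And>a b d f. a < b \<Longrightarrow> b < d \<Longrightarrow> d < f \<Longrightarrow> f \<le> k \<Longrightarrow> pent b d f a b"
    and pent1: "\<And>a b d f g. a < b \<Longrightarrow> b < d \<Longrightarrow> d < f \<Longrightarrow> f < g \<Longrightarrow> g \<le> k \<Longrightarrow> pent a b d f g"
    and pent2: "\<And>a b d f g. a < b \<Longrightarrow> b < d \<Longrightarrow> d < f \<Longrightarrow> f < g \<Longrightarrow> g \<le> k \<Longrightarrow> pent g f d b a"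
    and d: "dih5 a b d f g" and k: "a \<le> k" "b \<le> k" "d \<le> k" "f \<le> k" "g \<le> k"
  shows "pent a b d f g"
proof -
  have q: "pent a b d f a" if "dih4 a b d f" "a \<le> k" "b \<le> k" "d \<le> k" "f \<le> k" for a b d f
    by (rule quads_of_sorted[where k = k]) (fact quad1 quad2 that)+
  have rot: "pent f g a b d" if "dih5 a b d f g" "pent a b d f g" "a \<le> k" "b \<le> k" "d \<le> k" "f \<le> k" "g \<le> k" for a b d f g
    by (rule pent_rotate[OF that(1,2)]; rule q; (rule dih5_imp_dih4[OF that(1)])?; rule that)
  have all: "pent a b d f g \<and> pent b d f g a \<and> pent d f g a b \<and> pent f g a b d \<and> pent g a b d f"
    if d: "dih5 a b d f g" "pent a b d f g" and k: "a \<le> k" "b \<le> k" "d \<le> k" "f \<le> k" "g \<le> k" for a b d f g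
  proof -
    note r = dih5_rotate
    have d3: "dih5 f g a b d" by (rule r, rule r, rule r, rule d(1))
    have d6: "dih5 b d f g a" by (rule r, rule r, rule r, rule d3)
    have d9: "dih5 g a b d f" by (rule r, rule r, rule r, rule d6)
    note p3 = rot[OF d k]
    note p6 = rot[OF d3 p3 k(4,5,1,2,3)]
    note p9 = rot[OF d6 p6 k(2,3,4,5,1)]
    note p12 = rot[OF d9 p9 k(5,1,2,3,4)]
    show ?thesis using d(2) p3 p6 p9 p12 by blast
  qed
  show ?thesis
  proof (cases "a = b \<or> b = d \<or> d = f \<or> f = g \<or> g = a")
    case True
    then show ?thesis using pent_degenerate[of a b d f g] q[of a b d f] dih5_imp_dih4(1)[OF d] k by blast
  next
    case False
    have sorted: "pent a b d f g \<and> pent b d f g a \<and> pent d f g a b \<and> pent f g a b d \<and> pent g a b d f"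
      if "a < b" "b < d" "d < f" "f < g" "g \<le> k" for a b d f g
      by (rule all[OF _ pent1[OF that]]) (use that in \<open>simp_all add: dih5_def cyc5_def\<close>)
    have rsorted: "pent g f d b a \<and> pent f d b a g \<and> pent d b a g f \<and> pent b a g f d \<and> pent a g f d b"
      if "a < b" "b < d" "d < f" "f < g" "g \<le> k" for a b d f g
      by (rule all[OF _ pent2[OF that]]) (use that in \<open>simp_all add: dih5_def cyc5_def\<close>)
    have ne: "a \<noteq> b" "b \<noteq> d" "d \<noteq> f" "f \<noteq> g" "g \<noteq> a" using False by auto
    have weak: "pent a b d f g \<and> pent b d f g a \<and> pent d f g a b \<and> pent f g a b d \<and> pent g a b d f"
      if "a \<le> b \<and> b \<le> d \<and> d \<le> f \<and> f \<le> g" "a \<noteq> b" "b \<noteq> d" "d \<noteq> f" "f \<noteq> g" "g \<le> k" for a b d f g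
      by (rule sorted) (use that in auto)
    have rweak: "pent g f d b a \<and> pent f d b a g \<and> pent d b a g f \<and> pent b a g f d \<and> pent a g f d b"
      if "a \<le> b \<and> b \<le> d \<and> d \<le> f \<and> f \<le> g" "a \<noteq> b" "b \<noteq> d" "d \<noteq> f" "f \<noteq> g" "g \<le> k" for a b d f g
      by (rule rsorted) (use that in auto)
    have strict: "pent a b d f g" if c: "cyc5 a b d f g"
      using c weak[of a b d f g, OF _ ne(1-4) k(5)] weak[of b d f g a, OF _ ne(2-5) k(1)]
        weak[of d f g a b, OF _ ne(3-5) ne(1) k(2)] weak[of f g a b d, OF _ ne(4,5,1,2) k(3)]
        weak[of g a b d f, OF _ ne(5,1,2,3) k(4)]
      unfolding cyc5_def by argo
    note nes = ne[symmetric]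
    have rstrict: "pent a b d f g" if c: "cyc5 g f d b a"
      using c rweak[of g f d b a, OF _ nes(4,3,2,1) k(1)] rweak[of f d b a g, OF _ nes(3,2,1,5) k(5)]
        rweak[of d b a g f, OF _ nes(2,1,5,4) k(4)] rweak[of b a g f d, OF _ nes(1,5,4,3) k(3)]
        rweak[of a g f d b, OF _ nes(5,4,3,2) k(2)]
      unfolding cyc5_def by argo
    show ?thesis using d strict rstrict unfolding dih5_def by blast
  qed
qed

text \<open>The two hypotheses in \<open>p\<close> are the forms in which the relation arises from
  requirement (2); rotations lead to the sorted orders of relation (iii).\<close>

lemma pent_five_points:
  assumes quad1: "\<And>a b d f. a < b \<Longrightarrow> b < d \<Longrightarrow> d < f \<Longrightarrow> f \<le> 4 \<Longrightarrow> pent a b d f a"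
    and quad2: "\<And>a b d f. a < b \<Longrightarrow> b < d \<Longrightarrow> d < f \<Longrightarrow> f \<le> 4 \<Longrightarrow> pent b d f a b"
    and p: "pent 4 0 1 2 3" "pent 3 2 1 0 4"
  shows "pent 0 1 2 3 4" "pent 4 3 2 1 0"
proof -
  have q: "pent a b d f a" if "dih4 a b d f" "a \<le> 4" "b \<le> 4" "d \<le> 4" "f \<le> 4" for a b d f
    by (rule quads_of_sorted[where k = 4]) (fact quad1 quad2 that)+
  have rot: "pent f g a b d" if "dih5 a b d f g" "pent a b d f g" "a \<le> 4" "b \<le> 4" "d \<le> 4" "f \<le> 4" "g \<le> 4" for a b d f g
    by (rule pent_rotate[OF that(1,2)]; rule q; (rule dih5_imp_dih4[OF that(1)])?; rule that)
  have "pent 2 3 4 0 1" by (rule rot[OF _ p(1)]) (simp_all add: dih5_def cyc5_def)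
  from rot[OF _ this] show "pent 0 1 2 3 4" by (simp add: dih5_def cyc5_def)
  have "pent 0 4 3 2 1" by (rule rot[OF _ p(2)]) (simp_all add: dih5_def cyc5_def)
  from rot[OF _ this] have "pent 2 1 0 4 3" by (simp add: dih5_def cyc5_def)
  from rot[OF _ this] show "pent 4 3 2 1 0" by (simp add: dih5_def cyc5_def)
qed

end

context qring
begin

definition resolved :: "'a \<Rightarrow> 'a \<Rightarrow> 'a \<Rightarrow> 'a \<Rightarrow> 'a \<Rightarrow> 'a \<Rightarrow> 'a" where
  "resolved x y s t h w = - br x y + s * t + h * w"

text \<open>Extends \<open>C\<close> to all pairs of naturals by moving every point beyond \<open>k\<close> to \<open>k\<close>.\<close>

definition clamp :: "nat \<Rightarrow> 'a \<Rightarrow> (nat \<Rightarrow> nat \<Rightarrow> 'a) \<Rightarrow> nat \<Rightarrow> nat \<Rightarrow> 'a" where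
  "clamp k e C a b = (if min a k = min b k then e else C (min (min a b) k) (min (max a b) k))"

lemma clamp_simps:
  "a < b \<Longrightarrow> b \<le> k \<Longrightarrow> clamp k e C a b = C a b" "a < b \<Longrightarrow> b \<le> k \<Longrightarrow> clamp k e C b a = C a b"
  "clamp k e C a a = e"
  by (auto simp: clamp_def min_def max_def)

lemma clamp_sym: "clamp k e C a b = clamp k e C b a"
  by (simp add: clamp_def min.commute[of a b] max.commute[of a b] eq_commute)

lemma clamp_clamp: "clamp k e C (min a k) (min b k) = clamp k e C a b"
  by (auto simp: clamp_def min_def max_def)

text \<open>Clamping is monotone and so preserves the cyclic order. Chords that do not cross then
  become disjoint or nested intervals, or one of them becomes \<open>e\<close>.\<close>

lemma prechordal_clamp:
  assumes ee: "e * e = e"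
    and eC: "\<And>a b. a < b \<Longrightarrow> b \<le> k \<Longrightarrow> e * C a b = C a b"
    and Ce: "\<And>a b. a < b \<Longrightarrow> b \<le> k \<Longrightarrow> C a b * e = C a b"
    and disjoint: "\<And>a b d f. a < b \<Longrightarrow> b \<le> d \<Longrightarrow> d < f \<Longrightarrow> f \<le> k \<Longrightarrow> C a b * C d f = C d f * C a b"
    and nested: "\<And>a b d f. a \<le> d \<Longrightarrow> d < f \<Longrightarrow> f \<le> b \<Longrightarrow> b \<le> k \<Longrightarrow> C d f * C a b = C a b * C d f"
  shows "prechordal mu (clamp k e C) e"
proof -
  let ?c = "clamp k e C"
  show ?thesis
  proof
    fix a b d f
    show "?c a b = ?c b a" by (rule clamp_sym)
    show "?c a a = e" by (rule clamp_simps)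
    have form: "?c a b = e \<or> (\<exists>i j. i < j \<and> j \<le> k \<and> ?c a b = C i j)" for a b
    proof (cases "min a k = min b k")
      case False
      then have "min (min a b) k < min (max a b) k" by (auto simp: min_def max_def split: if_splits)
      then show ?thesis using False unfolding clamp_def by (metis min.cobounded2)
    qed (simp add: clamp_def)
    show e1: "e * ?c a b = ?c a b" for a b using form[of a b] eC ee by auto
    show e2: "?c a b * e = ?c a b" for a b using form[of a b] Ce ee by auto
    assume d: "dih4 a b d f"
    show "?c a b * ?c d f = ?c d f * ?c a b"
    proof (cases "min a k = min b k \<or> min d k = min f k")
      case True
      then have "?c a b = e \<or> ?c d f = e" by (auto simp: clamp_def)
      then show ?thesis using e1 e2 by auto
    next
      case False
      define a' b' d' f' where "a' = min (min a b) k" "b' = min (max a b) k" "d' = min (min d f) k" "f' = min (max d f) k"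
      note defs = this
      have 1: "?c a b = C a' b'" "?c d f = C d' f'" using False unfolding clamp_def defs by auto
      have 2: "a' < b'" "d' < f'" "b' \<le> k" "f' \<le> k" using False unfolding defs by (auto simp: min_def max_def split: if_splits)
      have 3: "a' = min (min a k) (min b k)" "b' = max (min a k) (min b k)"
        "d' = min (min d k) (min f k)" "f' = max (min d k) (min f k)"
        unfolding defs by (auto simp: min_def max_def)
      have "b' \<le> d' \<or> f' \<le> a' \<or> d' \<le> a' \<and> b' \<le> f' \<or> a' \<le> d' \<and> f' \<le> b'"
        using dih4_interval[OF dih4_min[OF d, of k]] False unfolding 3 by blast
      then show ?thesis unfolding 1 using 2 disjoint nested by metis
    qed
  qed
qed

lemma quads_clamp:
  assumes ee: "e * e = e"
    and eC: "\<And>a b. a < b \<Longrightarrow> b \<le> k \<Longrightarrow> e * C a b = C a b"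
    and Ce: "\<And>a b. a < b \<Longrightarrow> b \<le> k \<Longrightarrow> C a b * e = C a b"
    and disjoint: "\<And>a b d f. a < b \<Longrightarrow> b \<le> d \<Longrightarrow> d < f \<Longrightarrow> f \<le> k \<Longrightarrow> C a b * C d f = C d f * C a b"
    and nested: "\<And>a b d f. a \<le> d \<Longrightarrow> d < f \<Longrightarrow> f \<le> b \<Longrightarrow> b \<le> k \<Longrightarrow> C d f * C a b = C a b * C d f"
    and inc2: "\<And>a b d f. a < b \<Longrightarrow> b < d \<Longrightarrow> d < f \<Longrightarrow> f \<le> k \<Longrightarrow>
      C a d = - br (C b f) (resolved (C a d) (C b f) (C a b) (C d f) (C b d) (C a f)) + C a b * C b d + C d f * C a f"
    and dec2: "\<And>a b d f. a < b \<Longrightarrow> b < d \<Longrightarrow> d < f \<Longrightarrow> f \<le> k \<Longrightarrow>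
      C b f = - br (C a d) (resolved (C b f) (C a d) (C d f) (C a b) (C b d) (C a f)) + C d f * C b d + C a b * C a f"
    and o: "a < b" "b < d" "d < f" "f \<le> k"
  shows "prechordal.pent mu (clamp k e C) a b d f a" "prechordal.pent mu (clamp k e C) b d f a b"
proof -
  let ?c = "clamp k e C"
  interpret P: prechordal mu ?c e
    by (rule prechordal_clamp) (fact ee eC Ce disjoint nested)+
  have cp: "P.cpair a b d f = resolved (?c a d) (?c b f) (?c a b) (?c d f) (?c b d) (?c a f)" for a b d f
    by (simp add: P.cpair_def resolved_def)
  have d: "dih4 a b d f" "dih4 f d b a" using o unfolding dih4_def cyc4_def by auto
  have comm: "C b d * C d f = C d f * C b d" by (rule disjoint) (use o in auto)
  show "P.pent a b d f a"
    using dec2[OF o] comm o unfolding P.cpair_iff[OF d(1), symmetric] cp by (simp add: clamp_simps)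
  have comm: "C b d * C a b = C a b * C b d" by (rule disjoint[symmetric]) (use o in auto)
  have "P.pent f d b a f"
    using inc2[OF o] comm o unfolding P.cpair_iff[OF d(2), symmetric] cp by (simp add: clamp_simps)
  from P.quad_reverse[OF d(2) this] have "P.pent f a b d f" .
  moreover have "dih4 f a b d" using d(1) dih4_rotate by blast
  ultimately show "P.pent b d f a b" using P.quad_swap by blast
qed

text \<open>The numerals 2 and 3 refer to relations (ii) and (iii), the prefixes to increasing and
  decreasing monotonic sequences. Those sorted instances suffice for all points on the
  circle.\<close>

lemma chordal_clamp:
  assumes ee: "e * e = e"
    and eC: "\<And>a b. a < b \<Longrightarrow> b \<le> k \<Longrightarrow> e * C a b = C a b"
    and Ce: "\<And>a b. a < b \<Longrightarrow> b \<le> k \<Longrightarrow> C a b * e = C a b"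
    and disjoint: "\<And>a b d f. a < b \<Longrightarrow> b \<le> d \<Longrightarrow> d < f \<Longrightarrow> f \<le> k \<Longrightarrow> C a b * C d f = C d f * C a b"
    and nested: "\<And>a b d f. a \<le> d \<Longrightarrow> d < f \<Longrightarrow> f \<le> b \<Longrightarrow> b \<le> k \<Longrightarrow> C d f * C a b = C a b * C d f"
    and inc2: "\<And>a b d f. a < b \<Longrightarrow> b < d \<Longrightarrow> d < f \<Longrightarrow> f \<le> k \<Longrightarrow>
      C a d = - br (C b f) (resolved (C a d) (C b f) (C a b) (C d f) (C b d) (C a f)) + C a b * C b d + C d f * C a f"
    and dec2: "\<And>a b d f. a < b \<Longrightarrow> b < d \<Longrightarrow> d < f \<Longrightarrow> f \<le> k \<Longrightarrow>
      C b f = - br (C a d) (resolved (C b f) (C a d) (C d f) (C a b) (C b d) (C a f)) + C d f * C b d + C a b * C a f"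
    and inc3: "\<And>a b d f g. a < b \<Longrightarrow> b < d \<Longrightarrow> d < f \<Longrightarrow> f < g \<Longrightarrow> g \<le> k \<Longrightarrow>
      resolved (C a f) (C b g) (C a b) (C f g) (C b f) (C a g) =
        - br (resolved (C a d) (C b f) (C a b) (C d f) (C b d) (C a f)) (C d g) + C a b * C f g
        + C d f * resolved (C a d) (C b g) (C a b) (C d g) (C b d) (C a g)"
    and dec3: "\<And>a b d f g. a < b \<Longrightarrow> b < d \<Longrightarrow> d < f \<Longrightarrow> f < g \<Longrightarrow> g \<le> k \<Longrightarrow>
      resolved (C b g) (C a f) (C f g) (C a b) (C b f) (C a g) =
        - br (resolved (C d g) (C b f) (C f g) (C b d) (C d f) (C b g)) (C a d) + C f g * C a b
        + C b d * resolved (C d g) (C a f) (C f g) (C a d) (C d f) (C a g)"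
  shows "chordal mu (clamp k e C) e"
proof -
  let ?c = "clamp k e C"
  interpret P: prechordal mu ?c e
    by (rule prechordal_clamp) (fact ee eC Ce disjoint nested)+
  have cp: "P.cpair a b d f = resolved (?c a d) (?c b f) (?c a b) (?c d f) (?c b d) (?c a f)" for a b d f
    by (simp add: P.cpair_def resolved_def)
  show ?thesis
  proof
    fix a b d f g assume d: "dih5 a b d f g"
    have "P.pent (min a k) (min b k) (min d k) (min f k) (min g k)"
    proof (rule P.pent_of_sorted[OF _ _ _ _ dih5_min[OF d]])
      fix a b d f assume "a < b" "b < d" "d < f" "f \<le> k"
      note q = quads_clamp[of e k C, OF ee eC Ce disjoint nested inc2 dec2 this]
      show "P.pent a b d f a" "P.pent b d f a b" by (rule q; assumption)+
    next
      fix a b d f g assume o: "a < b" "b < d" "d < f" "f < g" "g \<le> k"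
      then have d: "dih5 a b d f g" "dih5 g f d b a" unfolding dih5_def cyc5_def by auto
      show "P.pent a b d f g"
        using inc3[OF o] o unfolding P.cpair5_iff[OF d(1), symmetric] cp by (simp add: clamp_simps)
      show "P.pent g f d b a"
        using dec3[OF o] o unfolding P.cpair5_iff[OF d(2), symmetric] cp by (simp add: clamp_simps)
    qed simp_all
    then show "P.pent a b d f g" unfolding P.pent_def clamp_clamp .
  qed
qed

end

context chordal
begin

lemma relations_of_chordal:
  shows "a \<le> b \<Longrightarrow> b \<le> d \<Longrightarrow> d \<le> f \<Longrightarrow>
      c a d = - br (c b f) (resolved (c a d) (c b f) (c a b) (c d f) (c b d) (c a f)) + c a b * c b d + c d f * c a f" (is "_ \<Longrightarrow> _ \<Longrightarrow> _ \<Longrightarrow> ?p1")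
    and "a \<le> b \<Longrightarrow> b \<le> d \<Longrightarrow> d \<le> f \<Longrightarrow>
      c b f = - br (c a d) (resolved (c b f) (c a d) (c d f) (c a b) (c b d) (c a f)) + c d f * c b d + c a b * c a f" (is "_ \<Longrightarrow> _ \<Longrightarrow> _ \<Longrightarrow> ?p2")
    and "a \<le> b \<Longrightarrow> b \<le> d \<Longrightarrow> d \<le> f \<Longrightarrow> f \<le> g \<Longrightarrow>
      resolved (c a f) (c b g) (c a b) (c f g) (c b f) (c a g) =
        - br (resolved (c a d) (c b f) (c a b) (c d f) (c b d) (c a f)) (c d g) + c a b * c f g
        + c d f * resolved (c a d) (c b g) (c a b) (c d g) (c b d) (c a g)" (is "_ \<Longrightarrow> _ \<Longrightarrow> _ \<Longrightarrow> _ \<Longrightarrow> ?p3")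
    and "a \<le> b \<Longrightarrow> b \<le> d \<Longrightarrow> d \<le> f \<Longrightarrow> f \<le> g \<Longrightarrow>
      resolved (c b g) (c a f) (c f g) (c a b) (c b f) (c a g) =
        - br (resolved (c d g) (c b f) (c f g) (c b d) (c d f) (c b g)) (c a d) + c f g * c a b
        + c b d * resolved (c d g) (c a f) (c f g) (c a d) (c d f) (c a g)" (is "_ \<Longrightarrow> _ \<Longrightarrow> _ \<Longrightarrow> _ \<Longrightarrow> ?p4")
proof -
  have cp: "cpair a b d f = resolved (c a d) (c b f) (c a b) (c d f) (c b d) (c a f)" for a b d f
    by (simp add: cpair_def resolved_def)
  have s: "c d a = c a d" "c d b = c b d" "c f b = c b f" "c f d = c d f" "c b a = c a b" "c f a = c a f"
    "c g a = c a g" "c g b = c b g" "c g d = c d g" "c g f = c f g"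
    by (simp_all add: sym)
  have comm: "c d f * c b d = c b d * c d f" "c b d * c a b = c a b * c b d" by (rule commute_share)+
  {
    assume o: "a \<le> b" "b \<le> d" "d \<le> f"
    then have d: "dih4 a b d f" "dih4 f d b a" unfolding dih4_def cyc4_def by auto
    note p = d[THEN dih4_imp_dih5, THEN pent]
    show ?p1 using p(2) unfolding cpair_iff[OF d(2), symmetric] cp by (simp only: s comm)
    show ?p2 using p(1) unfolding cpair_iff[OF d(1), symmetric] cp by (simp only: s comm)
  next
    assume o: "a \<le> b" "b \<le> d" "d \<le> f" "f \<le> g"
    then have d: "dih5 a b d f g" "dih5 g f d b a" unfolding dih5_def cyc5_def by auto
    note p = d[THEN pent]
    show ?p3 using p(1) unfolding cpair5_iff[OF d(1), symmetric] cp by (simp only: s)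
    show ?p4 using p(2) unfolding cpair5_iff[OF d(2), symmetric] cp by (simp only: s)
  }
qed

end

section \<open>The relators of \<open>aw(n)\<close>\<close>

definition ival :: "nat \<Rightarrow> nat \<Rightarrow> nat set" where "ival a b = {Suc a..b}"

lemma ival_mem: "i \<in> ival a b \<longleftrightarrow> a < i \<and> i \<le> b"
  by (auto simp: ival_def)

lemma ival_end: "a < b \<Longrightarrow> Suc a \<in> ival a b" "a < b \<Longrightarrow> b \<in> ival a b"
  by (simp_all add: ival_mem)

lemma ival_union: "a \<le> b \<Longrightarrow> b \<le> d \<Longrightarrow> ival a b \<union> ival b d = ival a d"
  "a \<le> b \<Longrightarrow> b \<le> d \<Longrightarrow> ival b d \<union> ival a b = ival a d"
  by (auto simp: ival_mem set_eq_iff)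

lemma conn_iff: "I \<in> conn n \<longleftrightarrow> (\<exists>a b. a < b \<and> b \<le> n \<and> I = ival a b)"
proof
  assume "I \<in> conn n"
  then obtain j k where jk: "j \<le> k" "I = {j..k}" "I \<subseteq> {1..n}" by (auto simp: conn_def consecutive_def)
  then have "j \<in> {1..n}" "k \<in> {1..n}" by auto
  with jk show "\<exists>a b. a < b \<and> b \<le> n \<and> I = ival a b"
    by (intro exI[of _ "j - 1"] exI[of _ k]) (auto simp: ival_def)
next
  assume "\<exists>a b. a < b \<and> b \<le> n \<and> I = ival a b"
  then show "I \<in> conn n" by (auto simp: conn_def consecutive_def ival_def intro: Suc_leI)
qed

lemma ival_conn: "a < b \<Longrightarrow> b \<le> n \<Longrightarrow> ival a b \<in> conn n"
  unfolding conn_iff by blast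

lemma set_less_ival:
  assumes "a < b" "d < f"
  shows "set_less (ival a b) (ival d f) \<longleftrightarrow> b \<le> d"
proof
  assume "set_less (ival a b) (ival d f)"
  then have "b < Suc d" unfolding set_less_def using ival_end assms by blast
  then show "b \<le> d" by simp
qed (auto simp: set_less_def ival_mem)

lemma disjoint_ival: assumes "a < b" "d < f"
  shows "ival a b \<inter> ival d f = {} \<longleftrightarrow> b \<le> d \<or> f \<le> a"
  using assms unfolding ival_def by (auto simp: Int_atLeastAtMost)

lemma subset_ival: assumes "a < b" shows "ival a b \<subseteq> ival d f \<longleftrightarrow> d \<le> a \<and> b \<le> f"
  using assms unfolding ival_def by auto

lemma adjacent_ival: assumes "a < b" "d < f"
  shows "adjacent (ival a b) (ival d f) \<longleftrightarrow> b = d \<or> f = a"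
proof
  assume "b = d \<or> f = a"
  then show "adjacent (ival a b) (ival d f)"
  proof
    assume "b = d"
    then have "ival a b \<union> ival d f = {Suc a..f}" using assms by (auto simp: ival_mem)
    then show ?thesis unfolding adjacent_def consecutive_def disjoint_ival[OF assms]
      using \<open>b = d\<close> assms by (intro conjI exI[of _ "Suc a"] exI[of _ f]) auto
  next
    assume "f = a"
    then have "ival a b \<union> ival d f = {Suc d..b}" using assms by (auto simp: ival_mem)
    then show ?thesis unfolding adjacent_def consecutive_def disjoint_ival[OF assms]
      using \<open>f = a\<close> assms by (intro conjI exI[of _ "Suc d"] exI[of _ b]) auto
  qed
next
  assume "adjacent (ival a b) (ival d f)"
  then obtain j k where 1: "b \<le> d \<or> f \<le> a" and 2: "ival a b \<union> ival d f = {j..k}"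
    unfolding adjacent_def consecutive_def disjoint_ival[OF assms] by auto
  have mem: "Suc a \<in> {j..k}" "b \<in> {j..k}" "Suc d \<in> {j..k}" "f \<in> {j..k}"
    unfolding 2[symmetric] using assms by (auto simp: ival_mem)
  show "b = d \<or> f = a"
  proof (rule ccontr)
    assume "\<not> (b = d \<or> f = a)"
    with 1 consider "b < d" | "f < a" by linarith
    then show False
    proof cases
      case 1
      then have "Suc b \<in> ival a b \<union> ival d f" unfolding 2 using mem assms by auto
      then show False using 1 by (auto simp: ival_mem)
    next
      case 2
      then have "Suc f \<in> ival a b \<union> ival d f" unfolding \<open>_ = {j..k}\<close> using mem assms by auto
      then show False using 2 by (auto simp: ival_mem)
    qed
  qed
qed

lemma hole_ival: assumes "a < b" "b < d" "d < f"
  shows "hole (ival a b) (ival d f) = ival b d" "hole (ival d f) (ival a b) = ival b d"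
proof -
  have "(\<forall>i\<in>ival a b. \<forall>j\<in>ival d f. i < h \<and> h < j) \<longleftrightarrow> b < h \<and> h \<le> d" for h
  proof
    assume "\<forall>i\<in>ival a b. \<forall>j\<in>ival d f. i < h \<and> h < j"
    then have "b < h \<and> h < Suc d" using ival_end assms by blast
    then show "b < h \<and> h \<le> d" by simp
  qed (auto simp: ival_mem)
  moreover have "\<not> (\<forall>i\<in>ival a b. \<forall>j\<in>ival d f. j < h \<and> h < i)" for h
  proof
    assume "\<forall>i\<in>ival a b. \<forall>j\<in>ival d f. j < h \<and> h < i"
    then have "f < h \<and> h < b" using ival_end assms by blast
    then show False using assms by simp
  qed
  ultimately show 1: "hole (ival a b) (ival d f) = ival b d"
    unfolding hole_def by (auto simp: ival_mem)
  have "hole I J = hole J I" for I J unfolding hole_def by blast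
  then show "hole (ival d f) (ival a b) = ival b d" using 1 by simp
qed

text \<open>The expansion of \<open>C\<^bsub>IJ\<^esub>\<close> across a hole; the shape shared by all relations.\<close>

definition rX :: "(Cq, 'a) module \<Rightarrow> 'a \<Rightarrow> 'a \<Rightarrow> 'a \<Rightarrow> 'a \<Rightarrow> 'a \<Rightarrow> 'a \<Rightarrow> 'a" where
  "rX A x y s t h w = (\<ominus>\<^bsub>A\<^esub> qcomm A x y) \<oplus>\<^bsub>A\<^esub> (s \<otimes>\<^bsub>A\<^esub> t) \<oplus>\<^bsub>A\<^esub> (h \<otimes>\<^bsub>A\<^esub> w)"

lemma C_pair_adjacent:
  assumes "a < b" "b < d"
  shows "C_pair A C (ival a b) (ival b d) = C (ival a d)" "C_pair A C (ival b d) (ival a b) = C (ival a d)"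
  using assms by (simp_all add: C_pair_def adjacent_ival ival_union)

lemma C_pair_hole:
  assumes "a < b" "b < d" "d < f"
  shows "C_pair A C (ival a b) (ival d f) = rX A (C (ival a d)) (C (ival b f)) (C (ival a b)) (C (ival d f)) (C (ival b d)) (C (ival a f))"
    "C_pair A C (ival d f) (ival a b) = rX A (C (ival b f)) (C (ival a d)) (C (ival d f)) (C (ival a b)) (C (ival b d)) (C (ival a f))"
  using assms by (simp_all add: C_pair_def adjacent_ival hole_ival ival_union rX_def)

lemma monotonic_adjacent3:
  "monotonic_adjacent n [I1, I2, I3] \<longleftrightarrow> (\<exists>a b d f. a < b \<and> b < d \<and> d < f \<and> f \<le> n \<and>
     (I1 = ival a b \<and> I2 = ival b d \<and> I3 = ival d f \<or> I1 = ival d f \<and> I2 = ival b d \<and> I3 = ival a b))" (is "?l \<longleftrightarrow> ?r")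
proof
  assume ?l
  then have c: "I1 \<in> conn n" "I2 \<in> conn n" "I3 \<in> conn n" and m: "monotonic [I1, I2, I3]"
    and adj: "adjacent I1 I2" "adjacent I2 I3"
    unfolding monotonic_adjacent_def by (auto dest: spec[of _ 0] spec[of _ "Suc 0"])
  obtain a b d f g h where 1: "I1 = ival a b" "a < b" "b \<le> n" "I2 = ival d f" "d < f" "f \<le> n" "I3 = ival g h" "g < h" "h \<le> n"
    using c unfolding conn_iff by blast
  from m have "b \<le> d \<and> f \<le> g \<or> f \<le> a \<and> h \<le> d"
    unfolding monotonic_def 1 by (auto simp: set_less_ival 1)
  then show ?r
  proof
    assume "b \<le> d \<and> f \<le> g"
    then have "b = d" "f = g" using adj 1 by (auto simp: adjacent_ival)
    then show ?r using 1 by blast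
  next
    assume "f \<le> a \<and> h \<le> d"
    then have "f = a" "h = d" using adj 1 by (auto simp: adjacent_ival)
    then show ?r using 1 by blast
  qed
next
  assume ?r
  then show ?l
    unfolding monotonic_adjacent_def monotonic_def
    by (auto simp: set_less_ival adjacent_ival ival_conn less_Suc_eq)
qed

lemma monotonic_adjacent4:
  "monotonic_adjacent n [I1, I2, I3, I4] \<longleftrightarrow> (\<exists>a b d f g. a < b \<and> b < d \<and> d < f \<and> f < g \<and> g \<le> n \<and>
     (I1 = ival a b \<and> I2 = ival b d \<and> I3 = ival d f \<and> I4 = ival f g
      \<or> I1 = ival f g \<and> I2 = ival d f \<and> I3 = ival b d \<and> I4 = ival a b))" (is "?l \<longleftrightarrow> ?r")
proof
  assume ?l
  then have l: "monotonic_adjacent n [I1, I2, I3]" "I4 \<in> conn n" "monotonic [I1, I2, I3, I4]" "adjacent I3 I4"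
    unfolding monotonic_adjacent_def monotonic_def by (auto simp: less_Suc_eq)
  obtain g h where 1: "I4 = ival g h" "g < h" "h \<le> n" using l(2) unfolding conn_iff by blast
  from l(1) obtain a b d f where 2: "a < b" "b < d" "d < f" "f \<le> n"
    "I1 = ival a b \<and> I2 = ival b d \<and> I3 = ival d f \<or> I1 = ival d f \<and> I2 = ival b d \<and> I3 = ival a b"
    unfolding monotonic_adjacent3 by blast
  from 2(5) show ?r
  proof
    assume i: "I1 = ival a b \<and> I2 = ival b d \<and> I3 = ival d f"
    then have "f \<le> g" using l(3) 1 2(1-4) unfolding monotonic_def by (auto simp: set_less_ival)
    then have "f = g" using l(4) i 1 2(1-4) by (auto simp: adjacent_ival)
    then show ?r using i 1 2(1-4) by blast
  next
    assume i: "I1 = ival d f \<and> I2 = ival b d \<and> I3 = ival a b"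
    then have "h \<le> a" using l(3) 1 2(1-4) unfolding monotonic_def by (auto simp: set_less_ival)
    then have "h = a" using l(4) i 1 2(1-4) by (auto simp: adjacent_ival)
    then show ?r using i 1 2(1-4) by blast
  qed
next
  assume ?r
  then show ?l
    unfolding monotonic_adjacent_def monotonic_def
    by (auto simp: set_less_ival adjacent_ival ival_conn less_Suc_eq)
qed

text \<open>Relations (i) to (iii) of aw(n) in terms of cut points, with each relation (ii) and
  (iii) in both directions. The family is arbitrary, so images of generators, for instance twisted
  chords, can be tested.\<close>

definition chord_family :: "nat \<Rightarrow> (Cq, 'a) module \<Rightarrow> (nat \<Rightarrow> nat \<Rightarrow> 'a) \<Rightarrow> bool" where
  "chord_family n A c \<longleftrightarrow>
     (\<forall>a b. a < b \<and> b \<le> n \<longrightarrow> c a b \<in> carrier A) \<and>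
     (\<forall>a b d f. a < b \<and> b \<le> n \<and> d < f \<and> f \<le> n \<and> (b \<le> d \<or> f \<le> a \<or> d \<le> a \<and> b \<le> f) \<longrightarrow>
        c a b \<otimes>\<^bsub>A\<^esub> c d f = c d f \<otimes>\<^bsub>A\<^esub> c a b) \<and>
     (\<forall>a b d f. a < b \<and> b < d \<and> d < f \<and> f \<le> n \<longrightarrow>
        c a d = rX A (c b f) (rX A (c a d) (c b f) (c a b) (c d f) (c b d) (c a f)) (c a b) (c b d) (c d f) (c a f) \<and>
        c b f = rX A (c a d) (rX A (c b f) (c a d) (c d f) (c a b) (c b d) (c a f)) (c d f) (c b d) (c a b) (c a f)) \<and>
     (\<forall>a b d f g. a < b \<and> b < d \<and> d < f \<and> f < g \<and> g \<le> n \<longrightarrow>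
        rX A (c a f) (c b g) (c a b) (c f g) (c b f) (c a g) =
          rX A (rX A (c a d) (c b f) (c a b) (c d f) (c b d) (c a f)) (c d g) (c a b) (c f g)
            (c d f) (rX A (c a d) (c b g) (c a b) (c d g) (c b d) (c a g)) \<and>
        rX A (c b g) (c a f) (c f g) (c a b) (c b f) (c a g) =
          rX A (rX A (c d g) (c b f) (c f g) (c b d) (c d f) (c b g)) (c a d) (c f g) (c a b)
            (c b d) (rX A (c d g) (c a f) (c f g) (c a d) (c d f) (c a g)))"

lemma (in assoc_alg) rX_carrier [simp, intro]:
  "x \<in> carrier A \<Longrightarrow> y \<in> carrier A \<Longrightarrow> s \<in> carrier A \<Longrightarrow> t \<in> carrier A \<Longrightarrow> h \<in> carrier A \<Longrightarrow> w \<in> carrier A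
    \<Longrightarrow> rX A x y s t h w \<in> carrier A"
  by (simp add: rX_def)

context alg_morphism
begin

lemma hom_rX: "x \<in> carrier A \<Longrightarrow> y \<in> carrier A \<Longrightarrow> s \<in> carrier A \<Longrightarrow> t \<in> carrier A \<Longrightarrow> h \<in> carrier A \<Longrightarrow> w \<in> carrier A
    \<Longrightarrow> f (rX A x y s t h w) = rX B (f x) (f y) (f s) (f t) (f h) (f w)"
  by (simp add: rX_def hom_simps hom_uminus hom_qcomm)

lemma hom_minus_eq_zero: "x \<in> carrier A \<Longrightarrow> y \<in> carrier A \<Longrightarrow> f (x \<ominus>\<^bsub>A\<^esub> y) = \<zero>\<^bsub>B\<^esub> \<longleftrightarrow> f x = f y"
  using B.r_right_minus_eq[of "f x" "f y"] by (simp add: hom_minus hom_simps)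

end

lemma ball_image3: "(\<forall>r\<in>{E x y z | x y z. P x y z}. Q r) \<longleftrightarrow> (\<forall>x y z. P x y z \<longrightarrow> Q (E x y z))" by blast
lemma ball_image4: "(\<forall>r\<in>{E x y z w | x y z w. P x y z w}. Q r) \<longleftrightarrow> (\<forall>x y z w. P x y z w \<longrightarrow> Q (E x y z w))" by blast
lemma ball_image2: "(\<forall>r\<in>{E x y | x y. P x y}. Q r) \<longleftrightarrow> (\<forall>x y. P x y \<longrightarrow> Q (E x y))" by blast

lemma ball_mono3: "(\<forall>I1 I2 I3. monotonic_adjacent n [I1, I2, I3] \<longrightarrow> Q I1 I2 I3) \<longleftrightarrow>
   (\<forall>a b d f. a < b \<and> b < d \<and> d < f \<and> f \<le> n \<longrightarrow> Q (ival a b) (ival b d) (ival d f) \<and> Q (ival d f) (ival b d) (ival a b))"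
  unfolding monotonic_adjacent3 by blast

lemma ball_mono4: "(\<forall>I1 I2 I3 I4. monotonic_adjacent n [I1, I2, I3, I4] \<longrightarrow> Q I1 I2 I3 I4) \<longleftrightarrow>
   (\<forall>a b d f g. a < b \<and> b < d \<and> d < f \<and> f < g \<and> g \<le> n \<longrightarrow> Q (ival a b) (ival b d) (ival d f) (ival f g)
      \<and> Q (ival f g) (ival d f) (ival b d) (ival a b))"
  unfolding monotonic_adjacent4 by blast

text \<open>Monotonic sequences of adjacent intervals are sequences of cut points, read upwards or
  downwards. This equivalence is the passage between the presentation by sets and the chord
  relations.\<close>

lemma relators_vanish_iff:
  assumes B: "assoc_algebra B" and f: "h \<in> alg_hom (free_algebra (conn n)) B"
  shows "(\<forall>r\<in>aw_relators n. h r = \<zero>\<^bsub>B\<^esub>) \<longleftrightarrow> chord_family n B (\<lambda>a b. h (free_gen (ival a b)))"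
proof -
  let ?F = "free_algebra (conn n)"
  interpret f: alg_morphism ?F B h using assoc_algebra_free B f by unfold_locales
  define g :: "nat \<Rightarrow> nat \<Rightarrow> nat set ncpoly" where "g a b = free_gen (ival a b)" for a b
  have g: "g a b \<in> carrier ?F" if "a < b" "b \<le> n" for a b
    unfolding g_def using that by (intro free_gen_carrier ival_conn)
  have hg: "h (g a b) \<in> carrier B" if "a < b" "b \<le> n" for a b
    using g[OF that] f.hom_simps by blast
  have 1: "(\<forall>I J. I \<in> conn n \<and> J \<in> conn n \<and> (I \<inter> J = {} \<or> I \<subseteq> J) \<longrightarrow> h (comm ?F (free_gen I) (free_gen J)) = \<zero>\<^bsub>B\<^esub>)
    \<longleftrightarrow> (\<forall>a b d f. a < b \<and> b \<le> n \<and> d < f \<and> f \<le> n \<and> (b \<le> d \<or> f \<le> a \<or> d \<le> a \<and> b \<le> f) \<longrightarrow>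
        h (g a b) \<otimes>\<^bsub>B\<^esub> h (g d f) = h (g d f) \<otimes>\<^bsub>B\<^esub> h (g a b))" (is "?l \<longleftrightarrow> ?r")
  proof -
    have "?l \<longleftrightarrow> (\<forall>a b d f. a < b \<and> b \<le> n \<and> d < f \<and> f \<le> n \<and> (ival a b \<inter> ival d f = {} \<or> ival a b \<subseteq> ival d f)
      \<longrightarrow> h (comm ?F (g a b) (g d f)) = \<zero>\<^bsub>B\<^esub>)"
      unfolding conn_iff g_def by blast
    also have "\<dots> \<longleftrightarrow> ?r"
    proof (intro iff_allI)
      fix a b d f
      have e: "(a < b \<and> b \<le> n \<and> d < f \<and> f \<le> n \<and> (ival a b \<inter> ival d f = {} \<or> ival a b \<subseteq> ival d f))
        \<longleftrightarrow> (a < b \<and> b \<le> n \<and> d < f \<and> f \<le> n \<and> (b \<le> d \<or> f \<le> a \<or> d \<le> a \<and> b \<le> f))"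
        by (cases "a < b"; cases "d < f"; simp add: disjoint_ival subset_ival)
      have "h (comm ?F (g a b) (g d f)) = \<zero>\<^bsub>B\<^esub> \<longleftrightarrow> h (g a b) \<otimes>\<^bsub>B\<^esub> h (g d f) = h (g d f) \<otimes>\<^bsub>B\<^esub> h (g a b)"
        if "a < b" "b \<le> n" "d < f" "f \<le> n"
        using that by (simp add: f.hom_comm g hg f.B.comm_zero_iff)
      then show "(a < b \<and> b \<le> n \<and> d < f \<and> f \<le> n \<and> (ival a b \<inter> ival d f = {} \<or> ival a b \<subseteq> ival d f) \<longrightarrow> h (comm ?F (g a b) (g d f)) = \<zero>\<^bsub>B\<^esub>)
        \<longleftrightarrow> (a < b \<and> b \<le> n \<and> d < f \<and> f \<le> n \<and> (b \<le> d \<or> f \<le> a \<or> d \<le> a \<and> b \<le> f) \<longrightarrow> h (g a b) \<otimes>\<^bsub>B\<^esub> h (g d f) = h (g d f) \<otimes>\<^bsub>B\<^esub> h (g a b))"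
        unfolding e by blast
    qed
    finally show ?thesis .
  qed
  have carr: "(\<forall>a b. a < b \<and> b \<le> n \<longrightarrow> h (g a b) \<in> carrier B) \<longleftrightarrow> True" using hg by blast
  note simps = C_pair_adjacent C_pair_hole ival_union g_def[symmetric] rX_def[symmetric]
  show ?thesis
    unfolding aw_relators_def Let_def ball_Un ball_image2 ball_image3 ball_image4 ball_mono3 ball_mono4 1 chord_family_def
      g_def[symmetric] carr simp_thms conj_assoc
  proof (intro conj_cong refl iff_allI imp_cong)
    fix a b d f assume "a < b \<and> b < d \<and> d < f \<and> f \<le> n"
    then have o: "a < b" "b < d" "d < f" "f \<le> n" "a < d" "a < f" "b < f" "b \<le> n" "d \<le> n" "a \<le> b" "b \<le> d" "d \<le> f" "a \<le> d" by auto
    note o' = o(1-3,5-7)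
    show "h (C_pair ?F free_gen (ival a b) (ival b d) \<ominus>\<^bsub>?F\<^esub> (\<ominus>\<^bsub>?F\<^esub> qcomm ?F (C_pair ?F free_gen (ival b d) (ival d f)) (C_pair ?F free_gen (ival a b) (ival d f))
        \<oplus>\<^bsub>?F\<^esub> g a b \<otimes>\<^bsub>?F\<^esub> g b d \<oplus>\<^bsub>?F\<^esub> g d f \<otimes>\<^bsub>?F\<^esub> free_gen (ival a b \<union> ival b d \<union> ival d f))) = \<zero>\<^bsub>B\<^esub> \<longleftrightarrow>
       h (g a d) = rX B (h (g b f)) (rX B (h (g a d)) (h (g b f)) (h (g a b)) (h (g d f)) (h (g b d)) (h (g a f))) (h (g a b)) (h (g b d)) (h (g d f)) (h (g a f))"
      using o by (simp add: simps f.hom_minus_eq_zero f.hom_rX g)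
    show "h (C_pair ?F free_gen (ival d f) (ival b d) \<ominus>\<^bsub>?F\<^esub> (\<ominus>\<^bsub>?F\<^esub> qcomm ?F (C_pair ?F free_gen (ival b d) (ival a b)) (C_pair ?F free_gen (ival d f) (ival a b))
        \<oplus>\<^bsub>?F\<^esub> g d f \<otimes>\<^bsub>?F\<^esub> g b d \<oplus>\<^bsub>?F\<^esub> g a b \<otimes>\<^bsub>?F\<^esub> free_gen (ival d f \<union> ival b d \<union> ival a b))) = \<zero>\<^bsub>B\<^esub> \<longleftrightarrow>
       h (g b f) = rX B (h (g a d)) (rX B (h (g b f)) (h (g a d)) (h (g d f)) (h (g a b)) (h (g b d)) (h (g a f))) (h (g d f)) (h (g b d)) (h (g a b)) (h (g a f))"
      using o by (simp add: simps f.hom_minus_eq_zero f.hom_rX g)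
  next
    fix a b d f k assume "a < b \<and> b < d \<and> d < f \<and> f < k \<and> k \<le> n"
    then have o: "a < b" "b < d" "d < f" "f < k" "k \<le> n" "a < d" "a < f" "a < k" "b < f" "b < k" "d < k" "b \<le> n" "d \<le> n" "f \<le> n"
       "a \<le> b" "b \<le> d" "d \<le> f" "f \<le> k" by auto
    show "h (C_pair ?F free_gen (ival a b) (ival f k) \<ominus>\<^bsub>?F\<^esub> (\<ominus>\<^bsub>?F\<^esub> qcomm ?F (C_pair ?F free_gen (ival a b) (ival d f)) (C_pair ?F free_gen (ival d f) (ival f k))
        \<oplus>\<^bsub>?F\<^esub> g a b \<otimes>\<^bsub>?F\<^esub> g f k \<oplus>\<^bsub>?F\<^esub> g d f \<otimes>\<^bsub>?F\<^esub> C_pair ?F free_gen (ival a b) (ival d f \<union> ival f k))) = \<zero>\<^bsub>B\<^esub> \<longleftrightarrow>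
      rX B (h (g a f)) (h (g b k)) (h (g a b)) (h (g f k)) (h (g b f)) (h (g a k)) =
          rX B (rX B (h (g a d)) (h (g b f)) (h (g a b)) (h (g d f)) (h (g b d)) (h (g a f))) (h (g d k)) (h (g a b)) (h (g f k))
            (h (g d f)) (rX B (h (g a d)) (h (g b k)) (h (g a b)) (h (g d k)) (h (g b d)) (h (g a k)))"
      using o by (simp add: simps f.hom_minus_eq_zero f.hom_rX g)
    show "h (C_pair ?F free_gen (ival f k) (ival a b) \<ominus>\<^bsub>?F\<^esub> (\<ominus>\<^bsub>?F\<^esub> qcomm ?F (C_pair ?F free_gen (ival f k) (ival b d)) (C_pair ?F free_gen (ival b d) (ival a b))
        \<oplus>\<^bsub>?F\<^esub> g f k \<otimes>\<^bsub>?F\<^esub> g a b \<oplus>\<^bsub>?F\<^esub> g b d \<otimes>\<^bsub>?F\<^esub> C_pair ?F free_gen (ival f k) (ival b d \<union> ival a b))) = \<zero>\<^bsub>B\<^esub> \<longleftrightarrow>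
      rX B (h (g b k)) (h (g a f)) (h (g f k)) (h (g a b)) (h (g b f)) (h (g a k)) =
          rX B (rX B (h (g d k)) (h (g b f)) (h (g f k)) (h (g b d)) (h (g d f)) (h (g b k))) (h (g a d)) (h (g f k)) (h (g a b))
            (h (g b d)) (rX B (h (g d k)) (h (g a f)) (h (g f k)) (h (g a d)) (h (g d f)) (h (g a k)))"
      using o by (simp add: simps f.hom_minus_eq_zero f.hom_rX g)
  qed
qed

section \<open>Relations on at most four points, on five points, and the star relations\<close>

definition quad_family :: "nat \<Rightarrow> (Cq, 'a) module \<Rightarrow> (nat \<Rightarrow> nat \<Rightarrow> 'a) \<Rightarrow> bool" where
  "quad_family n A c \<longleftrightarrow>
     (\<forall>a b. a < b \<and> b \<le> n \<longrightarrow> c a b \<in> carrier A) \<and>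
     (\<forall>a b d f. a < b \<and> b \<le> n \<and> d < f \<and> f \<le> n \<and> (b \<le> d \<or> f \<le> a \<or> d \<le> a \<and> b \<le> f) \<longrightarrow>
        c a b \<otimes>\<^bsub>A\<^esub> c d f = c d f \<otimes>\<^bsub>A\<^esub> c a b) \<and>
     (\<forall>a b d f. a < b \<and> b < d \<and> d < f \<and> f \<le> n \<longrightarrow>
        c a d = rX A (c b f) (rX A (c a d) (c b f) (c a b) (c d f) (c b d) (c a f)) (c a b) (c b d) (c d f) (c a f) \<and>
        c b f = rX A (c a d) (rX A (c b f) (c a d) (c d f) (c a b) (c b d) (c a f)) (c d f) (c b d) (c a b) (c a f))"

definition pent_family :: "nat \<Rightarrow> (Cq, 'a) module \<Rightarrow> (nat \<Rightarrow> nat \<Rightarrow> 'a) \<Rightarrow> bool" where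
  "pent_family n A c \<longleftrightarrow>
     (\<forall>a b d f g. a < b \<and> b < d \<and> d < f \<and> f < g \<and> g \<le> n \<longrightarrow>
        rX A (c a f) (c b g) (c a b) (c f g) (c b f) (c a g) =
          rX A (rX A (c a d) (c b f) (c a b) (c d f) (c b d) (c a f)) (c d g) (c a b) (c f g)
            (c d f) (rX A (c a d) (c b g) (c a b) (c d g) (c b d) (c a g)) \<and>
        rX A (c b g) (c a f) (c f g) (c a b) (c b f) (c a g) =
          rX A (rX A (c d g) (c b f) (c f g) (c b d) (c d f) (c b g)) (c a d) (c f g) (c a b)
            (c b d) (rX A (c d g) (c a f) (c f g) (c a d) (c d f) (c a g)))"

lemma chord_family_split: "chord_family n A c \<longleftrightarrow> quad_family n A c \<and> pent_family n A c"
  unfolding chord_family_def quad_family_def pent_family_def by (simp only: conj_assoc)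

text \<open>The identity \<delta>_1 P = r_1 r_2 \<delta>_3 P in the fourth algebra and its barred
  version, written out in chords. The second equation is the relation on five points in the order 4,
  0, 1, 2, 3, the first one that in the order 3, 2, 1, 0, 4.\<close>

definition star_family :: "(Cq, 'a) module \<Rightarrow> (nat \<Rightarrow> nat \<Rightarrow> 'a) \<Rightarrow> bool" where
  "star_family A c \<longleftrightarrow>
     rX A (c 0 3) (c 2 4) (c 0 2) (c 3 4) (c 2 3) (c 0 4) =
       rX A (c 1 3) (rX A (c 0 2) (c 1 4) (c 0 1) (c 2 4) (c 1 2) (c 0 4)) (c 1 2)
         (rX A (c 0 3) (c 1 4) (c 0 1) (c 3 4) (c 1 3) (c 0 4)) (c 2 3) (c 0 4) \<and>
     rX A (c 2 4) (c 0 3) (c 0 2) (c 3 4) (c 2 3) (c 0 4) =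
       rX A (rX A (c 1 4) (c 0 2) (c 0 1) (c 2 4) (c 1 2) (c 0 4)) (c 1 3) (c 1 2)
         (rX A (c 1 4) (c 0 3) (c 0 1) (c 3 4) (c 1 3) (c 0 4)) (c 2 3) (c 0 4)"

abbreviation gen :: "nat \<Rightarrow> nat \<Rightarrow> nat set ncpoly" where "gen a b \<equiv> free_gen (ival a b)"

definition star_relators :: "nat set ncpoly set" where
  "star_relators = (let F = free_algebra (conn 4); c = gen in
    {comm F (c a b) (c d f) | a b d f. a < b \<and> b \<le> 4 \<and> d < f \<and> f \<le> 4 \<and> (b \<le> d \<or> f \<le> a \<or> d \<le> a \<and> b \<le> f)} \<union>
    {c a d \<ominus>\<^bsub>F\<^esub> rX F (c b f) (rX F (c a d) (c b f) (c a b) (c d f) (c b d) (c a f)) (c a b) (c b d) (c d f) (c a f)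
       | a b d f. a < b \<and> b < d \<and> d < f \<and> f \<le> 4} \<union>
    {c b f \<ominus>\<^bsub>F\<^esub> rX F (c a d) (rX F (c b f) (c a d) (c d f) (c a b) (c b d) (c a f)) (c d f) (c b d) (c a b) (c a f)
       | a b d f. a < b \<and> b < d \<and> d < f \<and> f \<le> 4} \<union>
    {rX F (c 0 3) (c 2 4) (c 0 2) (c 3 4) (c 2 3) (c 0 4) \<ominus>\<^bsub>F\<^esub>
       rX F (c 1 3) (rX F (c 0 2) (c 1 4) (c 0 1) (c 2 4) (c 1 2) (c 0 4)) (c 1 2)
         (rX F (c 0 3) (c 1 4) (c 0 1) (c 3 4) (c 1 3) (c 0 4)) (c 2 3) (c 0 4),
     rX F (c 2 4) (c 0 3) (c 0 2) (c 3 4) (c 2 3) (c 0 4) \<ominus>\<^bsub>F\<^esub>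
       rX F (rX F (c 1 4) (c 0 2) (c 0 1) (c 2 4) (c 1 2) (c 0 4)) (c 1 3) (c 1 2)
         (rX F (c 1 4) (c 0 3) (c 0 1) (c 3 4) (c 1 3) (c 0 4)) (c 2 3) (c 0 4)})"

lemma gen_carrier: "a < b \<Longrightarrow> b \<le> n \<Longrightarrow> gen a b \<in> carrier (free_algebra (conn n))"
  by (intro free_gen_carrier ival_conn)

lemma aw_relators_carrier: "aw_relators n \<subseteq> carrier (free_algebra (conn n))"
proof -
  let ?F = "free_algebra (conn n)"
  interpret F: assoc_alg ?F by unfold_locales (rule assoc_algebra_free)
  have "\<forall>r\<in>aw_relators n. r \<in> carrier ?F"
    unfolding aw_relators_def Let_def ball_Un ball_image2 ball_image3 ball_image4 ball_mono3 ball_mono4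
    by (intro conjI allI impI; elim conjE; simp add: C_pair_adjacent C_pair_hole ival_union gen_carrier free_gen_carrier F.comm_carrier)
  then show ?thesis by blast
qed

lemma star_relators_carrier: "star_relators \<subseteq> carrier (free_algebra (conn 4))"
proof -
  interpret F: assoc_alg "free_algebra (conn 4)" by unfold_locales (rule assoc_algebra_free)
  have "\<forall>r\<in>star_relators. r \<in> carrier (free_algebra (conn 4))"
    unfolding star_relators_def Let_def ball_Un ball_image4
    by (intro conjI allI impI; (elim conjE)?; simp add: gen_carrier)
  then show ?thesis by blast
qed

lemma star_relators_vanish_iff:
  assumes B: "assoc_algebra B" and f: "h \<in> alg_hom (free_algebra (conn 4)) B"
  shows "(\<forall>r\<in>star_relators. h r = \<zero>\<^bsub>B\<^esub>) \<longleftrightarrow>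
    quad_family 4 B (\<lambda>a b. h (gen a b)) \<and> star_family B (\<lambda>a b. h (gen a b))"
proof -
  let ?F = "free_algebra (conn 4)"
  interpret f: alg_morphism ?F B h using assoc_algebra_free B f by unfold_locales
  have hg: "h (gen a b) \<in> carrier B" if "a < b" "b \<le> 4" for a b
    using gen_carrier[OF that] f.hom_simps by blast
  have carr: "(\<forall>a b. a < b \<and> b \<le> 4 \<longrightarrow> h (gen a b) \<in> carrier B) \<longleftrightarrow> True" using hg by blast
  have 1: "(\<forall>a b d f. P a b d f \<longrightarrow> Q a b d f \<and> R a b d f) \<longleftrightarrow> (\<forall>a b d f. P a b d f \<longrightarrow> Q a b d f) \<and> (\<forall>a b d f. P a b d f \<longrightarrow> R a b d f)"
    for P Q R :: "nat \<Rightarrow> nat \<Rightarrow> nat \<Rightarrow> nat \<Rightarrow> bool" by blast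
  show ?thesis
    unfolding star_relators_def Let_def ball_Un ball_image4 quad_family_def star_family_def carr simp_thms 1 conj_assoc ball_simps
    by (intro conj_cong refl iff_allI imp_cong;
       (elim conjE)?; simp add: f.hom_minus_eq_zero f.hom_comm f.hom_rX gen_carrier hg f.B.comm_zero_iff)
qed

lemma assoc_algebra_aw: "assoc_algebra (aw n)"
  unfolding aw_def by (rule assoc_algebra_presented[OF aw_relators_carrier])

lemma aw_generated: "generated_by (aw n) (aw_gen n ` conn n)"
  unfolding aw_def aw_gen_def by (rule presented_generated[OF aw_relators_carrier])

lemma chord_family_aw: "chord_family n (aw n) (\<lambda>a b. aw_gen n (ival a b))"
proof -
  obtain h where h: "h \<in> alg_hom (free_algebra (conn n)) (aw n)" "\<And>x. h (free_gen x) = aw_gen n x"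
    "\<And>r. r \<in> aw_relators n \<Longrightarrow> h r = \<zero>\<^bsub>aw n\<^esub>"
    using presented_proj[OF aw_relators_carrier] unfolding aw_def aw_gen_def by blast
  show ?thesis
    using relators_vanish_iff[OF assoc_algebra_aw h(1)] h(2,3) by simp
qed

lemma chord_family_restrict:
  "chord_family n A c \<longleftrightarrow> chord_family n A (\<lambda>a b. if a < b \<and> b \<le> n then c a b else undefined)"
  unfolding chord_family_def
  by (intro conj_cong iff_allI imp_cong refl; (elim conjE)?; simp)

lemma chord_family_cong:
  assumes "\<And>a b. a < b \<Longrightarrow> b \<le> n \<Longrightarrow> c a b = c' a b"
  shows "chord_family n A c \<longleftrightarrow> chord_family n A c'"
proof -
  have "(\<lambda>a b. if a < b \<and> b \<le> n then c a b else undefined) = (\<lambda>a b. if a < b \<and> b \<le> n then c' a b else undefined)"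
    using assms by (intro ext) simp
  then show ?thesis using chord_family_restrict[of n A c] chord_family_restrict[of n A c'] by simp
qed

text \<open>The universal property of aw(n) in terms of chords: morphisms to \<open>B\<close> can be
  prescribed by any family that satisfies the relations.\<close>

lemma aw_hom:
  assumes B: "assoc_algebra B" and c: "chord_family n B (\<lambda>a b. C (ival a b))"
  obtains \<phi> where "\<phi> \<in> alg_hom (aw n) B" "\<And>I. I \<in> conn n \<Longrightarrow> \<phi> (aw_gen n I) = C I"
proof -
  have "\<forall>a b. a < b \<and> b \<le> n \<longrightarrow> C (ival a b) \<in> carrier B"
    using c unfolding chord_family_def by (rule conjunct1)
  then have g: "C I \<in> carrier B" if "I \<in> conn n" for I
    using that by (auto simp: conn_iff)
  have rel: "f r = \<zero>\<^bsub>B\<^esub>" if f: "f \<in> alg_hom (free_algebra (conn n)) B" "\<And>x. x \<in> conn n \<Longrightarrow> f (free_gen x) = C x" and r: "r \<in> aw_relators n" for f r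
  proof -
    have "chord_family n B (\<lambda>a b. f (gen a b))"
      using c f(2) ival_conn by (subst chord_family_cong) auto
    with relators_vanish_iff[OF B f(1)] r show ?thesis by simp
  qed
  obtain \<phi> where \<phi>: "\<phi> \<in> alg_hom (presented_algebra (conn n) (aw_relators n)) B"
    "\<And>x. x \<in> conn n \<Longrightarrow> \<phi> (presented_gen (conn n) (aw_relators n) x) = C x"
    using presented_hom[OF aw_relators_carrier B, where g = C] g rel by metis
  show ?thesis
    by (rule that[of \<phi>]) (simp_all add: aw_def aw_gen_def \<phi>)
qed

section \<open>The product of all algebras\<close>

text \<open>Requirement (2) gives two relations in \<open>A\<^sub>4\<close> that differ from (iii) by a rotation of the five points. As rotating
  uses the ring structure on a type, it is carried out in the universal algebra with these relations, which is stored as component \<open>0\<close>.\<close>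

definition star_algebra :: "(Cq, nat set ncpoly set) module" where
  "star_algebra = presented_algebra (conn 4) star_relators"

definition fam :: "nat \<Rightarrow> (Cq, nat set ncpoly set) module" where
  "fam k = (if k = 0 then star_algebra else aw k)"

lemma assoc_algebra_fam: "assoc_algebra (fam k)"
  unfolding fam_def star_algebra_def
  using assoc_algebra_presented[OF star_relators_carrier] assoc_algebra_aw by simp

interpretation fam: assoc_alg "fam k" for k
  by unfold_locales (rule assoc_algebra_fam)

text \<open>A single type of class \<open>ring\<close> that contains every algebra in question as a (non-unital) ideal.\<close>

typedef fam_product = "{f :: nat \<Rightarrow> nat set ncpoly set. \<forall>k. f k \<in> carrier (fam k)}"
  morphisms comp Abs_fam_product
  by (rule exI[of _ "\<lambda>k. \<zero>\<^bsub>fam k\<^esub>"]) simp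

setup_lifting type_definition_fam_product

instantiation fam_product :: Rings.ring
begin
lift_definition zero_fam_product :: fam_product is "\<lambda>k. \<zero>\<^bsub>fam k\<^esub>" by simp
lift_definition plus_fam_product :: "fam_product \<Rightarrow> fam_product \<Rightarrow> fam_product" is "\<lambda>f g k. f k \<oplus>\<^bsub>fam k\<^esub> g k" by simp
lift_definition uminus_fam_product :: "fam_product \<Rightarrow> fam_product" is "\<lambda>f k. \<ominus>\<^bsub>fam k\<^esub> f k" by simp
lift_definition minus_fam_product :: "fam_product \<Rightarrow> fam_product \<Rightarrow> fam_product" is "\<lambda>f g k. f k \<ominus>\<^bsub>fam k\<^esub> g k" by simp
lift_definition times_fam_product :: "fam_product \<Rightarrow> fam_product \<Rightarrow> fam_product" is "\<lambda>f g k. f k \<otimes>\<^bsub>fam k\<^esub> g k" by simp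
instance
proof
  fix a b d :: fam_product
  show "a + b + d = a + (b + d)" by transfer (simp add: fam.a_assoc)
  show "a + b = b + a" by transfer (simp add: fam.a_comm)
  show "0 + a = a" by transfer simp
  show "- a + a = 0" by transfer (simp add: fam.l_neg)
  show "a - b = a + - b" by transfer (simp add: a_minus_def)
  show "a * b * d = a * (b * d)" by transfer (simp add: fam.m_assoc)
  show "(a + b) * d = a * d + b * d" by transfer (simp add: fam.l_distr)
  show "a * (b + d) = a * b + a * d" by transfer (simp add: fam.r_distr)
qed
end

lemma comp_carrier [simp]: "comp x k \<in> carrier (fam k)"
  using comp by blast

lemma comp_simps:
  "comp (x + y) k = comp x k \<oplus>\<^bsub>fam k\<^esub> comp y k" "comp (x * y) k = comp x k \<otimes>\<^bsub>fam k\<^esub> comp y k"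
  "comp (- x) k = \<ominus>\<^bsub>fam k\<^esub> comp x k" "comp (x - y) k = comp x k \<ominus>\<^bsub>fam k\<^esub> comp y k" "comp 0 k = \<zero>\<^bsub>fam k\<^esub>"
  by (simp_all add: plus_fam_product.rep_eq times_fam_product.rep_eq uminus_fam_product.rep_eq minus_fam_product.rep_eq
      zero_fam_product.rep_eq)

lift_definition scale :: "Cq \<Rightarrow> fam_product \<Rightarrow> fam_product" is "\<lambda>r f k. r \<odot>\<^bsub>fam k\<^esub> f k" by simp

lemma scale_simps:
  "scale r (x + y) = scale r x + scale r y" "scale r x * y = scale r (x * y)" "x * scale r y = scale r (x * y)"
  "scale r (scale s x) = scale (r * s) x" "scale r x + scale s x = scale (r + s) x" "scale 1 x = x" "scale 0 x = 0"
  "scale r x - scale s x = scale (r - s) x" "scale r 0 = 0" "scale r (x - y) = scale r x - scale r y"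
proof -
  show 1: "scale r (x + y) = scale r x + scale r y" "scale r x * y = scale r (x * y)" "x * scale r y = scale r (x * y)"
    "scale r (scale s x) = scale (r * s) x" "scale r x + scale s x = scale (r + s) x" "scale 1 x = x" "scale 0 x = 0" "scale r 0 = 0"
    for r s x y
    by (transfer; simp add: fam.smult_add fam.mult_smult_left fam.mult_smult_right fam.smult_smult fam.smult_add_scalar)+
  show "scale r x - scale s x = scale (r - s) x"
    using 1(5)[of "r - s" x s] by (simp add: algebra_simps)
  show "scale r (x - y) = scale r x - scale r y"
    using 1(1)[of r "x - y" y] by (simp add: algebra_simps)
qed

definition mu :: "fam_product \<Rightarrow> fam_product" where
  "mu = scale (qq / (qq - inverse qq))"

lemma qq_power_nonzero: "qq ^ 2 + 1 \<noteq> 0" "qq ^ 4 + 1 \<noteq> 0"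
proof -
  have q: "qq ^ k = Fract (monom 1 k) 1" for k
    by (induction k) (simp_all add: qq_def monom_Suc One_fract_def)
  have "qq ^ k + 1 \<noteq> 0" if "k > 0" for k
  proof
    assume "qq ^ k + 1 = 0"
    then have "Fract (monom 1 k + 1 :: complex poly) 1 = Fract 0 1"
      unfolding q by (simp add: One_fract_def Zero_fract_def)
    then have "(monom 1 k + 1 :: complex poly) = 0" by (simp add: eq_fract)
    \<comment> \<open>The value at 1 is 2.\<close>
    then have "poly (monom 1 k + 1 :: complex poly) 1 = 0" by simp
    then show False by (simp add: poly_monom)
  qed
  then show "qq ^ 2 + 1 \<noteq> 0" "qq ^ 4 + 1 \<noteq> 0" by simp_all
qed

interpretation Q: qring mu
proof
  fix x y :: fam_product
  show "mu (x + y) = mu x + mu y" "mu x * y = mu (x * y)" "x * mu y = mu (x * y)"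
    by (simp_all add: mu_def scale_simps)
  define m where "m = qq / (qq - inverse qq)"
  have cancel: "x = 0" if "scale s x = 0" "s \<noteq> 0" for s and x :: fam_product
  proof -
    have "x = scale (inverse s) (scale s x)"
      unfolding scale_simps(4) using that(2) by (simp add: scale_simps(6))
    also have "\<dots> = 0" unfolding that(1) by (rule scale_simps(9))
    finally show ?thesis .
  qed
  have q2: "qq ^ 2 - 1 \<noteq> 0"
    using qq_diff_nonzero qq_nonzero by (simp add: field_simps power2_eq_square)
  have m: "m = qq ^ 2 / (qq ^ 2 - 1)"
    using q2 qq_nonzero qq_diff_nonzero unfolding m_def by (simp add: field_simps power2_eq_square)
  have md: "m * (qq ^ 2 - 1) = qq ^ 2" unfolding m using q2 by simp
  show "x = 0" if "mu x + mu x = x"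
  proof (rule cancel)
    have "scale (m + m - 1) x = mu x + mu x - x"
      unfolding mu_def m_def[symmetric] by (simp only: scale_simps(5,8)[symmetric] scale_simps(6))
    then show "scale (m + m - 1) x = 0" using that by simp
    have "(m + m - 1) * (qq ^ 2 - 1) = m * (qq ^ 2 - 1) + m * (qq ^ 2 - 1) - (qq ^ 2 - 1)"
      by (simp add: algebra_simps)
    also have "\<dots> = qq ^ 2 + 1" unfolding md by simp
    finally show "m + m - 1 \<noteq> 0" using qq_power_nonzero by auto
  qed
  show "x = 0" if "mu (mu x) + mu (mu x) - mu x - mu x + x = 0"
  proof (rule cancel)
    have "scale (m * m + m * m - m - m + 1) x = mu (mu x) + mu (mu x) - mu x - mu x + x"
      unfolding mu_def m_def[symmetric] scale_simps(4) by (simp only: scale_simps(5,8)[symmetric] scale_simps(6))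
    then show "scale (m * m + m * m - m - m + 1) x = 0" using that by simp
    have "(m * m + m * m - m - m + 1) * ((qq ^ 2 - 1) * (qq ^ 2 - 1))
      = 2 * (m * (qq ^ 2 - 1)) * (m * (qq ^ 2 - 1)) - 2 * (m * (qq ^ 2 - 1)) * (qq ^ 2 - 1) + (qq ^ 2 - 1) * (qq ^ 2 - 1)"
      by (simp add: algebra_simps)
    also have "\<dots> = qq ^ 4 + 1"
      unfolding md by (simp add: algebra_simps power2_eq_square power4_eq_xxxx)
    finally show "m * m + m * m - m - m + 1 \<noteq> 0" using qq_power_nonzero by auto
  qed
qed

text \<open>Inclusion of one component. Arguments outside the carrier are sent to zero only to make
  the map total.\<close>

lift_definition emb :: "nat \<Rightarrow> nat set ncpoly set \<Rightarrow> fam_product" is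
  "\<lambda>n x k. if k = n \<and> x \<in> carrier (fam k) then x else \<zero>\<^bsub>fam k\<^esub>" by auto

lemma comp_emb [simp]: "x \<in> carrier (fam n) \<Longrightarrow> comp (emb n x) n = x"
  by (simp add: emb.rep_eq)

lemma emb_inject: "x \<in> carrier (fam n) \<Longrightarrow> y \<in> carrier (fam n) \<Longrightarrow> emb n x = emb n y \<longleftrightarrow> x = y"
  by (metis comp_emb)

lemma emb_simps:
  assumes "x \<in> carrier (fam n)" "y \<in> carrier (fam n)"
  shows "emb n x + emb n y = emb n (x \<oplus>\<^bsub>fam n\<^esub> y)" "emb n x * emb n y = emb n (x \<otimes>\<^bsub>fam n\<^esub> y)"
    "- emb n x = emb n (\<ominus>\<^bsub>fam n\<^esub> x)" "scale r (emb n x) = emb n (r \<odot>\<^bsub>fam n\<^esub> x)"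
    "emb n x - emb n y = emb n (x \<ominus>\<^bsub>fam n\<^esub> y)"
  using assms by (transfer; auto simp: fun_eq_iff a_minus_def)+

lemma br_emb:
  assumes x: "x \<in> carrier (fam n)" "y \<in> carrier (fam n)"
  shows "Q.br (emb n x) (emb n y) = emb n (qcomm (fam n) x y)"
proof -
  let ?q = "qq - inverse qq" and ?X = "emb n (x \<otimes>\<^bsub>fam n\<^esub> y)" and ?Y = "emb n (y \<otimes>\<^bsub>fam n\<^esub> x)"
  have "(qq - ?q) / ?q = qq / ?q - ?q / ?q" by (rule diff_divide_distrib)
  then have e: "inverse qq / ?q = qq / ?q - 1" unfolding divide_self[OF qq_diff_nonzero] by simp
  have "emb n (qcomm (fam n) x y) = scale (1 / ?q) (scale qq ?X - scale (inverse qq) ?Y)"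
    using x by (simp add: qcomm_def emb_simps)
  also have "\<dots> = scale (qq / ?q) ?X - scale (inverse qq / ?q) ?Y" by (simp add: scale_simps)
  also have "scale (inverse qq / ?q) ?Y = scale (qq / ?q) ?Y - scale 1 ?Y"
    unfolding e by (simp only: scale_simps(8))
  finally show ?thesis unfolding Q.br_def using x by (simp add: mu_def emb_simps(2) scale_simps algebra_simps)
qed

lemma resolved_emb:
  assumes "x \<in> carrier (fam n)" "y \<in> carrier (fam n)" "s \<in> carrier (fam n)" "t \<in> carrier (fam n)" "h \<in> carrier (fam n)" "w \<in> carrier (fam n)"
  shows "Q.resolved (emb n x) (emb n y) (emb n s) (emb n t) (emb n h) (emb n w) = emb n (rX (fam n) x y s t h w)"
  using assms by (simp add: Q.resolved_def rX_def br_emb emb_simps)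

lemma mu_emb: "x \<in> carrier (fam k) \<Longrightarrow> mu (emb k x) = emb k ((qq / (qq - inverse qq)) \<odot>\<^bsub>fam k\<^esub> x)"
  by (simp add: mu_def emb_simps)

text \<open>The element lies in component k. Twisted chords have to be known to stay there before
  they can be read again as elements of aw(k).\<close>

definition supp :: "nat \<Rightarrow> fam_product \<Rightarrow> bool" where
  "supp k x \<longleftrightarrow> x = emb k (comp x k)"

lemma supp_emb [simp, intro]: "x \<in> carrier (fam k) \<Longrightarrow> supp k (emb k x)"
  by (simp add: supp_def)

lemma supp_intros:
  assumes "supp k x" "supp k y"
  shows "supp k (x + y)" "supp k (x * y)" "supp k (- x)" "supp k (x - y)" "supp k (mu x)" "supp k (Q.br x y)"
proof -
  have base: "supp k (x + y)" "supp k (x * y)" "supp k (- x)" "supp k (x - y)" "supp k (mu x)" if "supp k x" "supp k y" for x y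
  proof -
    define x' y' where "x' = comp x k" "y' = comp y k"
    have "x = emb k x'" "y = emb k y'" "x' \<in> carrier (fam k)" "y' \<in> carrier (fam k)"
      using that unfolding supp_def x'_y'_def by simp_all
    then show "supp k (x + y)" "supp k (x * y)" "supp k (- x)" "supp k (x - y)" "supp k (mu x)"
      by (simp_all add: emb_simps mu_emb)
  qed
  show "supp k (x + y)" "supp k (x * y)" "supp k (- x)" "supp k (x - y)" "supp k (mu x)"
    by (rule base[OF assms])+
  show "supp k (Q.br x y)" unfolding Q.br_def
    by (rule base(1)[OF base(2)[OF assms(2,1)] base(5)[OF base(4)[OF base(2)[OF assms] base(2)[OF assms(2,1)]] assms(1)]])
qed

text \<open>An idempotent of the product ring that is an identity only on component k; it serves as
  the trivial chord.\<close>

abbreviation unit :: "nat \<Rightarrow> fam_product" where "unit k \<equiv> emb k \<one>\<^bsub>fam k\<^esub>"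

abbreviation chords :: "nat \<Rightarrow> nat \<Rightarrow> (nat \<Rightarrow> nat \<Rightarrow> nat set ncpoly set) \<Rightarrow> nat \<Rightarrow> nat \<Rightarrow> fam_product" where
  "chords n k D \<equiv> Q.clamp n (unit k) (\<lambda>a b. emb k (D a b))"

lemma supp_chords:
  assumes "\<And>a b. a < b \<Longrightarrow> b \<le> n \<Longrightarrow> D a b \<in> carrier (fam k)"
  shows "supp k (chords n k D a b)"
proof (cases "min a n = min b n")
  case False
  then have "min (min a b) n < min (max a b) n" "min (max a b) n \<le> n" by (auto simp: min_def max_def split: if_splits)
  then show ?thesis using assms False by (simp add: Q.clamp_def)
qed (simp add: Q.clamp_def)

context
  fixes n k :: nat and D :: "nat \<Rightarrow> nat \<Rightarrow> nat set ncpoly set"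
  assumes quad: "quad_family n (fam k) D"
begin

lemma D_carrier: "a < b \<Longrightarrow> b \<le> n \<Longrightarrow> D a b \<in> carrier (fam k)"
  and D_comm: "a < b \<Longrightarrow> b \<le> n \<Longrightarrow> d < f \<Longrightarrow> f \<le> n \<Longrightarrow> b \<le> d \<or> f \<le> a \<or> d \<le> a \<and> b \<le> f \<Longrightarrow>
     emb k (D a b) * emb k (D d f) = emb k (D d f) * emb k (D a b)"
proof -
  note q = quad[unfolded quad_family_def]
  show c: "a < b \<Longrightarrow> b \<le> n \<Longrightarrow> D a b \<in> carrier (fam k)" for a b
    using q[THEN conjunct1] by blast
  show "a < b \<Longrightarrow> b \<le> n \<Longrightarrow> d < f \<Longrightarrow> f \<le> n \<Longrightarrow> b \<le> d \<or> f \<le> a \<or> d \<le> a \<and> b \<le> f \<Longrightarrow>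
     emb k (D a b) * emb k (D d f) = emb k (D d f) * emb k (D a b)"
    using q[THEN conjunct2, THEN conjunct1, rule_format, of a b d f] c by (simp add: emb_simps)
qed

lemma D_resolved:
  assumes o: "a < b" "b < d" "d < f" "f \<le> n"
  shows "emb k (D a d) = - Q.br (emb k (D b f)) (Q.resolved (emb k (D a d)) (emb k (D b f)) (emb k (D a b)) (emb k (D d f)) (emb k (D b d)) (emb k (D a f)))
      + emb k (D a b) * emb k (D b d) + emb k (D d f) * emb k (D a f)"
    "emb k (D b f) = - Q.br (emb k (D a d)) (Q.resolved (emb k (D b f)) (emb k (D a d)) (emb k (D d f)) (emb k (D a b)) (emb k (D b d)) (emb k (D a f)))
      + emb k (D d f) * emb k (D b d) + emb k (D a b) * emb k (D a f)"
  using quad[unfolded quad_family_def, THEN conjunct2, THEN conjunct2, rule_format, of a b d f] o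
  unfolding Q.resolved_def[symmetric]
  by (simp_all add: resolved_emb D_carrier emb_inject)

lemma prechordal_chords: "prechordal mu (chords n k D) (unit k)"
  by (rule Q.prechordal_clamp) (use D_carrier D_comm in \<open>auto simp: emb_simps\<close>)

lemma quads_chords:
  assumes o: "a < b" "b < d" "d < f" "f \<le> n"
  shows "prechordal.pent mu (chords n k D) a b d f a" "prechordal.pent mu (chords n k D) b d f a b"
proof -
  have "prechordal.pent mu (chords n k D) a b d f a \<and> prechordal.pent mu (chords n k D) b d f a b"
    by (rule conjI; rule Q.quads_clamp[OF _ _ _ _ _ _ _ o])
      (use D_carrier D_comm D_resolved in \<open>auto simp: emb_simps\<close>)
  then show "prechordal.pent mu (chords n k D) a b d f a" "prechordal.pent mu (chords n k D) b d f a b" by auto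
qed

end

lemma pent_resolved:
  assumes q: "quad_family n (fam k) D" and p: "pent_family n (fam k) D" and o: "a < b" "b < d" "d < f" "f < g" "g \<le> n"
  defines "C \<equiv> \<lambda>a b. emb k (D a b)"
  shows "Q.resolved (C a f) (C b g) (C a b) (C f g) (C b f) (C a g) =
        - Q.br (Q.resolved (C a d) (C b f) (C a b) (C d f) (C b d) (C a f)) (C d g) + C a b * C f g
        + C d f * Q.resolved (C a d) (C b g) (C a b) (C d g) (C b d) (C a g)"
    "Q.resolved (C b g) (C a f) (C f g) (C a b) (C b f) (C a g) =
        - Q.br (Q.resolved (C d g) (C b f) (C f g) (C b d) (C d f) (C b g)) (C a d) + C f g * C a b
        + C b d * Q.resolved (C d g) (C a f) (C f g) (C a d) (C d f) (C a g)"
  using p[unfolded pent_family_def, rule_format, of a b d f g] o D_carrier[OF q]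
  unfolding C_def Q.resolved_def[symmetric]
  by (simp_all add: resolved_emb emb_inject less_imp_le)

lemma chordal_chords:
  assumes D: "chord_family n (fam k) D"
  shows "chordal mu (chords n k D) (unit k)"
proof -
  have q: "quad_family n (fam k) D" and p: "pent_family n (fam k) D" using D unfolding chord_family_split by blast+
  show ?thesis
    by (rule Q.chordal_clamp) (use D_carrier[OF q] D_comm[OF q] D_resolved[OF q] pent_resolved[OF q p] in \<open>auto simp: emb_simps\<close>)
qed

text \<open>The converse of \<open>chordal_chords\<close> for chords supported in one component;
  together they carry relations of an algebra to the circle and back.\<close>

lemma family_of_chordal:
  assumes c: "chordal mu c e" and s: "\<And>a b. supp k (c a b)"
  shows "chord_family n (fam k) (\<lambda>a b. comp (c a b) k)"
proof -
  interpret chordal mu c e by (rule c)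
  define D where "D a b = comp (c a b) k" for a b
  have cD: "c a b = emb k (D a b)" for a b using s[of a b] by (simp add: supp_def D_def)
  have Dc [simp]: "D a b \<in> carrier (fam k)" for a b by (simp add: D_def)
  have comm: "D a b \<otimes>\<^bsub>fam k\<^esub> D d f = D d f \<otimes>\<^bsub>fam k\<^esub> D a b" if "b \<le> d \<or> f \<le> a \<or> d \<le> a \<and> b \<le> f" "a < b" "d < f" for a b d f
  proof -
    have "dih4 a b d f \<or> dih4 a b f d" using that unfolding dih4_def cyc4_def by auto
    then have "c a b * c d f = c d f * c a b"
      using commute[of a b d f] commute[of a b f d] sym[of f d] by auto
    then show ?thesis by (simp add: cD emb_simps emb_inject)
  qed
  have r: "x = y" if "emb k x = emb k y" "x \<in> carrier (fam k)" "y \<in> carrier (fam k)" for x y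
    using that by (simp add: emb_inject)
  show ?thesis
    unfolding chord_family_def D_def[symmetric]
  proof (intro conjI allI impI; (elim conjE)?)
    fix a b d f :: nat assume o: "a < b" "b < d" "d < f"
    show "D a d = rX (fam k) (D b f) (rX (fam k) (D a d) (D b f) (D a b) (D d f) (D b d) (D a f)) (D a b) (D b d) (D d f) (D a f)"
      using relations_of_chordal(1)[of a b d f] o unfolding Q.resolved_def[symmetric] unfolding cD
      by (simp add: resolved_emb emb_inject less_imp_le)
    show "D b f = rX (fam k) (D a d) (rX (fam k) (D b f) (D a d) (D d f) (D a b) (D b d) (D a f)) (D d f) (D b d) (D a b) (D a f)"
      using relations_of_chordal(2)[of a b d f] o unfolding Q.resolved_def[symmetric] unfolding cD
      by (simp add: resolved_emb emb_inject less_imp_le)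
  next
    fix a b d f g :: nat assume o: "a < b" "b < d" "d < f" "f < g"
    show "rX (fam k) (D a f) (D b g) (D a b) (D f g) (D b f) (D a g) =
          rX (fam k) (rX (fam k) (D a d) (D b f) (D a b) (D d f) (D b d) (D a f)) (D d g) (D a b) (D f g)
            (D d f) (rX (fam k) (D a d) (D b g) (D a b) (D d g) (D b d) (D a g))"
      using relations_of_chordal(3)[of a b d f g] o unfolding Q.resolved_def[symmetric] unfolding cD
      by (simp add: resolved_emb emb_inject less_imp_le)
    show "rX (fam k) (D b g) (D a f) (D f g) (D a b) (D b f) (D a g) =
          rX (fam k) (rX (fam k) (D d g) (D b f) (D f g) (D b d) (D d f) (D b g)) (D a d) (D f g) (D a b)
            (D b d) (rX (fam k) (D d g) (D a f) (D f g) (D a d) (D d f) (D a g))"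
      using relations_of_chordal(4)[of a b d f g] o unfolding Q.resolved_def[symmetric] unfolding cD
      by (simp add: resolved_emb emb_inject less_imp_le)
  next
    fix a b d f :: nat assume "a < b" "d < f" and o: "b \<le> d \<or> f \<le> a \<or> d \<le> a \<and> b \<le> f"
    then show "D a b \<otimes>\<^bsub>fam k\<^esub> D d f = D d f \<otimes>\<^bsub>fam k\<^esub> D a b" by (intro comm[OF o])
  qed simp
qed

text \<open>One star relation is a relation on five points for \<open>mu\<close>, the other is the
  same relation for 1 - mu, hence a reflected relation for \<open>mu\<close>. Rotating both gives
  the sorted relations (iii).\<close>

lemma star_typed:
  assumes q: "quad_family 4 (fam k) D" and s: "star_family (fam k) D"
  shows "pent_family 4 (fam k) D"
proof -
  let ?c = "chords 4 k D"
  define C where "C a b = emb k (D a b)" for a b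
  note Dc = D_carrier[OF q]
  interpret P: prechordal mu ?c "unit k" by (rule prechordal_chords[OF q])
  interpret F: prechordal "\<lambda>x. x - mu x" ?c "unit k" by (rule P.flip_prechordal)
  have c: "?c 0 1 = C 0 1" "?c 0 2 = C 0 2" "?c 0 3 = C 0 3" "?c 0 4 = C 0 4" "?c 1 2 = C 1 2" "?c 1 3 = C 1 3"
    "?c 1 4 = C 1 4" "?c 2 3 = C 2 3" "?c 2 4 = C 2 4" "?c 3 4 = C 3 4"
    "?c 1 0 = C 0 1" "?c 2 0 = C 0 2" "?c 3 0 = C 0 3" "?c 4 0 = C 0 4" "?c 2 1 = C 1 2" "?c 3 1 = C 1 3"
    "?c 4 1 = C 1 4" "?c 3 2 = C 2 3" "?c 4 2 = C 2 4" "?c 4 3 = C 3 4"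
    unfolding C_def by (simp_all add: Q.clamp_simps)
  have comm: "C 1 2 * C 0 4 = C 0 4 * C 1 2" "C 1 3 * C 0 4 = C 0 4 * C 1 3" "C 2 3 * C 0 4 = C 0 4 * C 2 3"
    unfolding C_def by (simp_all add: D_comm[OF q])
  have st: "Q.resolved (C 2 4) (C 0 3) (C 0 2) (C 3 4) (C 2 3) (C 0 4) =
       Q.resolved (Q.resolved (C 1 4) (C 0 2) (C 0 1) (C 2 4) (C 1 2) (C 0 4)) (C 1 3) (C 1 2)
         (Q.resolved (C 1 4) (C 0 3) (C 0 1) (C 3 4) (C 1 3) (C 0 4)) (C 2 3) (C 0 4)"
    "Q.resolved (C 0 3) (C 2 4) (C 0 2) (C 3 4) (C 2 3) (C 0 4) =
       Q.resolved (C 1 3) (Q.resolved (C 0 2) (C 1 4) (C 0 1) (C 2 4) (C 1 2) (C 0 4)) (C 1 2)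
         (Q.resolved (C 0 3) (C 1 4) (C 0 1) (C 3 4) (C 1 3) (C 0 4)) (C 2 3) (C 0 4)"
    using s[unfolded star_family_def] unfolding C_def by (simp_all add: resolved_emb Dc)
  have d: "dih5 4 0 1 2 3" by (simp add: dih5_def cyc5_def)
  have "P.pent 4 0 1 2 3"
    using st(1) unfolding P.cpair5_iff[OF d, symmetric] P.cpair_def c Q.resolved_def comm by (simp add: algebra_simps)
  moreover have "F.pent 4 0 1 2 3"
    using st(2) unfolding F.cpair5_iff[OF d, symmetric] F.cpair_def c Q.resolved_def comm Q.flip_br by (simp add: algebra_simps)
  then have "P.pent 3 2 1 0 4" unfolding P.flip_pent .
  ultimately have "P.pent 0 1 2 3 4" "P.pent 4 3 2 1 0"
    using P.pent_five_points quads_chords[OF q] by blast+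
  moreover have "dih5 0 1 2 3 4" "dih5 4 3 2 1 0" by (simp_all add: dih5_def cyc5_def)
  ultimately have p: "P.cpair 0 1 3 4 = - Q.br (P.cpair 0 1 2 3) (?c 2 4) + ?c 0 1 * ?c 3 4 + ?c 2 3 * P.cpair 0 1 2 4"
    "P.cpair 4 3 1 0 = - Q.br (P.cpair 4 3 2 1) (?c 2 0) + ?c 4 3 * ?c 1 0 + ?c 2 1 * P.cpair 4 3 2 0"
    using P.cpair5_iff by blast+
  show ?thesis
    unfolding pent_family_def
  proof (intro allI impI, elim conjE)
    fix a b d f g :: nat assume "a < b" "b < d" "d < f" "f < g" "g \<le> 4"
    then have [simp]: "a = 0" "b = 1" "d = 2" "f = 3" "g = 4" by auto
    show "rX (fam k) (D a f) (D b g) (D a b) (D f g) (D b f) (D a g) =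
          rX (fam k) (rX (fam k) (D a d) (D b f) (D a b) (D d f) (D b d) (D a f)) (D d g) (D a b) (D f g)
            (D d f) (rX (fam k) (D a d) (D b g) (D a b) (D d g) (D b d) (D a g)) \<and>
        rX (fam k) (D b g) (D a f) (D f g) (D a b) (D b f) (D a g) =
          rX (fam k) (rX (fam k) (D d g) (D b f) (D f g) (D b d) (D d f) (D b g)) (D a d) (D f g) (D a b)
            (D b d) (rX (fam k) (D d g) (D a f) (D f g) (D a d) (D d f) (D a g))"
      using p unfolding P.cpair_def c Q.resolved_def[symmetric] unfolding C_def
      by (simp add: resolved_emb Dc emb_inject)
  qed
qed

lemma quad_family_cong:
  assumes "\<And>a b. a < b \<Longrightarrow> b \<le> n \<Longrightarrow> c a b = c' a b"
  shows "quad_family n A c \<longleftrightarrow> quad_family n A c'"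
proof -
  have restrict: "quad_family n A c \<longleftrightarrow> quad_family n A (\<lambda>a b. if a < b \<and> b \<le> n then c a b else undefined)" for c
    unfolding quad_family_def
    by (intro conj_cong iff_allI imp_cong refl; (elim conjE)?; simp)
  have "(\<lambda>a b. if a < b \<and> b \<le> n then c a b else undefined) = (\<lambda>a b. if a < b \<and> b \<le> n then c' a b else undefined)"
    using assms by (intro ext) simp
  then show ?thesis using restrict[of c] restrict[of c'] by simp
qed

text \<open>\<open>B\<close> has its own type, on which rotation is not at hand. The relation is
  proved in the universal algebra with the star relations and pushed along the morphism to
  \<open>B\<close>.\<close>

lemma star_imp_pent:
  assumes B: "assoc_algebra B" and q: "quad_family 4 B (\<lambda>a b. C (ival a b))" and s: "star_family B (\<lambda>a b. C (ival a b))"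
  shows "pent_family 4 B (\<lambda>a b. C (ival a b))"
proof -
  have star: "assoc_algebra star_algebra"
    unfolding star_algebra_def by (rule assoc_algebra_presented[OF star_relators_carrier])
  define G where "G I = presented_gen (conn 4) star_relators I" for I
  obtain h where h: "h \<in> alg_hom (free_algebra (conn 4)) star_algebra" "\<And>x. h (free_gen x) = G x"
    "\<And>r. r \<in> star_relators \<Longrightarrow> h r = \<zero>\<^bsub>star_algebra\<^esub>"
    using presented_proj[OF star_relators_carrier] unfolding star_algebra_def G_def by blast
  have "quad_family 4 star_algebra (\<lambda>a b. G (ival a b)) \<and> star_family star_algebra (\<lambda>a b. G (ival a b))"
    using star_relators_vanish_iff[OF star h(1)] h(2,3) by simp
  then have qs: "quad_family 4 star_algebra (\<lambda>a b. G (ival a b))" and "pent_family 4 star_algebra (\<lambda>a b. G (ival a b))"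
    using star_typed[of 0 "\<lambda>a b. G (ival a b)"] by (simp_all add: fam_def)
  note p = \<open>pent_family 4 star_algebra _\<close>
  have "\<forall>a b. a < b \<and> b \<le> 4 \<longrightarrow> C (ival a b) \<in> carrier B" using q unfolding quad_family_def by (rule conjunct1)
  then have g: "C I \<in> carrier B" if "I \<in> conn 4" for I using that by (auto simp: conn_iff)
  have rel: "f r = \<zero>\<^bsub>B\<^esub>" if f: "f \<in> alg_hom (free_algebra (conn 4)) B" "\<And>x. x \<in> conn 4 \<Longrightarrow> f (free_gen x) = C x" and r: "r \<in> star_relators" for f r
  proof -
    define c where "c a b = f (gen a b)" for a b
    have e: "c a b = C (ival a b)" if "a < b" "b \<le> 4" for a b
      unfolding c_def using f(2) ival_conn[OF that] by blast
    have "quad_family 4 B c"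
      by (rule iffD2[OF quad_family_cong q]) (rule e)
    moreover have "star_family B c"
      using s unfolding star_family_def by (simp add: e)
    ultimately show ?thesis using star_relators_vanish_iff[OF B f(1)] r unfolding c_def by simp
  qed
  obtain \<phi> where \<phi>: "\<phi> \<in> alg_hom star_algebra B" "\<And>x. x \<in> conn 4 \<Longrightarrow> \<phi> (G x) = C x"
    using presented_hom[OF star_relators_carrier B, where g = C] g rel unfolding star_algebra_def G_def by metis
  interpret \<phi>: alg_morphism star_algebra B \<phi> using star B \<phi>(1) by unfold_locales
  have Gc: "G (ival a b) \<in> carrier star_algebra" if "a < b" "b \<le> 4" for a b
    using qs[unfolded quad_family_def, THEN conjunct1] that by blast
  have \<phi>G: "\<phi> (G (ival a b)) = C (ival a b)" if "a < b" "b \<le> 4" for a b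
    using \<phi>(2) ival_conn[OF that] by blast
  show ?thesis
    unfolding pent_family_def
  proof (intro allI impI, elim conjE)
    fix a b d f g :: nat assume o: "a < b" "b < d" "d < f" "f < g" "g \<le> 4"
    note e = p[unfolded pent_family_def, rule_format, of a b d f g]
    show "rX B (C (ival a f)) (C (ival b g)) (C (ival a b)) (C (ival f g)) (C (ival b f)) (C (ival a g)) =
          rX B (rX B (C (ival a d)) (C (ival b f)) (C (ival a b)) (C (ival d f)) (C (ival b d)) (C (ival a f))) (C (ival d g)) (C (ival a b)) (C (ival f g))
            (C (ival d f)) (rX B (C (ival a d)) (C (ival b g)) (C (ival a b)) (C (ival d g)) (C (ival b d)) (C (ival a g))) \<and>
        rX B (C (ival b g)) (C (ival a f)) (C (ival f g)) (C (ival a b)) (C (ival b f)) (C (ival a g)) =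
          rX B (rX B (C (ival d g)) (C (ival b f)) (C (ival f g)) (C (ival b d)) (C (ival d f)) (C (ival b g))) (C (ival a d)) (C (ival f g)) (C (ival a b))
            (C (ival b d)) (rX B (C (ival d g)) (C (ival a f)) (C (ival f g)) (C (ival a d)) (C (ival d f)) (C (ival a g)))"
      using arg_cong[OF e[THEN conjunct1], of \<phi>] arg_cong[OF e[THEN conjunct2], of \<phi>] o
      by (simp add: \<phi>.hom_rX Gc \<phi>G less_imp_le)
  qed
qed

section \<open>The half twists on chord families\<close>

text \<open>The bracket is a parameter: \<open>Q.br\<close> gives r_i, and \<open>bro\<close>, with
  exchanged arguments, gives its inverse.\<close>

definition tw :: "(fam_product \<Rightarrow> fam_product \<Rightarrow> fam_product) \<Rightarrow> (nat \<Rightarrow> nat \<Rightarrow> fam_product) \<Rightarrow> nat \<Rightarrow> nat \<Rightarrow> fam_product" where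
  "tw \<beta> c i b = c (i - 1) i * c (i + 1) b + c i (i + 1) * c (i - 1) b - \<beta> (c (i - 1) (i + 1)) (c i b)"

definition twist :: "(fam_product \<Rightarrow> fam_product \<Rightarrow> fam_product) \<Rightarrow> (nat \<Rightarrow> nat \<Rightarrow> fam_product) \<Rightarrow> nat \<Rightarrow> nat \<Rightarrow> nat \<Rightarrow> fam_product" where
  "twist \<beta> c i a b = (if a = b then c a a else if a = i then tw \<beta> c i b else if b = i then tw \<beta> c i a else c a b)"

abbreviation bro :: "fam_product \<Rightarrow> fam_product \<Rightarrow> fam_product" where "bro x y \<equiv> Q.br y x"

text \<open>The map \<open>m\<close> is kept general because the inverse twist is the instance of
  the flipped map 1 - mu.\<close>

lemma twist_aux:
  assumes c: "chordal m c e" and i: "1 \<le> i"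
  shows "chordal m (twist (qring.br m) c i) e" "tw (qring.br m) c i (i + 1) = c (i - 1) i" "tw (qring.br m) c i (i - 1) = c i (i + 1)"
    "b \<noteq> i \<Longrightarrow> qring.br m (tw (qring.br m) c i b) (c (i - 1) (i + 1)) = c i (i + 1) * c (i + 1) b + c (i - 1) i * c (i - 1) b - c i b"
proof -
  interpret chordal m c e by (rule c)
  interpret R: chord_at m c e "i - 1" i "i + 1" by unfold_locales (use i in auto)
  have p: "R.pr b = tw br c i b" for b unfolding R.pr_def tw_def ..
  have "R.prime = twist br c i"
    unfolding fun_eq_iff R.prime_def twist_def p using diag by simp
  then show "chordal m (twist br c i) e" using R.P.chordal_axioms by simp
  show "tw br c i (i + 1) = c (i - 1) i" "tw br c i (i - 1) = c i (i + 1)"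
    using R.pr_near unfolding p by auto
  show "br (tw br c i b) (c (i - 1) (i + 1)) = c i (i + 1) * c (i + 1) b + c (i - 1) i * c (i - 1) b - c i b" if "b \<noteq> i"
    using R.pr_K[OF that] unfolding p .
qed

lemma flip_bro: "qring.br (\<lambda>x. x - mu x) = bro"
  by (intro ext) (rule Q.flip_br)

lemma twist_chordal:
  assumes c: "chordal mu c e" and i: "1 \<le> i"
  shows "chordal mu (twist Q.br c i) e" "chordal mu (twist bro c i) e"
    and "tw Q.br c i (i + 1) = c (i - 1) i" "tw Q.br c i (i - 1) = c i (i + 1)"
    and "tw bro c i (i + 1) = c (i - 1) i" "tw bro c i (i - 1) = c i (i + 1)"
    and "b \<noteq> i \<Longrightarrow> Q.br (tw Q.br c i b) (c (i - 1) (i + 1)) = c i (i + 1) * c (i + 1) b + c (i - 1) i * c (i - 1) b - c i b"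
    and "b \<noteq> i \<Longrightarrow> Q.br (c (i - 1) (i + 1)) (tw bro c i b) = c i (i + 1) * c (i + 1) b + c (i - 1) i * c (i - 1) b - c i b"
proof -
  show "chordal mu (twist Q.br c i) e" "tw Q.br c i (i + 1) = c (i - 1) i" "tw Q.br c i (i - 1) = c i (i + 1)"
    "b \<noteq> i \<Longrightarrow> Q.br (tw Q.br c i b) (c (i - 1) (i + 1)) = c i (i + 1) * c (i + 1) b + c (i - 1) i * c (i - 1) b - c i b"
    by (rule twist_aux[OF c i]; assumption)+
  note f = twist_aux[OF chordal.flip_chordal[OF c] i, unfolded flip_bro]
  show "tw bro c i (i + 1) = c (i - 1) i" "tw bro c i (i - 1) = c i (i + 1)"
    "b \<noteq> i \<Longrightarrow> Q.br (c (i - 1) (i + 1)) (tw bro c i b) = c i (i + 1) * c (i + 1) b + c (i - 1) i * c (i - 1) b - c i b"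
    by (rule f(2-4); assumption)+
  show "chordal mu (twist bro c i) e" using chordal.flip_chordal[OF f(1)] by simp
qed

text \<open>A twist only looks at i and its two neighbours, so it commutes with any injective
  relabelling that keeps these three consecutive.\<close>

lemma twist_reindex:
  assumes f: "\<And>a b. f a = f b \<longleftrightarrow> a = b" "f i = j" "f (i - 1) = j - 1" "f (i + 1) = j + 1"
  shows "twist \<beta> (\<lambda>a b. c (f a) (f b)) i a b = twist \<beta> c j (f a) (f b)"
  using f(1)[of a i] f(1)[of b i] f(1)[of a b] unfolding twist_def tw_def f(2-4) by simp

text \<open>The increasing map of points that misses t. It induces \<delta>_t, and at the two ends,
  t = 0 and t = n + 1, the index shift and \<iota>_n.\<close>

definition skip :: "nat \<Rightarrow> nat \<Rightarrow> nat" where "skip t a = (if a < t then a else a + 1)"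

lemma skip_simps: "skip t a = skip t b \<longleftrightarrow> a = b" "skip t a \<noteq> t"
  by (auto simp: skip_def)

lemma skip_mono: "skip t a \<le> skip t b \<longleftrightarrow> a \<le> b"
  by (auto simp: skip_def)

lemma chordal_skip:
  assumes "chordal mu c e" shows "chordal mu (\<lambda>a b. c (skip t a) (skip t b)) e"
proof -
  interpret chordal mu c e by (rule assms)
  interpret S: prechordal mu "\<lambda>a b. c (skip t a) (skip t b)" e
  proof
    fix a b d f
    show "c (skip t a) (skip t b) = c (skip t b) (skip t a)" by (rule sym)
    assume "dih4 a b d f"
    then have "dih4 (skip t a) (skip t b) (skip t d) (skip t f)" by (simp add: dih4_def cyc4_def skip_mono)
    then show "c (skip t a) (skip t b) * c (skip t d) (skip t f) = c (skip t d) (skip t f) * c (skip t a) (skip t b)"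
      by (rule commute)
  qed (simp_all add: diag unit_left unit_right)
  show ?thesis
  proof
    fix a b d f g assume "dih5 a b d f g"
    then have "dih5 (skip t a) (skip t b) (skip t d) (skip t f) (skip t g)" by (simp add: dih5_def cyc5_def skip_mono)
    from pent[OF this] show "S.pent a b d f g" unfolding S.pent_def pent_def .
  qed
qed

text \<open>At the moved chords both sides expand to the two sides of relation (iii) in the form
  \<open>cpair5_iff\<close>, on the points i-1, i, i+1, i+2 and b', read downwards in the first case
  and upwards in the second.\<close>

lemma twist_braid:
  assumes c: "chordal mu c e" and i: "1 \<le> i"
  shows "twist Q.br (\<lambda>a b. c (skip i a) (skip i b)) i a b = twist Q.br (twist Q.br c (i + 1)) i (skip (i + 1) a) (skip (i + 1) b)"
    and "twist Q.br (\<lambda>a b. c (skip (i + 1) a) (skip (i + 1) b)) i a b = twist Q.br (twist Q.br c i) (i + 1) (skip i a) (skip i b)"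
proof -
  interpret chordal mu c e by (rule c)
  obtain w where w: "i = Suc w" using i by (cases i) auto
  have pt: "tw Q.br c p b = cpair (p - 1) p (p + 1) b" "tw Q.br c p b = cpair (p + 1) p (p - 1) b" for p b
    unfolding tw_def cpair_def sym[of "p + 1" p] sym[of "p + 1" "p - 1"] sym[of p "p - 1"] by (simp_all add: algebra_simps)
  have near: "tw Q.br c p (p + 1) = c (p - 1) p" "tw Q.br c p (p - 1) = c p (p + 1)" if "1 \<le> p" for p
    by (rule twist_chordal[OF c that])+
  have eq1: "tw Q.br (\<lambda>a b. c (skip i a) (skip i b)) i b = tw Q.br (twist Q.br c (i + 1)) i b'"
    if b: "b \<noteq> i" "b' = skip (i + 1) b" for b b'
  proof -
    have b': "b' = skip i b" "b' \<noteq> i" "b' \<noteq> i + 1" using b by (auto simp: skip_def)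
    have d: "dih5 (i + 2) (i + 1) i (i - 1) b'"
      using b'(2,3) unfolding w dih5_def cyc5_def by simp linarith
    have "tw Q.br (\<lambda>a b. c (skip i a) (skip i b)) i b = cpair (i + 2) (i + 1) (i - 1) b'"
      using b' unfolding tw_def cpair_def w by (simp add: skip_def sym[of "Suc (Suc (Suc w))"] sym[of "Suc (Suc w)" w] algebra_simps)
    also have "\<dots> = - Q.br (cpair (i + 2) (i + 1) i (i - 1)) (c i b') + c (i + 2) (i + 1) * c (i - 1) b' + c i (i - 1) * cpair (i + 2) (i + 1) i b'"
      using pent[OF d] unfolding cpair5_iff[OF d, symmetric] .
    also have "\<dots> = tw Q.br (twist Q.br c (i + 1)) i b'"
      using near(2)[of "i + 1"] b'(2,3) pt(2)[of "i + 1"] unfolding w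
      by (simp add: tw_def[of _ "twist _ _ _"] twist_def sym[of "Suc w" w] sym[of "Suc (Suc (Suc w))"] algebra_simps)
    finally show ?thesis .
  qed
  have eq2: "tw Q.br (\<lambda>a b. c (skip (i + 1) a) (skip (i + 1) b)) i b = tw Q.br (twist Q.br c i) (i + 1) b'"
    if b: "b \<noteq> i" "b' = skip i b" for b b'
  proof -
    have b': "b' = skip (i + 1) b" "b' \<noteq> i" "b' \<noteq> i + 1" using b by (auto simp: skip_def)
    have d: "dih5 (i - 1) i (i + 1) (i + 2) b'"
      using b'(2,3) unfolding w dih5_def cyc5_def by simp linarith
    have "tw Q.br (\<lambda>a b. c (skip (i + 1) a) (skip (i + 1) b)) i b = cpair (i - 1) i (i + 2) b'"
      using b' unfolding tw_def cpair_def w by (simp add: skip_def algebra_simps)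
    also have "\<dots> = - Q.br (cpair (i - 1) i (i + 1) (i + 2)) (c (i + 1) b') + c (i - 1) i * c (i + 2) b' + c (i + 1) (i + 2) * cpair (i - 1) i (i + 1) b'"
      using pent[OF d] unfolding cpair5_iff[OF d, symmetric] .
    also have "\<dots> = tw Q.br (twist Q.br c i) (i + 1) b'"
      using near(1)[of i] b'(2,3) pt(1)[of i] unfolding w
      by (simp add: tw_def[of _ "twist _ _ _"] twist_def algebra_simps)
    finally show ?thesis .
  qed
  have sk: "skip i a = i + 1 \<longleftrightarrow> a = i" "skip (i + 1) a = i \<longleftrightarrow> a = i" "a \<noteq> i \<Longrightarrow> skip (i + 1) a = skip i a" for a
    by (auto simp: skip_def)
  show "twist Q.br (\<lambda>a b. c (skip i a) (skip i b)) i a b = twist Q.br (twist Q.br c (i + 1)) i (skip (i + 1) a) (skip (i + 1) b)"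
    using eq1[of a "skip (i + 1) a"] eq1[of b "skip (i + 1) b"] sk[of a] sk[of b] skip_simps(2)[of "i + 1"]
    by (simp add: twist_def[of _ "\<lambda>a b. c (skip i a) (skip i b)"] twist_def[of _ "twist _ _ _"] skip_simps(1))
      (auto simp: twist_def diag skip_simps)
  show "twist Q.br (\<lambda>a b. c (skip (i + 1) a) (skip (i + 1) b)) i a b = twist Q.br (twist Q.br c i) (i + 1) (skip i a) (skip i b)"
    using eq2[of a "skip i a"] eq2[of b "skip i b"] sk[of a] sk[of b] skip_simps(2)[of i]
    by (simp add: twist_def[of _ "\<lambda>a b. c (skip (i + 1) a) (skip (i + 1) b)"] twist_def[of _ "twist _ _ _"] skip_simps(1))
      (auto simp: twist_def diag skip_simps)
qed

section \<open>The requirements hold for \<open>aw(n)\<close>\<close>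

text \<open>The formula for the bracket of a twisted chord with K, solved for the old chord, is the
  twist with the other bracket; the chords from i to its neighbours are exchanged twice.\<close>

lemma twist_inverse:
  assumes c: "chordal mu c e" and i: "1 \<le> i"
  shows "twist Q.br (twist bro c i) i a b = c a b" "twist bro (twist Q.br c i) i a b = c a b"
proof -
  interpret chordal mu c e by (rule c)
  obtain w where w: "i = Suc w" using i by (cases i) auto
  note t = twist_chordal(3-8)[OF c i]
  have 1: "tw Q.br (twist bro c i) i b = c i b" "tw bro (twist Q.br c i) i b = c i b" if "b \<noteq> i" for b
    using that t(1-4) t(5,6)[OF that] unfolding w
    by (simp_all add: tw_def[of _ "twist _ _ _"] twist_def sym[of "Suc w" w] algebra_simps)
  have 2: "twist \<beta> c i a a = c a a" "a \<noteq> i \<Longrightarrow> b \<noteq> i \<Longrightarrow> twist \<beta> c i a b = c a b" for \<beta> a b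
    by (simp_all add: twist_def)
  have 3: "c a i = c i a" by (rule sym)
  show "twist Q.br (twist bro c i) i a b = c a b" "twist bro (twist Q.br c i) i a b = c a b"
    by (cases "a = b"; cases "a = i"; cases "b = i"; simp add: twist_def[of _ "twist _ _ _"] 1 2 3)+
qed

definition chord :: "nat \<Rightarrow> nat \<Rightarrow> nat \<Rightarrow> nat set ncpoly set" where "chord n a b = aw_gen n (ival a b)"

definition aw_chords :: "nat \<Rightarrow> nat \<Rightarrow> nat \<Rightarrow> fam_product" where "aw_chords n = chords n n (chord n)"

text \<open>The index is positive because component 0 holds the auxiliary star algebra instead of
  some aw(n).\<close>

definition chordal_in :: "nat \<Rightarrow> (nat \<Rightarrow> nat \<Rightarrow> fam_product) \<Rightarrow> bool" where
  "chordal_in N c \<longleftrightarrow> 1 \<le> N \<and> chordal mu c (unit N) \<and> (\<forall>a b. supp N (c a b))"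

lemma fam_aw: "1 \<le> n \<Longrightarrow> fam n = aw n"
  by (simp add: fam_def)

lemma chord_family_chord: "1 \<le> n \<Longrightarrow> chord_family n (fam n) (chord n)"
  using chord_family_aw[of n] by (simp add: fam_aw chord_def[abs_def])

lemma chord_carrier: "1 \<le> n \<Longrightarrow> a < b \<Longrightarrow> b \<le> n \<Longrightarrow> chord n a b \<in> carrier (fam n)"
  using chord_family_chord[of n, unfolded chord_family_def, THEN conjunct1] by blast

lemma chordal_in_aw_chords: "1 \<le> n \<Longrightarrow> chordal_in n (aw_chords n)"
  unfolding chordal_in_def aw_chords_def
  by (intro conjI allI chordal_chords chord_family_chord supp_chords chord_carrier)

lemma aw_chords_emb: "a < b \<Longrightarrow> b \<le> n \<Longrightarrow> aw_chords n a b = emb n (chord n a b)"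
  by (simp add: aw_chords_def Q.clamp_def)

lemma comp_aw_chords: "1 \<le> n \<Longrightarrow> a < b \<Longrightarrow> b \<le> n \<Longrightarrow> comp (aw_chords n a b) n = chord n a b"
  by (simp add: aw_chords_emb chord_carrier)

lemma chordal_in_twist:
  assumes c: "chordal_in N c" and i: "1 \<le> i" and \<beta>: "\<beta> = Q.br \<or> \<beta> = bro"
  shows "chordal_in N (twist \<beta> c i)"
proof -
  have s: "supp N (c a b)" for a b using c by (simp add: chordal_in_def)
  have "supp N (tw \<beta> c i b)" for b
    using \<beta> unfolding tw_def by (auto intro!: supp_intros s)
  then have "supp N (twist \<beta> c i a b)" for a b by (simp add: twist_def s)
  moreover have "chordal mu (twist \<beta> c i) (unit N)"
    using \<beta> twist_chordal(1,2)[OF _ i] c unfolding chordal_in_def by blast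
  ultimately show ?thesis using c by (simp add: chordal_in_def)
qed

lemma chordal_in_skip: "chordal_in N c \<Longrightarrow> chordal_in N (\<lambda>a b. c (skip t a) (skip t b))"
  unfolding chordal_in_def using chordal_skip by blast

text \<open>The morphism of aw(n) given by a chordal family in aw(N). Only the chords between points
  up to n are used, so one family serves all n.\<close>

definition chord_hom :: "nat \<Rightarrow> nat \<Rightarrow> (nat \<Rightarrow> nat \<Rightarrow> fam_product) \<Rightarrow> nat set ncpoly set \<Rightarrow> nat set ncpoly set" where
  "chord_hom n N c = (SOME \<phi>. \<phi> \<in> alg_hom (aw n) (aw N) \<and> (\<forall>a b. a < b \<and> b \<le> n \<longrightarrow> \<phi> (chord n a b) = comp (c a b) N))"

lemma chord_hom:
  assumes c: "chordal_in N c"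
  shows "chord_hom n N c \<in> alg_hom (aw n) (aw N)" "a < b \<Longrightarrow> b \<le> n \<Longrightarrow> chord_hom n N c (chord n a b) = comp (c a b) N"
proof -
  have N: "1 \<le> N" using c by (simp add: chordal_in_def)
  define C where "C I = comp (c (Min I - 1) (Max I)) N" for I
  have C: "C (ival a b) = comp (c a b) N" if "a < b" for a b
  proof -
    have "Min (ival a b) = Suc a" "Max (ival a b) = b" using that unfolding ival_def by (auto intro!: Min_eqI Max_eqI)
    then show ?thesis by (simp add: C_def)
  qed
  have "chord_family n (fam N) (\<lambda>a b. comp (c a b) N)"
    using c family_of_chordal unfolding chordal_in_def by blast
  then have "chord_family n (aw N) (\<lambda>a b. C (ival a b))"
    using C by (subst chord_family_cong[where c' = "\<lambda>a b. comp (c a b) N"]) (simp_all add: fam_aw[OF N])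
  then obtain \<phi> where "\<phi> \<in> alg_hom (aw n) (aw N)" "\<And>I. I \<in> conn n \<Longrightarrow> \<phi> (aw_gen n I) = C I"
    using aw_hom[OF assoc_algebra_aw] by metis
  then have "\<exists>\<phi>. \<phi> \<in> alg_hom (aw n) (aw N) \<and> (\<forall>a b. a < b \<and> b \<le> n \<longrightarrow> \<phi> (chord n a b) = comp (c a b) N)"
    using C ival_conn unfolding chord_def by metis
  from someI_ex[OF this] show "chord_hom n N c \<in> alg_hom (aw n) (aw N)"
    "a < b \<Longrightarrow> b \<le> n \<Longrightarrow> chord_hom n N c (chord n a b) = comp (c a b) N"
    unfolding chord_hom_def by blast+
qed

lemma alg_hom_aw_eqI:
  assumes f: "f \<in> alg_hom (aw n) (aw N)" and g: "g \<in> alg_hom (aw n) (aw N)"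
    and eq: "\<And>a b. a < b \<Longrightarrow> b \<le> n \<Longrightarrow> f (chord n a b) = g (chord n a b)" and x: "x \<in> carrier (aw n)"
  shows "f x = g x"
proof (rule alg_hom_eqI[OF assoc_algebra_aw assoc_algebra_aw aw_generated f g _ x])
  fix x assume "x \<in> aw_gen n ` conn n"
  then show "f x = g x" using eq by (auto simp: conn_iff chord_def)
qed

text \<open>A morphism made into a map of the product ring that discards all other components, so
  that it can be applied to brackets and twists formed there.\<close>

definition lift_hom :: "nat \<Rightarrow> nat \<Rightarrow> (nat set ncpoly set \<Rightarrow> nat set ncpoly set) \<Rightarrow> fam_product \<Rightarrow> fam_product" where
  "lift_hom n N \<phi> x = emb N (\<phi> (comp x n))"

lemma lift_hom_simps:
  assumes n: "1 \<le> n" and N: "1 \<le> N" and \<phi>: "\<phi> \<in> alg_hom (aw n) (aw N)"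
  shows "lift_hom n N \<phi> (x + y) = lift_hom n N \<phi> x + lift_hom n N \<phi> y"
    "lift_hom n N \<phi> (x * y) = lift_hom n N \<phi> x * lift_hom n N \<phi> y"
    "lift_hom n N \<phi> (x - y) = lift_hom n N \<phi> x - lift_hom n N \<phi> y"
    "lift_hom n N \<phi> (Q.br x y) = Q.br (lift_hom n N \<phi> x) (lift_hom n N \<phi> y)"
    "lift_hom n N \<phi> (unit n) = unit N"
    "comp (lift_hom n N \<phi> x) N = \<phi> (comp x n)"
proof -
  interpret \<phi>: alg_morphism "fam n" "fam N" \<phi>
    using assoc_algebra_fam \<phi> by unfold_locales (simp_all add: fam_aw[OF n] fam_aw[OF N])
  show a: "lift_hom n N \<phi> (x + y) = lift_hom n N \<phi> x + lift_hom n N \<phi> y"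
    and m: "lift_hom n N \<phi> (x * y) = lift_hom n N \<phi> x * lift_hom n N \<phi> y"
    and s: "lift_hom n N \<phi> (x - y) = lift_hom n N \<phi> x - lift_hom n N \<phi> y" for x y
    unfolding lift_hom_def comp_simps by (simp_all add: \<phi>.hom_simps \<phi>.hom_minus emb_simps)
  have "comp (mu x) n = (qq / (qq - inverse qq)) \<odot>\<^bsub>fam n\<^esub> comp x n" for x
    by (simp add: mu_def scale.rep_eq)
  then have "lift_hom n N \<phi> (mu x) = mu (lift_hom n N \<phi> x)" for x
    unfolding lift_hom_def by (simp add: \<phi>.hom_simps mu_emb)
  then show "lift_hom n N \<phi> (Q.br x y) = Q.br (lift_hom n N \<phi> x) (lift_hom n N \<phi> y)"
    unfolding Q.br_def a m s by (simp add: a m s)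
  show "lift_hom n N \<phi> (unit n) = unit N" "comp (lift_hom n N \<phi> x) N = \<phi> (comp x n)"
    unfolding lift_hom_def by (simp_all add: \<phi>.hom_simps)
qed

lemma lift_chord_hom_aw_chords:
  assumes n: "1 \<le> n" and c: "chordal_in N c" and ab: "a \<le> n" "b \<le> n"
  shows "lift_hom n N (chord_hom n N c) (aw_chords n a b) = c a b"
proof -
  have N: "1 \<le> N" and s: "supp N (c a b)" for a b using c by (simp_all add: chordal_in_def)
  interpret chordal mu c "unit N" using c by (simp add: chordal_in_def)
  interpret aw_chords: chordal mu "aw_chords n" "unit n" using chordal_in_aw_chords[OF n] by (simp add: chordal_in_def)
  note L = lift_hom_simps[OF n N chord_hom(1)[OF c]]
  have 1: "lift_hom n N (chord_hom n N c) (aw_chords n a b) = c a b" if "a < b" "b \<le> n" for a b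
    using chord_hom(2)[OF c that] s[of a b] that n by (simp add: lift_hom_def comp_aw_chords supp_def)
  consider "a < b" | "a = b" | "b < a" by linarith
  then show ?thesis
  proof cases
    case 2 then show ?thesis by (simp add: aw_chords.diag diag L)
  next
    case 3 then show ?thesis using 1[of b a] ab by (simp add: aw_chords.sym[of a b] sym[of a b])
  qed (use 1 ab in simp)
qed

lemma lift_chord_hom_twist:
  assumes n: "1 \<le> n" and c: "chordal_in N c" and ab: "a \<le> n" "b \<le> n" and i: "1 \<le> i" "i < n" and \<beta>: "\<beta> = Q.br \<or> \<beta> = bro"
  shows "lift_hom n N (chord_hom n N c) (twist \<beta> (aw_chords n) i a b) = twist \<beta> c i a b"
proof -
  have N: "1 \<le> N" using c by (simp add: chordal_in_def)
  have "lift_hom n N (chord_hom n N c) (tw \<beta> (aw_chords n) i b) = tw \<beta> c i b" if "b \<le> n" for b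
    using \<beta> that i by (auto simp: tw_def lift_hom_simps[OF n N chord_hom(1)[OF c]] lift_chord_hom_aw_chords[OF n c])
  then show ?thesis using ab by (simp add: twist_def lift_chord_hom_aw_chords[OF n c])
qed

text \<open>On generators, composing morphisms amounts to applying the second, lifted to the product
  ring, to the chords of the first.\<close>

lemma chord_hom_comp:
  assumes n: "1 \<le> n" and c: "chordal_in N c" and d: "chordal_in M d" and e: "chordal_in M e"
    and eq: "\<And>a b. a < b \<Longrightarrow> b \<le> n \<Longrightarrow> lift_hom N M (chord_hom N M d) (c a b) = e a b" and x: "x \<in> carrier (aw n)"
  shows "chord_hom N M d (chord_hom n N c x) = chord_hom n M e x"
proof -
  have N: "1 \<le> N" and M: "1 \<le> M" using c d by (simp_all add: chordal_in_def)
  have "(chord_hom N M d \<circ> chord_hom n N c) x = chord_hom n M e x"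
  proof (rule alg_hom_aw_eqI[OF alg_hom_trans[OF chord_hom(1)[OF c] chord_hom(1)[OF d]] chord_hom(1)[OF e] _ x])
    fix a b assume ab: "a < b" "b \<le> n"
    show "(chord_hom N M d \<circ> chord_hom n N c) (chord n a b) = chord_hom n M e (chord n a b)"
      using lift_hom_simps(6)[OF N M chord_hom(1)[OF d], of "c a b"] by (simp add: chord_hom(2)[OF c ab] chord_hom(2)[OF e ab] eq[OF ab])
  qed
  then show ?thesis by simp
qed

lemma chord_hom_id: assumes n: "1 \<le> n" and x: "x \<in> carrier (aw n)" shows "chord_hom n n (aw_chords n) x = x"
proof -
  have "id \<in> alg_hom (aw n) (aw n)" by (auto simp: alg_hom_def ring_hom_def)
  from alg_hom_aw_eqI[OF chord_hom(1)[OF chordal_in_aw_chords[OF n]] this _ x] show ?thesis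
    by (simp add: chord_hom(2)[OF chordal_in_aw_chords[OF n]] comp_aw_chords[OF n])
qed

definition aw_iota :: "nat \<Rightarrow> nat set ncpoly set \<Rightarrow> nat set ncpoly set" where
  "aw_iota n = chord_hom n (n + 1) (aw_chords (n + 1))"

definition aw_delta :: "nat \<Rightarrow> nat \<Rightarrow> nat set ncpoly set \<Rightarrow> nat set ncpoly set" where
  "aw_delta n t = chord_hom n (n + 1) (\<lambda>a b. aw_chords (n + 1) (skip t a) (skip t b))"

definition aw_twist :: "(fam_product \<Rightarrow> fam_product \<Rightarrow> fam_product) \<Rightarrow> nat \<Rightarrow> nat \<Rightarrow> nat set ncpoly set \<Rightarrow> nat set ncpoly set" where
  "aw_twist \<beta> n i = chord_hom n n (twist \<beta> (aw_chords n) i)"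

abbreviation "aw_r \<equiv> aw_twist Q.br"
abbreviation "aw_rb \<equiv> aw_twist bro"

context
  fixes n :: nat assumes n: "1 \<le> n"
begin

lemma aw_maps:
  shows "aw_iota n \<in> alg_hom (aw n) (aw (n + 1))" "aw_delta n t \<in> alg_hom (aw n) (aw (n + 1))"
    "1 \<le> i \<Longrightarrow> \<beta> = Q.br \<or> \<beta> = bro \<Longrightarrow> aw_twist \<beta> n i \<in> alg_hom (aw n) (aw n)"
  unfolding aw_iota_def aw_delta_def aw_twist_def
  by (rule chord_hom(1); (intro chordal_in_aw_chords chordal_in_skip chordal_in_twist); use n in simp)+

lemma aw_maps_chord:
  assumes ab: "a < b" "b \<le> n"
  shows "aw_iota n (chord n a b) = chord (n + 1) a b" "aw_delta n t (chord n a b) = chord (n + 1) (skip t a) (skip t b)"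
    "1 \<le> i \<Longrightarrow> \<beta> = Q.br \<or> \<beta> = bro \<Longrightarrow> aw_twist \<beta> n i (chord n a b) = comp (twist \<beta> (aw_chords n) i a b) n"
proof -
  have g: "chordal_in (n + 1) (aw_chords (n + 1))" by (rule chordal_in_aw_chords) simp
  show "aw_iota n (chord n a b) = chord (n + 1) a b"
    unfolding aw_iota_def chord_hom(2)[OF g ab] using ab by (intro comp_aw_chords) auto
  have "skip t a < skip t b" "skip t b \<le> n + 1" using ab by (auto simp: skip_def)
  then show "aw_delta n t (chord n a b) = chord (n + 1) (skip t a) (skip t b)"
    unfolding aw_delta_def chord_hom(2)[OF chordal_in_skip[OF g] ab] by (intro comp_aw_chords) auto
  show "aw_twist \<beta> n i (chord n a b) = comp (twist \<beta> (aw_chords n) i a b) n" if "1 \<le> i" "\<beta> = Q.br \<or> \<beta> = bro"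
    unfolding aw_twist_def by (rule chord_hom(2)[OF chordal_in_twist[OF chordal_in_aw_chords[OF n] that] ab])
qed

lemma aw_twist_inverse:
  assumes i: "1 \<le> i" "i < n" and x: "x \<in> carrier (aw n)"
  shows "aw_rb n i (aw_r n i x) = x" "aw_r n i (aw_rb n i x) = x"
proof -
  note aw_chords = chordal_in_aw_chords[OF n]
  have t: "chordal_in n (twist Q.br (aw_chords n) i)" "chordal_in n (twist bro (aw_chords n) i)"
    using chordal_in_twist[OF aw_chords i(1)] by auto
  have g: "chordal mu (aw_chords n) (unit n)" using aw_chords by (simp add: chordal_in_def)
  have "aw_rb n i (aw_r n i x) = chord_hom n n (aw_chords n) x"
    unfolding aw_twist_def
    by (rule chord_hom_comp[OF n t(1) t(2) aw_chords _ x]) (simp add: lift_chord_hom_twist[OF n t(2) _ _ i] twist_inverse[OF g i(1)])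
  moreover have "aw_r n i (aw_rb n i x) = chord_hom n n (aw_chords n) x"
    unfolding aw_twist_def
    by (rule chord_hom_comp[OF n t(2) t(1) aw_chords _ x]) (simp add: lift_chord_hom_twist[OF n t(1) _ _ i] twist_inverse[OF g i(1)])
  ultimately show "aw_rb n i (aw_r n i x) = x" "aw_r n i (aw_rb n i x) = x" by (simp_all add: chord_hom_id[OF n x])
qed

lemma aw_twist_aut:
  assumes i: "1 \<le> i" "i < n"
  shows "aw_r n i \<in> alg_aut (aw n)" "aw_rb n i \<in> alg_aut (aw n)"
proof -
  note h = aw_maps(3)[OF i(1), of Q.br] aw_maps(3)[OF i(1), of bro]
  have "bij_betw (aw_r n i) (carrier (aw n)) (carrier (aw n))"
    by (rule bij_betw_byWitness[where f' = "aw_rb n i"]) (use aw_twist_inverse[OF i] alg_homE(3)[OF h(1)] alg_homE(3)[OF h(2)] in auto)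
  moreover have "bij_betw (aw_rb n i) (carrier (aw n)) (carrier (aw n))"
    by (rule bij_betw_byWitness[where f' = "aw_r n i"]) (use aw_twist_inverse[OF i] alg_homE(3)[OF h(1)] alg_homE(3)[OF h(2)] in auto)
  ultimately show "aw_r n i \<in> alg_aut (aw n)" "aw_rb n i \<in> alg_aut (aw n)"
    using h by (simp_all add: alg_aut_def)
qed

context
  fixes x assumes x: "x \<in> carrier (aw n)"
begin

lemma aw_iota_twist:
  assumes i: "1 \<le> i" "i < n"
  shows "aw_iota n (aw_r n i x) = aw_r (n + 1) i (aw_iota n x)"
proof -
  let ?aw_chords = "aw_chords (n + 1)"
  have g: "chordal_in (n + 1) ?aw_chords" by (rule chordal_in_aw_chords) simp
  have t: "chordal_in n (twist Q.br (aw_chords n) i)" "chordal_in (n + 1) (twist Q.br ?aw_chords i)"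
    using chordal_in_twist[OF _ i(1)] chordal_in_aw_chords[OF n] g by auto
  have "aw_iota n (aw_r n i x) = chord_hom n (n + 1) (twist Q.br ?aw_chords i) x"
    unfolding aw_iota_def aw_twist_def by (rule chord_hom_comp[OF n t(1) g t(2) _ x]) (rule lift_chord_hom_twist[OF n g _ _ i]; simp)
  moreover have "aw_r (n + 1) i (aw_iota n x) = chord_hom n (n + 1) (twist Q.br ?aw_chords i) x"
    unfolding aw_iota_def aw_twist_def by (rule chord_hom_comp[OF n g t(2) t(2) _ x]) (rule lift_chord_hom_aw_chords[OF _ t(2)]; simp)
  ultimately show ?thesis by simp
qed

lemma aw_twist_delta:
  assumes p: "1 \<le> p" and \<beta>: "\<beta> = Q.br \<or> \<beta> = bro"
  shows "aw_twist \<beta> (n + 1) p (aw_delta n t x) = chord_hom n (n + 1) (\<lambda>a b. twist \<beta> (aw_chords (n + 1)) p (skip t a) (skip t b)) x"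
proof -
  have g: "chordal_in (n + 1) (aw_chords (n + 1))" by (rule chordal_in_aw_chords) simp
  note tw = chordal_in_twist[OF g p \<beta>]
  show ?thesis
    unfolding aw_delta_def aw_twist_def
    by (rule chord_hom_comp[OF n chordal_in_skip[OF g] tw chordal_in_skip[OF tw] _ x]) (rule lift_chord_hom_aw_chords[OF _ tw]; simp add: skip_def)
qed

lemma aw_delta_twist:
  assumes i: "1 \<le> i" "i < n" and \<beta>: "\<beta> = Q.br \<or> \<beta> = bro"
  shows "aw_delta n t (aw_twist \<beta> n i x) = chord_hom n (n + 1) (twist \<beta> (\<lambda>a b. aw_chords (n + 1) (skip t a) (skip t b)) i) x"
proof -
  have g: "chordal_in (n + 1) (\<lambda>a b. aw_chords (n + 1) (skip t a) (skip t b))" by (rule chordal_in_skip, rule chordal_in_aw_chords) simp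
  show ?thesis
    unfolding aw_delta_def aw_twist_def
    by (rule chord_hom_comp[OF n chordal_in_twist[OF chordal_in_aw_chords[OF n] i(1) \<beta>] g chordal_in_twist[OF g i(1) \<beta>] _ x])
      (rule lift_chord_hom_twist[OF n g _ _ i \<beta>]; simp)
qed

text \<open>The order is reversed on families: a morphism carries a twist of the standard chords to
  the same twist of its own chords, so the outer morphism contributes the inner twist.\<close>

lemma aw_twist_twist_delta:
  assumes p: "1 \<le> p" "p \<le> n" "1 \<le> p'"
  shows "aw_r (n + 1) p' (aw_r (n + 1) p (aw_delta n t x)) =
    chord_hom n (n + 1) (\<lambda>a b. twist Q.br (twist Q.br (aw_chords (n + 1)) p') p (skip t a) (skip t b)) x"
proof -
  have g: "chordal_in (n + 1) (aw_chords (n + 1))" by (rule chordal_in_aw_chords) simp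
  have tw: "chordal_in (n + 1) (twist Q.br (aw_chords (n + 1)) q)" if "1 \<le> q" for q
    using chordal_in_twist[OF g that] by blast
  have tw2: "chordal_in (n + 1) (twist Q.br (twist Q.br (aw_chords (n + 1)) p') p)"
    using chordal_in_twist[OF tw[OF p(3)] p(1)] by blast
  show ?thesis
    unfolding aw_twist_delta[OF p(1) disjI1[OF refl]] unfolding aw_twist_def
    by (rule chord_hom_comp[OF n chordal_in_skip[OF tw[OF p(1)]] tw[OF p(3)] chordal_in_skip[OF tw2] _ x])
      (rule lift_chord_hom_twist[OF _ tw[OF p(3)]]; use p in \<open>simp add: skip_def\<close>)
qed

lemma aw_twist_delta_same:
  assumes i: "1 \<le> i" and \<beta>: "\<beta> = Q.br \<or> \<beta> = bro"
  shows "aw_twist \<beta> (n + 1) i (aw_delta n i x) = aw_delta n i x"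
proof -
  have "(\<lambda>a b. twist \<beta> (aw_chords (n + 1)) i (skip i a) (skip i b)) = (\<lambda>a b. aw_chords (n + 1) (skip i a) (skip i b))"
    by (intro ext) (simp add: twist_def skip_simps)
  then show ?thesis unfolding aw_twist_delta[OF assms] unfolding aw_delta_def by simp
qed

lemma aw_delta_twist_far:
  assumes \<beta>: "\<beta> = Q.br \<or> \<beta> = bro"
  shows "1 \<le> j \<Longrightarrow> j + 1 < i \<Longrightarrow> i \<le> n \<Longrightarrow> aw_delta n i (aw_twist \<beta> n j x) = aw_twist \<beta> (n + 1) j (aw_delta n i x)"
    and "1 \<le> i \<Longrightarrow> i < j \<Longrightarrow> j < n \<Longrightarrow> aw_delta n i (aw_twist \<beta> n j x) = aw_twist \<beta> (n + 1) (j + 1) (aw_delta n i x)"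
proof -
  have 1: "twist \<beta> (\<lambda>a b. aw_chords (n + 1) (skip i a) (skip i b)) j = (\<lambda>a b. twist \<beta> (aw_chords (n + 1)) k (skip i a) (skip i b))"
    if "skip i j = k" "skip i (j - 1) = k - 1" "skip i (j + 1) = k + 1" for k
    by (intro ext twist_reindex) (use that in \<open>simp_all add: skip_simps\<close>)
  show "aw_delta n i (aw_twist \<beta> n j x) = aw_twist \<beta> (n + 1) j (aw_delta n i x)" if "1 \<le> j" "j + 1 < i" "i \<le> n"
    using that by (subst aw_delta_twist[OF _ _ \<beta>], simp, simp, subst aw_twist_delta[OF _ \<beta>], simp, subst 1[of j])
      (simp_all add: skip_def)
  show "aw_delta n i (aw_twist \<beta> n j x) = aw_twist \<beta> (n + 1) (j + 1) (aw_delta n i x)" if "1 \<le> i" "i < j" "j < n"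
    using that by (subst aw_delta_twist[OF _ _ \<beta>], simp, simp, subst aw_twist_delta[OF _ \<beta>], simp, subst 1[of "j + 1"])
      (simp_all add: skip_def)
qed

lemma aw_delta_twist_near:
  assumes i: "1 \<le> i" "i < n"
  shows "aw_delta n i (aw_r n i x) = aw_r (n + 1) (i + 1) (aw_r (n + 1) i (aw_delta n (i + 1) x))"
    "aw_delta n (i + 1) (aw_r n i x) = aw_r (n + 1) i (aw_r (n + 1) (i + 1) (aw_delta n i x))"
proof -
  have g: "chordal mu (aw_chords (n + 1)) (unit (n + 1))" using chordal_in_aw_chords[of "n + 1"] by (simp add: chordal_in_def)
  have b: "twist Q.br (\<lambda>a b. aw_chords (n + 1) (skip i a) (skip i b)) i =
      (\<lambda>a b. twist Q.br (twist Q.br (aw_chords (n + 1)) (i + 1)) i (skip (i + 1) a) (skip (i + 1) b))"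
    "twist Q.br (\<lambda>a b. aw_chords (n + 1) (skip (i + 1) a) (skip (i + 1) b)) i =
      (\<lambda>a b. twist Q.br (twist Q.br (aw_chords (n + 1)) i) (i + 1) (skip i a) (skip i b))"
    by (intro ext twist_braid[OF g i(1)])+
  show "aw_delta n i (aw_r n i x) = aw_r (n + 1) (i + 1) (aw_r (n + 1) i (aw_delta n (i + 1) x))"
    unfolding aw_delta_twist[OF i disjI1[OF refl]] b(1) by (rule aw_twist_twist_delta[symmetric]) (use i in auto)
  show "aw_delta n (i + 1) (aw_r n i x) = aw_r (n + 1) i (aw_r (n + 1) (i + 1) (aw_delta n i x))"
    unfolding aw_delta_twist[OF i disjI1[OF refl]] b(2) by (rule aw_twist_twist_delta[symmetric]) (use i in auto)
qed

end

end

text \<open>The unbarred identities at \<open>aw_rb n i x\<close>, with the twists cancelled one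
  after the other.\<close>

lemma aw_delta_twist_near_inverse:
  assumes i: "1 \<le> i" "i < n" and x: "x \<in> carrier (aw n)"
  shows "aw_rb (n + 1) i (aw_rb (n + 1) (i + 1) (aw_delta n i x)) = aw_delta n (i + 1) (aw_rb n i x)"
    "aw_rb (n + 1) (i + 1) (aw_rb (n + 1) i (aw_delta n (i + 1) x)) = aw_delta n i (aw_rb n i x)"
proof -
  have n: "1 \<le> n" using i by simp
  define y where "y = aw_rb n i x"
  have y: "y \<in> carrier (aw n)" "aw_r n i y = x"
    unfolding y_def using alg_homE(3)[OF aw_maps(3)[OF n i(1), of bro]] aw_twist_inverse(2)[OF n i x] x by auto
  have d: "aw_delta n t y \<in> carrier (aw (n + 1))" for t by (rule alg_homE(3)[OF aw_maps(2)[OF n] y(1)])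
  have rc: "aw_r (n + 1) k z \<in> carrier (aw (n + 1))" if "z \<in> carrier (aw (n + 1))" "1 \<le> k" for z k
    using alg_homE(3)[OF aw_maps(3)[of "n + 1" k Q.br] that(1)] that(2) by simp
  have inv: "aw_rb (n + 1) k (aw_r (n + 1) k z) = z" if "z \<in> carrier (aw (n + 1))" "1 \<le> k" "k \<le> n" for k z
    using aw_twist_inverse(1)[of "n + 1" k z] that by simp
  note near = aw_delta_twist_near[OF n y(1) i, unfolded y(2)]
  show "aw_rb (n + 1) i (aw_rb (n + 1) (i + 1) (aw_delta n i x)) = aw_delta n (i + 1) (aw_rb n i x)"
    unfolding near(1) y_def[symmetric] using inv[OF rc[OF d i(1)], of "i + 1" "i + 1"] inv[OF d i(1), of "i + 1"] i by simp
  show "aw_rb (n + 1) (i + 1) (aw_rb (n + 1) i (aw_delta n (i + 1) x)) = aw_delta n i (aw_rb n i x)"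
    unfolding near(2) y_def[symmetric] using inv[OF rc[OF d], of "i + 1" i i] inv[OF d, of "i + 1" i] i by simp
qed

lemma requirement1_aw: "requirement1 aw aw_gen aw_iota aw_delta"
  unfolding requirement1_def
proof (intro allI impI conjI ballI; (elim conjE)?)
  fix n :: nat assume n: "1 \<le> n"
  show "aw_iota n \<in> alg_hom (aw n) (aw (n + 1))" "aw_delta n t \<in> alg_hom (aw n) (aw (n + 1))" for t by (rule aw_maps[OF n])+
  show "aw_iota n (aw_gen n I) = aw_gen (n + 1) I" if "I \<in> conn n" for I
    using that aw_maps_chord(1)[OF n] by (auto simp: conn_iff chord_def)
  fix t j k :: nat assume jk: "1 \<le> j" "j \<le> k" "k \<le> n"
  then have 1: "{j..k} = ival (j - 1) k" by (simp add: ival_def)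
  have "delta_index t j k = ival (skip t (j - 1)) (skip t k)"
    using jk by (auto simp: delta_index_def skip_def ival_def)
  then show "aw_delta n t (aw_gen n {j..k}) = aw_gen (n + 1) (delta_index t j k)"
    using aw_maps_chord(2)[OF n, of "j - 1" k t] jk by (simp add: 1 chord_def)
qed

lemma requirement2_aw: "requirement2 aw aw_iota aw_delta aw_r aw_rb"
  unfolding requirement2_def
proof (intro allI impI conjI ballI; (elim conjE)?)
  fix n :: nat assume n: "1 \<le> n"
  {
    fix i x assume i: "1 \<le> i" "i < n"
    show "aw_r n i \<in> alg_aut (aw n)" "aw_rb n i \<in> alg_aut (aw n)" by (rule aw_twist_aut[OF n i])+
    assume x: "x \<in> carrier (aw n)"
    show "aw_rb n i (aw_r n i x) = x" "aw_r n i (aw_rb n i x) = x" by (rule aw_twist_inverse[OF n i x])+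
    show "aw_iota n (aw_r n i x) = aw_r (n + 1) i (aw_iota n x)" by (rule aw_iota_twist[OF n x i])
    show "aw_delta n i (aw_r n i x) = aw_r (n + 1) (i + 1) (aw_r (n + 1) i (aw_delta n (i + 1) x))"
      "aw_delta n (i + 1) (aw_r n i x) = aw_r (n + 1) i (aw_r (n + 1) (i + 1) (aw_delta n i x))"
      by (rule aw_delta_twist_near[OF n x i])+
    show "aw_rb (n + 1) i (aw_rb (n + 1) (i + 1) (aw_delta n i x)) = aw_delta n (i + 1) (aw_rb n i x)"
      "aw_rb (n + 1) (i + 1) (aw_rb (n + 1) i (aw_delta n (i + 1) x)) = aw_delta n i (aw_rb n i x)"
      by (rule aw_delta_twist_near_inverse[OF i x])+
  }
  fix x assume x: "x \<in> carrier (aw n)"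
  show "aw_r (n + 1) i (aw_delta n i x) = aw_delta n i x" "aw_rb (n + 1) i (aw_delta n i x) = aw_delta n i x" if "1 \<le> i" for i
    using aw_twist_delta_same[OF n x that] by auto
  show "aw_delta n i (aw_r n j x) = aw_r (n + 1) j (aw_delta n i x)" "aw_delta n i (aw_rb n j x) = aw_rb (n + 1) j (aw_delta n i x)"
    if "1 \<le> j" "j + 1 < i" "i \<le> n" for i j using aw_delta_twist_far(1)[OF n x _ that] by auto
  show "aw_delta n i (aw_r n j x) = aw_r (n + 1) (j + 1) (aw_delta n i x)" "aw_delta n i (aw_rb n j x) = aw_rb (n + 1) (j + 1) (aw_delta n i x)"
    if "1 \<le> i" "i < j" "j < n" for i j using aw_delta_twist_far(2)[OF n x _ that] by auto
qed

lemma requirement3_aw: "requirement3 aw aw_gen aw_r"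
  unfolding requirement3_def
proof (intro conjI ballI)
  have comm: "\<forall>a b d f. a < b \<and> b \<le> 2 \<and> d < f \<and> f \<le> 2 \<and> (b \<le> d \<or> f \<le> a \<or> d \<le> a \<and> b \<le> f) \<longrightarrow>
        aw_gen 2 (ival a b) \<otimes>\<^bsub>aw 2\<^esub> aw_gen 2 (ival d f) = aw_gen 2 (ival d f) \<otimes>\<^bsub>aw 2\<^esub> aw_gen 2 (ival a b)"
    using chord_family_aw[of 2, unfolded chord_family_def, THEN conjunct2, THEN conjunct1] .
  have c: "aw_gen 2 (ival a b) \<otimes>\<^bsub>aw 2\<^esub> aw_gen 2 (ival d f) = aw_gen 2 (ival d f) \<otimes>\<^bsub>aw 2\<^esub> aw_gen 2 (ival a b)"
    if ab: "a < b" "b \<le> 2" "d < f" "f \<le> 2" for a b d f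
  proof (cases "b \<le> d \<or> f \<le> a \<or> d \<le> a \<and> b \<le> f")
    case True then show ?thesis using comm[rule_format, of a b d f] ab by blast
  next
    case False
    then have "a \<le> d \<and> f \<le> b" using ab by linarith
    then show ?thesis using comm[rule_format, of d f a b] ab by force
  qed
  show "x \<otimes>\<^bsub>aw 2\<^esub> y = y \<otimes>\<^bsub>aw 2\<^esub> x" if "x \<in> carrier (aw 2)" "y \<in> carrier (aw 2)" for x y
    by (rule commutative_if_generated[OF assoc_algebra_aw aw_generated _ that]) (auto simp: conn_iff c)
  have g: "chordal mu (aw_chords 2) (unit 2)" using chordal_in_aw_chords[of 2] by (simp add: chordal_in_def)
  interpret chordal mu "aw_chords 2" "unit 2" by (rule g)
  have e: "ival 0 1 = {1}" "ival 1 2 = {2}" "ival 1 (Suc (Suc 0)) = {Suc (Suc 0)}" by (auto simp: ival_def)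
  note t = twist_chordal(3,4)[OF g, of 1]
  have "aw_r 2 1 (chord 2 0 1) = comp (tw Q.br (aw_chords 2) 1 0) 2" "aw_r 2 1 (chord 2 1 2) = comp (tw Q.br (aw_chords 2) 1 2) 2"
    by (subst aw_maps_chord(3); simp add: twist_def)+
  then show "aw_r 2 1 (aw_gen 2 {1}) = aw_gen 2 {2}" "aw_r 2 1 (aw_gen 2 {2}) = aw_gen 2 {1}"
    using t comp_aw_chords[of 2 0 1] comp_aw_chords[of 2 1 2] by (simp_all add: chord_def e numeral_2_eq_2 del: One_nat_def)
qed

lemma requirement4_aw: "requirement4 aw aw_gen aw_r aw_rb"
proof -
  have e: "ival 0 1 = {1}" "ival 1 2 = {2}" "ival 2 3 = {3}" "ival 0 2 = {1..2}" "ival 1 3 = {2..3}" "ival 0 3 = {1..3}"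
    by (auto simp: ival_def)
  note c = chord_carrier[of 3]
  have t: "tw Q.br (aw_chords 3) 1 3 = emb 3 (rX (fam 3) (chord 3 0 2) (chord 3 1 3) (chord 3 0 1) (chord 3 2 3) (chord 3 1 2) (chord 3 0 3))"
    "tw bro (aw_chords 3) 1 3 = emb 3 (rX (fam 3) (chord 3 1 3) (chord 3 0 2) (chord 3 0 1) (chord 3 2 3) (chord 3 1 2) (chord 3 0 3))"
    using c by (simp_all add: resolved_emb[symmetric] Q.resolved_def tw_def aw_chords_emb numeral_3_eq_3[symmetric] numeral_2_eq_2[symmetric])
  have "aw_r 3 1 (chord 3 1 3) = comp (tw Q.br (aw_chords 3) 1 3) 3" "aw_rb 3 1 (chord 3 1 3) = comp (tw bro (aw_chords 3) 1 3) 3"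
    by (subst aw_maps_chord(3); simp add: twist_def)+
  moreover have "comp (tw Q.br (aw_chords 3) 1 3) 3 = rX (fam 3) (chord 3 0 2) (chord 3 1 3) (chord 3 0 1) (chord 3 2 3) (chord 3 1 2) (chord 3 0 3)"
    "comp (tw bro (aw_chords 3) 1 3) 3 = rX (fam 3) (chord 3 1 3) (chord 3 0 2) (chord 3 0 1) (chord 3 2 3) (chord 3 1 2) (chord 3 0 3)"
    unfolding t by (intro comp_emb fam.rX_carrier c; simp)+
  moreover have "fam 3 = aw 3" by (rule fam_aw) simp
  ultimately show ?thesis
    unfolding requirement4_def chord_def e rX_def by simp
qed

lemma aw_requirements: "algebra_sequence aw aw_gen" "requirements aw aw_gen"
  unfolding algebra_sequence_def requirements_def
  using assoc_algebra_aw aw_generated requirement1_aw requirement2_aw requirement3_aw requirement4_aw by blast+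

section \<open>Consequences of the requirements\<close>

locale aw_sequence =
  fixes A :: "nat \<Rightarrow> (Cq, 'a) module" and C :: "nat \<Rightarrow> nat set \<Rightarrow> 'a"
    and \<iota> :: "nat \<Rightarrow> 'a \<Rightarrow> 'a" and \<delta> r rb :: "nat \<Rightarrow> nat \<Rightarrow> 'a \<Rightarrow> 'a"
  assumes alg: "algebra_sequence A C"
    and req1: "requirement1 A C \<iota> \<delta>" and req2: "requirement2 A \<iota> \<delta> r rb"
    and req3: "requirement3 A C r" and req4: "requirement4 A C r rb"
begin

definition c :: "nat \<Rightarrow> nat \<Rightarrow> nat \<Rightarrow> 'a" where "c n a b = C n (ival a b)"

lemma assoc: "1 \<le> n \<Longrightarrow> assoc_algebra (A n)"
  using alg unfolding algebra_sequence_def by blast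

lemma c_carrier: "1 \<le> n \<Longrightarrow> a < b \<Longrightarrow> b \<le> n \<Longrightarrow> c n a b \<in> carrier (A n)"
  using alg ival_conn unfolding algebra_sequence_def generated_by_def c_def by blast

lemma iota_hom: "1 \<le> n \<Longrightarrow> \<iota> n \<in> alg_hom (A n) (A (n + 1))"
  and iota_c: "1 \<le> n \<Longrightarrow> a < b \<Longrightarrow> b \<le> n \<Longrightarrow> \<iota> n (c n a b) = c (n + 1) a b"
  using req1 ival_conn unfolding requirement1_def c_def by blast+

lemma delta_hom: "1 \<le> t \<Longrightarrow> t \<le> n \<Longrightarrow> \<delta> n t \<in> alg_hom (A n) (A (n + 1))"
  using req1 unfolding requirement1_def by (meson atLeastAtMost_iff le_trans)

lemma delta_c:
  assumes "1 \<le> t" "t \<le> n" "a < b" "b \<le> n"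
  shows "\<delta> n t (c n a b) = c (n + 1) (skip t a) (skip t b)"
proof -
  have "\<delta> n t (C n {Suc a..b}) = C (n + 1) (delta_index t (Suc a) b)"
    using req1 assms unfolding requirement1_def by auto
  moreover have "delta_index t (Suc a) b = {Suc (skip t a)..skip t b}"
    using assms by (auto simp: delta_index_def skip_def)
  ultimately show ?thesis by (simp add: c_def ival_def)
qed

lemma r_hom: "1 \<le> i \<Longrightarrow> i < n \<Longrightarrow> r n i \<in> alg_hom (A n) (A n)"
  and rb_hom: "1 \<le> i \<Longrightarrow> i < n \<Longrightarrow> rb n i \<in> alg_hom (A n) (A n)"
  using req2 unfolding requirement2_def alg_aut_def by auto

lemma r_inv: "1 \<le> i \<Longrightarrow> i < n \<Longrightarrow> x \<in> carrier (A n) \<Longrightarrow> rb n i (r n i x) = x"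
  and rb_inv: "1 \<le> i \<Longrightarrow> i < n \<Longrightarrow> x \<in> carrier (A n) \<Longrightarrow> r n i (rb n i x) = x"
  and r_iota: "1 \<le> i \<Longrightarrow> i < n \<Longrightarrow> x \<in> carrier (A n) \<Longrightarrow> r (n + 1) i (\<iota> n x) = \<iota> n (r n i x)"
  using req2 unfolding requirement2_def by auto

lemma delta_rel:
  assumes "x \<in> carrier (A n)" "1 \<le> n"
  shows "1 \<le> i \<Longrightarrow> i \<le> n \<Longrightarrow> r (n + 1) i (\<delta> n i x) = \<delta> n i x"
    "1 \<le> i \<Longrightarrow> i \<le> n \<Longrightarrow> rb (n + 1) i (\<delta> n i x) = \<delta> n i x"
    "1 \<le> i \<Longrightarrow> i < n \<Longrightarrow> r (n + 1) (i + 1) (r (n + 1) i (\<delta> n (i + 1) x)) = \<delta> n i (r n i x)"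
    "1 \<le> i \<Longrightarrow> i < n \<Longrightarrow> r (n + 1) i (r (n + 1) (i + 1) (\<delta> n i x)) = \<delta> n (i + 1) (r n i x)"
    "1 \<le> i \<Longrightarrow> i < n \<Longrightarrow> rb (n + 1) i (rb (n + 1) (i + 1) (\<delta> n i x)) = \<delta> n (i + 1) (rb n i x)"
    "1 \<le> i \<Longrightarrow> i < n \<Longrightarrow> rb (n + 1) (i + 1) (rb (n + 1) i (\<delta> n (i + 1) x)) = \<delta> n i (rb n i x)"
    "1 \<le> j \<Longrightarrow> j + 1 < i \<Longrightarrow> i \<le> n \<Longrightarrow> r (n + 1) j (\<delta> n i x) = \<delta> n i (r n j x)"
    "1 \<le> j \<Longrightarrow> j + 1 < i \<Longrightarrow> i \<le> n \<Longrightarrow> rb (n + 1) j (\<delta> n i x) = \<delta> n i (rb n j x)"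
    "1 \<le> i \<Longrightarrow> i < j \<Longrightarrow> j < n \<Longrightarrow> r (n + 1) (j + 1) (\<delta> n i x) = \<delta> n i (r n j x)"
  using req2 assms unfolding requirement2_def by simp_all

text \<open>\<open>sig (n + 1) n \<circ> \<iota> n\<close> will be the shift \<open>C\<^bsub>j\<dots>k\<^esub> \<mapsto> C\<^bsub>j+1\<dots>k+1\<^esub>\<close>, which inserts a point at \<open>0\<close> as \<open>\<delta> n t\<close> does at \<open>t\<close>.\<close>
primrec sig :: "nat \<Rightarrow> nat \<Rightarrow> 'a \<Rightarrow> 'a" where
  "sig n 0 = id"
| "sig n (Suc k) = sig n k \<circ> r n (Suc k)"

lemma id_hom: "id \<in> alg_hom (A n) (A n)"
  by (auto simp: alg_hom_def ring_hom_def)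

lemma sig_hom: "k < n \<Longrightarrow> sig n k \<in> alg_hom (A n) (A n)"
proof (induction k)
  case 0 show ?case by (simp only: sig.simps id_hom)
next
  case (Suc k)
  then have "r n (Suc k) \<in> alg_hom (A n) (A n)" "sig n k \<in> alg_hom (A n) (A n)" using r_hom by simp_all
  then show ?case unfolding sig.simps by (rule alg_hom_trans)
qed

lemma hom_carrier: "f \<in> alg_hom (A n) (A m) \<Longrightarrow> x \<in> carrier (A n) \<Longrightarrow> f x \<in> carrier (A m)"
  by (rule alg_homE(3))

text \<open>All twists that occur in \<open>sig\<close> have index at most k, hence stay away from
  the point t and commute with \<delta>_t.\<close>

lemma sig_below:
  assumes "x \<in> carrier (A n)" "1 \<le> n" "t \<le> n" "k + 1 < t"
  shows "sig (n + 1) k (\<delta> n t x) = \<delta> n t (sig n k x)"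
  using assms
proof (induction k arbitrary: x)
  case (Suc k)
  have "r (n + 1) (Suc k) (\<delta> n t x) = \<delta> n t (r n (Suc k) x)"
    by (rule delta_rel(7)) (use Suc.prems in auto)
  moreover have "r n (Suc k) x \<in> carrier (A n)" by (rule hom_carrier[OF r_hom]) (use Suc.prems in auto)
  ultimately show ?case using Suc.IH[of "r n (Suc k) x"] Suc.prems by simp
qed simp

text \<open>Twists with index beyond t are lowered by one as they pass \<delta>_t, the two at t and
  t + 1 turn \<delta>_t into \<delta>_(t+1) by the braiding identity, and the rest is
  \<open>sig_below\<close>.\<close>

lemma sig_above:
  assumes "x \<in> carrier (A n)" "1 \<le> t" "t \<le> k" "k < n"
  shows "sig (n + 1) (k + 1) (\<delta> n t x) = \<delta> n (t + 1) (sig n k x)"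
  using assms
proof (induction k arbitrary: x)
  case (Suc k)
  have c: "r n (Suc k) x \<in> carrier (A n)" by (rule hom_carrier[OF r_hom]) (use Suc.prems in auto)
  show ?case
  proof (cases "t = Suc k")
    case True
    have "r (n + 1) (Suc k) (r (n + 1) (Suc k + 1) (\<delta> n (Suc k) x)) = \<delta> n (Suc k + 1) (r n (Suc k) x)"
      by (rule delta_rel(4)) (use Suc.prems in auto)
    moreover have "sig (n + 1) k (\<delta> n (Suc k + 1) (r n (Suc k) x)) = \<delta> n (Suc k + 1) (sig n k (r n (Suc k) x))"
      by (rule sig_below[OF c]) (use Suc.prems in auto)
    ultimately show ?thesis using True by simp
  next
    case False
    have "r (n + 1) (Suc k + 1) (\<delta> n t x) = \<delta> n t (r n (Suc k) x)"
      by (rule delta_rel(9)) (use Suc.prems False in auto)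
    then show ?thesis using Suc.IH[OF c] Suc.prems False by simp
  qed
qed simp

end

context aw_sequence
begin

lemma delta_eval:
  "1 \<le> t \<Longrightarrow> t < m \<Longrightarrow> a < b \<Longrightarrow> b < m \<Longrightarrow> skip t a = a' \<Longrightarrow> skip t b = b' \<Longrightarrow> \<delta> (m - 1) t (c (m - 1) a b) = c m a' b'"
  using delta_c[of t "m - 1" a b] by simp

text \<open>A chord avoiding the point i comes from \<delta>_i, on whose image r_i and its inverse
  are trivial.\<close>

lemma r_fixes:
  assumes i: "1 \<le> i" "i < m" and ab: "a < b" "b \<le> m" "a \<noteq> i" "b \<noteq> i"
  shows "r m i (c m a b) = c m a b" "rb m i (c m a b) = c m a b"
proof -
  define p where "p x = (if x < i then x else x - 1)" for x
  have p: "p a < p b" "p b < m" "skip i (p a) = a" "skip i (p b) = b"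
    using i ab by (auto simp: p_def skip_def)
  have d: "\<delta> (m - 1) i (c (m - 1) (p a) (p b)) = c m a b" using delta_eval[OF i p] .
  have car: "c (m - 1) (p a) (p b) \<in> carrier (A (m - 1))" using i p by (intro c_carrier) auto
  show "r m i (c m a b) = c m a b" "rb m i (c m a b) = c m a b"
    using delta_rel(1,2)[OF car, of i] i unfolding d by simp_all
qed

lemma iota_eval: "2 \<le> m \<Longrightarrow> a < b \<Longrightarrow> b < m \<Longrightarrow> \<iota> (m - 1) (c (m - 1) a b) = c m a b"
  using iota_c[of "m - 1" a b] by simp

lemma r_cancel: "1 \<le> i \<Longrightarrow> i < n \<Longrightarrow> x \<in> carrier (A n) \<Longrightarrow> r n i x = y \<Longrightarrow> rb n i y = x"
  using r_inv by blast

lemma hom_X: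
  assumes "f \<in> alg_hom (A n) (A m)" "1 \<le> n" "1 \<le> m"
    "x \<in> carrier (A n)" "y \<in> carrier (A n)" "s \<in> carrier (A n)" "t \<in> carrier (A n)" "h \<in> carrier (A n)" "w \<in> carrier (A n)"
  shows "f (rX (A n) x y s t h w) = rX (A m) (f x) (f y) (f s) (f t) (f h) (f w)"
proof -
  interpret alg_morphism "A n" "A m" f using assoc assms(1-3) by unfold_locales auto
  show ?thesis by (rule hom_rX[OF assms(4-9)])
qed

lemma r2: "r 2 1 (c 2 0 1) = c 2 1 2" "r 2 1 (c 2 1 2) = c 2 0 1"
proof -
  have "ival 0 1 = {1}" "ival 1 2 = {2}" by (auto simp: ival_def)
  then show "r 2 1 (c 2 0 1) = c 2 1 2" "r 2 1 (c 2 1 2) = c 2 0 1"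
    using req3 unfolding requirement3_def c_def by simp_all
qed

text \<open>The values of r_1 come from the second algebra along \<iota>, those of r_2 from the
  braiding identities applied to C_1 and C_2.\<close>

lemma r3_swap:
  "r 3 1 (c 3 0 1) = c 3 1 2" "r 3 1 (c 3 1 2) = c 3 0 1" "r 3 2 (c 3 1 2) = c 3 2 3" "r 3 2 (c 3 2 3) = c 3 1 2"
proof -
  have car: "c 2 0 1 \<in> carrier (A 2)" "c 2 1 2 \<in> carrier (A 2)" by (rule c_carrier; simp)+
  have io: "\<iota> 2 (c 2 0 1) = c 3 0 1" "\<iota> 2 (c 2 1 2) = c 3 1 2" using iota_eval[of 3] by (simp_all del: One_nat_def)
  have de: "\<delta> 2 1 (c 2 1 2) = c 3 2 3" "\<delta> 2 2 (c 2 0 1) = c 3 0 1"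
    using delta_eval[of _ 3] by (simp_all add: skip_def del: One_nat_def)
  show 1: "r 3 1 (c 3 0 1) = c 3 1 2" "r 3 1 (c 3 1 2) = c 3 0 1"
    using r_iota[of 1 2, OF _ _ car(1)] r_iota[of 1 2, OF _ _ car(2)] unfolding io r2 by (simp_all del: One_nat_def)
  show "r 3 2 (c 3 1 2) = c 3 2 3"
    using delta_rel(3)[OF car(1), of 1] r2 by (simp add: io de 1 del: One_nat_def)
  have "r 3 1 (r 3 2 (c 3 2 3)) = c 3 0 1"
    using delta_rel(4)[OF car(2), of 1] r2 by (simp add: io de 1 del: One_nat_def)
  then have "rb 3 1 (c 3 0 1) = r 3 2 (c 3 2 3)"
    by (intro r_cancel hom_carrier[OF r_hom] c_carrier) simp_all
  moreover have "rb 3 1 (c 3 0 1) = c 3 1 2" by (intro r_cancel 1 c_carrier) simp_all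
  ultimately show "r 3 2 (c 3 2 3) = c 3 1 2" by simp
qed

lemma rb3_swap:
  "rb 3 1 (c 3 0 1) = c 3 1 2" "rb 3 1 (c 3 1 2) = c 3 0 1" "rb 3 2 (c 3 1 2) = c 3 2 3" "rb 3 2 (c 3 2 3) = c 3 1 2"
  by (intro r_cancel c_carrier r3_swap; simp)+

lemma r4_swap:
  "r 4 1 (c 4 0 1) = c 4 1 2" "r 4 1 (c 4 1 2) = c 4 0 1" "r 4 2 (c 4 1 2) = c 4 2 3" "r 4 2 (c 4 2 3) = c 4 1 2"
proof -
  have io: "\<iota> 3 (c 3 0 1) = c 4 0 1" "\<iota> 3 (c 3 1 2) = c 4 1 2" "\<iota> 3 (c 3 2 3) = c 4 2 3" using iota_eval[of 4] by (simp_all del: One_nat_def)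
  have "r 4 i (\<iota> 3 (c 3 a b)) = \<iota> 3 (r 3 i (c 3 a b))" if "1 \<le> i" "i < 3" "a < b" "b \<le> 3" for i a b
    using r_iota[of i 3 "c 3 a b"] c_carrier[of 3 a b] that by simp
  from this[of 1 0 1] this[of 1 1 2] this[of 2 1 2] this[of 2 2 3]
  show "r 4 1 (c 4 0 1) = c 4 1 2" "r 4 1 (c 4 1 2) = c 4 0 1" "r 4 2 (c 4 1 2) = c 4 2 3" "r 4 2 (c 4 2 3) = c 4 1 2"
    unfolding r3_swap io by (simp_all del: One_nat_def)
qed

lemma rb4_swap:
  "rb 4 1 (c 4 0 1) = c 4 1 2" "rb 4 1 (c 4 1 2) = c 4 0 1" "rb 4 2 (c 4 1 2) = c 4 2 3" "rb 4 2 (c 4 2 3) = c 4 1 2"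
  by (intro r_cancel c_carrier r4_swap; simp)+

text \<open>Induction by deleting a point: an inner point that is no end of the chord is inserted by
  some \<delta>_t, and \<open>sig\<close> moves past it.\<close>

lemma sig_shift: "1 \<le> m \<Longrightarrow> a < b \<Longrightarrow> b \<le> m \<Longrightarrow> sig (m + 1) m (c (m + 1) a b) = c (m + 1) (a + 1) (b + 1)"
proof (induction m arbitrary: a b)
  case (Suc n)
  show ?case
  proof (cases "\<exists>t. 1 \<le> t \<and> t \<le> n \<and> t \<noteq> a \<and> t \<noteq> b")
    case True
    then obtain t where t: "1 \<le> t" "t \<le> n" "t \<noteq> a" "t \<noteq> b" by blast
    define p where "p x = (if x < t then x else x - 1)" for x
    have p: "p a < p b" "p b \<le> n" "skip t (p a) = a" "skip t (p b) = b" "skip (t + 1) (p a + 1) = a + 1" "skip (t + 1) (p b + 1) = b + 1"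
      using t Suc.prems by (auto simp: p_def skip_def)
    have "c (Suc n + 1) a b = \<delta> (n + 1) t (c (n + 1) (p a) (p b))"
      using delta_c[of t "n + 1" "p a" "p b"] p t by simp
    also have "sig (Suc n + 1) (Suc n) \<dots> = \<delta> (n + 1) (t + 1) (sig (n + 1) n (c (n + 1) (p a) (p b)))"
      using sig_above[of "c (n + 1) (p a) (p b)" "n + 1" t n] c_carrier[of "n + 1" "p a" "p b"] p t by simp
    also have "sig (n + 1) n (c (n + 1) (p a) (p b)) = c (n + 1) (p a + 1) (p b + 1)"
      by (rule Suc.IH) (use p t in auto)
    also have "\<delta> (n + 1) (t + 1) \<dots> = c (Suc n + 1) (a + 1) (b + 1)"
      using delta_c[of "t + 1" "n + 1" "p a + 1" "p b + 1"] p t by simp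
    finally show ?thesis .
  next
    case False
    \<comment> \<open>Now every point from 1 to n is an end of the chord, so n is at most 2 and only
      four chords remain to be checked by hand.\<close>
    have h: "1 \<le> t \<Longrightarrow> t \<le> n \<Longrightarrow> t = a \<or> t = b" for t using False by blast
    have "n \<le> 2"
    proof (rule ccontr)
      assume "\<not> n \<le> 2"
      then have "1 = a \<or> 1 = b" "2 = a \<or> 2 = b" "3 = a \<or> 3 = b" using h[of 1] h[of 2] h[of 3] by simp_all
      then show False by (elim disjE) simp_all
    qed
    then consider (0) "n = 0" | (1) "n = 1" | (2) "n = 2" by linarith
    then consider "n = 0" "a = 0" "b = 1" | "n = 1" "a = 0" "b = 1" | "n = 1" "a = 1" "b = 2" | "n = 2" "a = 1" "b = 2"
    proof cases
      case 0
      then have "a = 0" "b = 1" using Suc.prems by simp_all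
      then show ?thesis using that(1) 0 by blast
    next
      case 1
      then have "1 = a \<or> 1 = b" using h[of 1] by simp
      then have "a = 0 \<and> b = 1 \<or> a = 1 \<and> b = 2" using Suc.prems 1 by (elim disjE) simp_all
      then show ?thesis using that(2,3) 1 by blast
    next
      case 2
      then have "1 = a \<or> 1 = b" "2 = a \<or> 2 = b" using h[of 1] h[of 2] by simp_all
      then have "a = 1 \<and> b = 2" using Suc.prems by (elim disjE) simp_all
      then show ?thesis using that(4) 2 by blast
    qed
    then show ?thesis
    proof cases
      case 1 then show ?thesis using r2 by (simp add: numeral_2_eq_2)
    next
      case 2
      have "r 3 2 (c 3 0 1) = c 3 0 1" by (rule r_fixes) simp_all
      then show ?thesis using 2 r3_swap by (simp add: numeral_2_eq_2 numeral_3_eq_3)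
    next
      case 3
      have "r 3 1 (c 3 2 3) = c 3 2 3" by (rule r_fixes) simp_all
      then show ?thesis using 3 r3_swap by (simp add: numeral_2_eq_2 numeral_3_eq_3)
    next
      case 4
      have "r 4 3 (c 4 1 2) = c 4 1 2" "r 4 1 (c 4 2 3) = c 4 2 3" by (rule r_fixes; simp)+
      then show ?thesis using 4 r4_swap(3) by (simp add: numeral_eq_Suc)
    qed
  qed
qed simp

text \<open>Insertion at 0 is the shift, at an inner point \<delta>_t, and behind the last point
  \<iota>.\<close>

lemma insertion:
  assumes m: "1 \<le> m" and t: "t \<le> m + 1"
  obtains g where "g \<in> alg_hom (A m) (A (m + 1))" "\<And>a b. a < b \<Longrightarrow> b \<le> m \<Longrightarrow> g (c m a b) = c (m + 1) (skip t a) (skip t b)"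
proof -
  consider "t = 0" | "1 \<le> t" "t \<le> m" | "t = m + 1" using t by linarith
  then show ?thesis
  proof cases
    case 1
    have "sig (m + 1) m \<circ> \<iota> m \<in> alg_hom (A m) (A (m + 1))"
      by (rule alg_hom_trans[OF iota_hom sig_hom]) (use m in auto)
    moreover have "(sig (m + 1) m \<circ> \<iota> m) (c m a b) = c (m + 1) (skip t a) (skip t b)" if "a < b" "b \<le> m" for a b
      using sig_shift[OF m that] iota_c[OF m that] 1 by (simp add: skip_def)
    ultimately show ?thesis by (rule that)
  next
    case 2
    show ?thesis by (rule that[OF delta_hom[OF 2] delta_c[OF 2]])
  next
    case 3
    show ?thesis by (rule that[OF iota_hom[OF m]]) (simp add: iota_c[OF m] 3 skip_def)
  qed
qed

text \<open>An increasing map that is not bijective misses some point t and so factors through the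
  insertion at t.\<close>

lemma reindexing:
  assumes k: "1 \<le> k" and e: "\<And>i. i < k \<Longrightarrow> e i < e (Suc i)" "e k \<le> n"
  obtains f where "f \<in> alg_hom (A k) (A n)" "\<And>a b. a < b \<Longrightarrow> b \<le> k \<Longrightarrow> f (c k a b) = c n (e a) (e b)"
proof -
  have grow: "e i + (j - i) \<le> e j" if "i \<le> j" "j \<le> k" "\<And>i. i < k \<Longrightarrow> e i < e (Suc i)" for i j and e :: "nat \<Rightarrow> nat"
    using that(1,2)
  proof (induction j)
    case (Suc j)
    then show ?case using that(3)[of j] by (cases "i = Suc j") (auto simp: le_Suc_eq)
  qed simp
  have "\<exists>f\<in>alg_hom (A k) (A n). \<forall>a b. a < b \<and> b \<le> k \<longrightarrow> f (c k a b) = c n (e a) (e b)"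
    using e
  proof (induction n arbitrary: e)
    case 0
    then show ?case using grow[of 0 k e] k by simp
  next
    case (Suc n)
    show ?case
    proof (cases "k = Suc n")
      case True
      have "e i = i" if "i \<le> k" for i
        using grow[of 0 i e] grow[of i k e] Suc.prems that True by simp
      then show ?thesis using id_hom[of k] True by (intro bexI[of _ id]) auto
    next
      case False
      have "k < Suc n" using grow[of 0 k e] Suc.prems False by simp
      \<comment> \<open>Pigeonhole: k + 1 points cannot cover n + 2 points.\<close>
      have "\<exists>t\<le>Suc n. t \<notin> e ` {..k}"
      proof (rule ccontr)
        assume "\<not> ?thesis"
        then have "{..Suc n} \<subseteq> e ` {..k}" by auto
        then have "card {..Suc n} \<le> card (e ` {..k})" by (intro card_mono) auto
        also have "\<dots> \<le> card {..k}" by (rule card_image_le) simp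
        finally show False using \<open>k < Suc n\<close> by simp
      qed
      then obtain t where t: "t \<le> Suc n" "\<And>i. i \<le> k \<Longrightarrow> e i \<noteq> t" by auto
      define p where "p x = (if x < t then x else x - 1)" for x
      have sk: "skip t (p (e i)) = e i" if "i \<le> k" for i
        using t(2)[OF that] by (auto simp: p_def skip_def)
      have n: "1 \<le> n" using \<open>k < Suc n\<close> k by simp
      have "\<exists>f\<in>alg_hom (A k) (A n). \<forall>a b. a < b \<and> b \<le> k \<longrightarrow> f (c k a b) = c n (p (e a)) (p (e b))"
      proof (rule Suc.IH)
        show "p (e i) < p (e (Suc i))" if "i < k" for i
          using Suc.prems(1)[OF that] t(2)[of i] t(2)[of "Suc i"] that by (auto simp: p_def)
        show "p (e k) \<le> n" using Suc.prems(2) t by (auto simp: p_def dest: t(2)[of k])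
      qed
      then obtain f where f: "f \<in> alg_hom (A k) (A n)" "\<And>a b. a < b \<Longrightarrow> b \<le> k \<Longrightarrow> f (c k a b) = c n (p (e a)) (p (e b))" by blast
      obtain g where g: "g \<in> alg_hom (A n) (A (n + 1))" "\<And>a b. a < b \<Longrightarrow> b \<le> n \<Longrightarrow> g (c n a b) = c (n + 1) (skip t a) (skip t b)"
        using insertion[OF n, of t] t by auto
      have "(g \<circ> f) (c k a b) = c (Suc n) (e a) (e b)" if ab: "a < b" "b \<le> k" for a b
      proof -
        have ek: "e b \<le> e k" "e a < e b" using grow[of b k e] grow[of a b e] Suc.prems(1) ab by auto
        then have "p (e b) \<le> n" "p (e a) < p (e b)"
          using Suc.prems(2) t(1) t(2)[of a] t(2)[of b] ab by (auto simp: p_def)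
        then show ?thesis using f(2)[OF ab] g(2) sk[of a] sk[of b] ab by simp
      qed
      moreover have "g \<circ> f \<in> alg_hom (A k) (A (Suc n))" using alg_hom_trans[OF f(1) g(1)] by simp
      ultimately show ?thesis by blast
    qed
  qed
  then show ?thesis using that by blast
qed

end

context aw_sequence
begin

definition P :: 'a where "P = rX (A 3) (c 3 0 2) (c 3 1 3) (c 3 0 1) (c 3 2 3) (c 3 1 2) (c 3 0 3)"
definition P' :: 'a where "P' = rX (A 3) (c 3 1 3) (c 3 0 2) (c 3 0 1) (c 3 2 3) (c 3 1 2) (c 3 0 3)"

lemma c3_carrier [simp]: "a < b \<Longrightarrow> b \<le> 3 \<Longrightarrow> c 3 a b \<in> carrier (A 3)"
  and c4_carrier [simp]: "a < b \<Longrightarrow> b \<le> 4 \<Longrightarrow> c 4 a b \<in> carrier (A 4)"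
  by (simp_all add: c_carrier)

lemma P_carrier: "P \<in> carrier (A 3)" "P' \<in> carrier (A 3)"
proof -
  interpret assoc_alg "A 3" by unfold_locales (rule assoc, simp)
  show "P \<in> carrier (A 3)" "P' \<in> carrier (A 3)" unfolding P_def P'_def by (rule rX_carrier; simp)+
qed

lemma r_P: "r 3 1 (c 3 1 3) = P" "rb 3 1 (c 3 1 3) = P'"
proof -
  have "ival 0 1 = {1}" "ival 1 2 = {2}" "ival 2 3 = {3}" "ival 0 2 = {1..2}" "ival 1 3 = {2..3}" "ival 0 3 = {1..3}"
    by (auto simp: ival_def)
  then show "r 3 1 (c 3 1 3) = P" "rb 3 1 (c 3 1 3) = P'"
    using req4 unfolding requirement4_def P_def P'_def rX_def c_def by (simp_all only:)
qed

text \<open>The twists r_1, r_2, r_2, r_1 move C_23 to P, then to C_12, then to P', and back to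
  C_23. The two middle arrows come from the braiding identities applied to C_2 and C_1.\<close>

lemma r3_orbit: "r 3 2 P = c 3 0 2" "r 3 2 (c 3 0 2) = P'" "r 3 1 P' = c 3 1 3"
  "rb 3 2 (c 3 0 2) = P" "rb 3 2 P' = c 3 0 2" "rb 3 1 P = c 3 1 3"
proof -
  have car: "c 2 0 1 \<in> carrier (A 2)" "c 2 1 2 \<in> carrier (A 2)" by (rule c_carrier; simp)+
  have de: "\<delta> 2 1 (c 2 0 1) = c 3 0 2" "\<delta> 2 2 (c 2 1 2) = c 3 1 3"
    using delta_eval[of _ 3] by (simp_all add: skip_def del: One_nat_def)
  show 1: "r 3 2 P = c 3 0 2"
    using delta_rel(3)[OF car(2), of 1] r2 by (simp add: de r_P del: One_nat_def)
  have "r 3 1 (r 3 2 (c 3 0 2)) = c 3 1 3"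
    using delta_rel(4)[OF car(1), of 1] r2 by (simp add: de del: One_nat_def)
  then have "rb 3 1 (c 3 1 3) = r 3 2 (c 3 0 2)"
    by (intro r_cancel hom_carrier[OF r_hom]) simp_all
  then show 2: "r 3 2 (c 3 0 2) = P'" using r_P by simp
  show "r 3 1 P' = c 3 1 3" using rb_inv[of 1 3 "c 3 1 3"] r_P by simp
  show "rb 3 2 (c 3 0 2) = P" "rb 3 2 P' = c 3 0 2" "rb 3 1 P = c 3 1 3"
    by (intro r_cancel 1 2 r_P P_carrier; simp)+
qed

text \<open>Chords between three points come from the commutative second algebra by
  reindexing.\<close>

lemma c2_comm: "1 \<le> n \<Longrightarrow> p0 < p1 \<Longrightarrow> p1 < p2 \<Longrightarrow> p2 \<le> n \<Longrightarrow>
   x \<in> {c n p0 p1, c n p1 p2, c n p0 p2} \<Longrightarrow> y \<in> {c n p0 p1, c n p1 p2, c n p0 p2} \<Longrightarrow> x \<otimes>\<^bsub>A n\<^esub> y = y \<otimes>\<^bsub>A n\<^esub> x"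
proof -
  assume p: "1 \<le> n" "p0 < p1" "p1 < p2" "p2 \<le> n"
    and xy: "x \<in> {c n p0 p1, c n p1 p2, c n p0 p2}" "y \<in> {c n p0 p1, c n p1 p2, c n p0 p2}"
  define e where "e i = (if i = 0 then p0 else if i = 1 then p1 else p2)" for i :: nat
  obtain f where f: "f \<in> alg_hom (A 2) (A n)" "\<And>a b. a < b \<Longrightarrow> b \<le> 2 \<Longrightarrow> f (c 2 a b) = c n (e a) (e b)"
    by (rule reindexing[of 2 e n]) (use p in \<open>auto simp: e_def\<close>)
  have "f (c 2 0 1) = c n p0 p1" "f (c 2 1 2) = c n p1 p2" "f (c 2 0 2) = c n p0 p2"
    using f(2) by (simp_all add: e_def)
  then obtain x' y' where xy': "x' \<in> carrier (A 2)" "y' \<in> carrier (A 2)" "x = f x'" "y = f y'"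
    using xy c_carrier[of 2 0 1] c_carrier[of 2 1 2] c_carrier[of 2 0 2] by fastforce
  have "x' \<otimes>\<^bsub>A 2\<^esub> y' = y' \<otimes>\<^bsub>A 2\<^esub> x'" using req3 xy' unfolding requirement3_def by blast
  then show ?thesis using alg_homE(4)[OF f(1)] xy' by metis
qed

text \<open>Disjoint chords with a gap arise from adjacent ones by r_2, and a chord strictly inside
  another one arises from a chord with a common end by r_1.\<close>

lemma c3_comm: "c 3 0 1 \<otimes>\<^bsub>A 3\<^esub> c 3 2 3 = c 3 2 3 \<otimes>\<^bsub>A 3\<^esub> c 3 0 1" "c 3 1 2 \<otimes>\<^bsub>A 3\<^esub> c 3 0 3 = c 3 0 3 \<otimes>\<^bsub>A 3\<^esub> c 3 1 2"
  "c 3 1 2 \<otimes>\<^bsub>A 3\<^esub> c 3 2 3 = c 3 2 3 \<otimes>\<^bsub>A 3\<^esub> c 3 1 2"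
proof -
  have 1: "c 3 0 1 \<otimes>\<^bsub>A 3\<^esub> c 3 1 2 = c 3 1 2 \<otimes>\<^bsub>A 3\<^esub> c 3 0 1" by (rule c2_comm[of 3 0 1 2]) simp_all
  have 2: "c 3 0 1 \<otimes>\<^bsub>A 3\<^esub> c 3 0 3 = c 3 0 3 \<otimes>\<^bsub>A 3\<^esub> c 3 0 1" by (rule c2_comm[of 3 0 1 3]) simp_all
  have "r 3 2 (c 3 0 1) = c 3 0 1" "r 3 1 (c 3 0 3) = c 3 0 3" by (rule r_fixes; simp)+
  moreover have m: "r 3 i (x \<otimes>\<^bsub>A 3\<^esub> y) = r 3 i x \<otimes>\<^bsub>A 3\<^esub> r 3 i y" if "1 \<le> i" "i < 3" "x \<in> carrier (A 3)" "y \<in> carrier (A 3)" for i x y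
    by (rule alg_homE(4)[OF r_hom[OF that(1,2)] that(3,4)])
  ultimately show "c 3 0 1 \<otimes>\<^bsub>A 3\<^esub> c 3 2 3 = c 3 2 3 \<otimes>\<^bsub>A 3\<^esub> c 3 0 1" "c 3 1 2 \<otimes>\<^bsub>A 3\<^esub> c 3 0 3 = c 3 0 3 \<otimes>\<^bsub>A 3\<^esub> c 3 1 2"
    using arg_cong[OF 1, of "r 3 2"] arg_cong[OF 2, of "r 3 1"] m[of 2 "c 3 0 1" "c 3 1 2"] m[of 2 "c 3 1 2" "c 3 0 1"]
      m[of 1 "c 3 0 1" "c 3 0 3"] m[of 1 "c 3 0 3" "c 3 0 1"] r3_swap by (simp_all del: One_nat_def)
  show "c 3 1 2 \<otimes>\<^bsub>A 3\<^esub> c 3 2 3 = c 3 2 3 \<otimes>\<^bsub>A 3\<^esub> c 3 1 2" by (rule c2_comm[of 3 1 2 3]) simp_all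
qed

text \<open>The inverse twists carry P' to C_12 and P to C_23; applying them to the defining
  expressions of P' and P gives the two directions of relation (ii).\<close>

lemma c3_quad: "c 3 0 2 = rX (A 3) (c 3 1 3) P (c 3 0 1) (c 3 1 2) (c 3 2 3) (c 3 0 3)"
  "c 3 1 3 = rX (A 3) (c 3 0 2) P' (c 3 2 3) (c 3 1 2) (c 3 0 1) (c 3 0 3)"
proof -
  have h: "rb 3 1 \<in> alg_hom (A 3) (A 3)" "rb 3 2 \<in> alg_hom (A 3) (A 3)" by (rule rb_hom; simp)+
  have fix2: "rb 3 2 (c 3 1 3) = c 3 1 3" "rb 3 2 (c 3 0 1) = c 3 0 1" "rb 3 2 (c 3 0 3) = c 3 0 3"
    and fix1: "rb 3 1 (c 3 0 2) = c 3 0 2" "rb 3 1 (c 3 2 3) = c 3 2 3" "rb 3 1 (c 3 0 3) = c 3 0 3"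
    by (rule r_fixes; simp)+
  have "c 3 0 2 = rb 3 2 (rX (A 3) (c 3 1 3) (c 3 0 2) (c 3 0 1) (c 3 2 3) (c 3 1 2) (c 3 0 3))"
    using r3_orbit(5) unfolding P'_def by simp
  also have "\<dots> = rX (A 3) (c 3 1 3) P (c 3 0 1) (c 3 1 2) (c 3 2 3) (c 3 0 3)"
    by (subst hom_X[OF h(2)]; simp add: fix2 r3_orbit rb3_swap del: One_nat_def)
  finally show "c 3 0 2 = rX (A 3) (c 3 1 3) P (c 3 0 1) (c 3 1 2) (c 3 2 3) (c 3 0 3)" .
  have "c 3 1 3 = rb 3 1 (rX (A 3) (c 3 0 2) (c 3 1 3) (c 3 0 1) (c 3 2 3) (c 3 1 2) (c 3 0 3))"
    using r3_orbit(6) unfolding P_def by simp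
  also have "\<dots> = rX (A 3) (c 3 0 2) P' (c 3 1 2) (c 3 2 3) (c 3 0 1) (c 3 0 3)"
    by (subst hom_X[OF h(1)]; simp add: fix1 r_P rb3_swap del: One_nat_def)
  also have "\<dots> = rX (A 3) (c 3 0 2) P' (c 3 2 3) (c 3 1 2) (c 3 0 1) (c 3 0 3)"
    unfolding rX_def c3_comm(3) ..
  finally show "c 3 1 3 = rX (A 3) (c 3 0 2) P' (c 3 2 3) (c 3 1 2) (c 3 0 1) (c 3 0 3)" .
qed

lemma reindexing3:
  assumes "p0 < p1" "p1 < p2" "p2 < p3" "p3 \<le> n"
  obtains f where "f \<in> alg_hom (A 3) (A n)" "f (c 3 0 1) = c n p0 p1" "f (c 3 0 2) = c n p0 p2" "f (c 3 0 3) = c n p0 p3"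
    "f (c 3 1 2) = c n p1 p2" "f (c 3 1 3) = c n p1 p3" "f (c 3 2 3) = c n p2 p3"
proof -
  define e where "e i = (if i = 0 then p0 else if i = 1 then p1 else if i = 2 then p2 else p3)" for i :: nat
  obtain f where f: "f \<in> alg_hom (A 3) (A n)" "\<And>a b. a < b \<Longrightarrow> b \<le> 3 \<Longrightarrow> f (c 3 a b) = c n (e a) (e b)"
    by (rule reindexing[of 3 e n]) (use assms in \<open>auto simp: e_def\<close>)
  show ?thesis by (rule that[OF f(1)]) (simp_all add: f(2), simp_all add: e_def)
qed

text \<open>Two chords have at most four ends and relation (ii) involves four points, so everything
  is carried over from the second and third algebras.\<close>

lemma quad_family_c: assumes n: "1 \<le> n" shows "quad_family n (A n) (c n)"
  unfolding quad_family_def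
proof (intro conjI allI impI; elim conjE)
  show "c n a b \<in> carrier (A n)" if "a < b" "b \<le> n" for a b by (rule c_carrier[OF n that])
next
  fix a b d f assume ab: "a < b" "b \<le> n" and df: "d < f" "f \<le> n" and o: "b \<le> d \<or> f \<le> a \<or> d \<le> a \<and> b \<le> f"
  have comm3: "c n p0 p1 \<otimes>\<^bsub>A n\<^esub> c n p2 p3 = c n p2 p3 \<otimes>\<^bsub>A n\<^esub> c n p0 p1"
    "c n p1 p2 \<otimes>\<^bsub>A n\<^esub> c n p0 p3 = c n p0 p3 \<otimes>\<^bsub>A n\<^esub> c n p1 p2"
    if p: "p0 < p1" "p1 < p2" "p2 < p3" "p3 \<le> n" for p0 p1 p2 p3
  proof -
    obtain h where h: "h \<in> alg_hom (A 3) (A n)" "h (c 3 0 1) = c n p0 p1" "h (c 3 0 2) = c n p0 p2" "h (c 3 0 3) = c n p0 p3"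
      "h (c 3 1 2) = c n p1 p2" "h (c 3 1 3) = c n p1 p3" "h (c 3 2 3) = c n p2 p3" using reindexing3[OF p] by blast
    show "c n p0 p1 \<otimes>\<^bsub>A n\<^esub> c n p2 p3 = c n p2 p3 \<otimes>\<^bsub>A n\<^esub> c n p0 p1"
      using arg_cong[OF c3_comm(1), of h] alg_homE(4)[OF h(1)] by (simp add: h(2-7) del: One_nat_def)
    show "c n p1 p2 \<otimes>\<^bsub>A n\<^esub> c n p0 p3 = c n p0 p3 \<otimes>\<^bsub>A n\<^esub> c n p1 p2"
      using arg_cong[OF c3_comm(2), of h] alg_homE(4)[OF h(1)] by (simp add: h(2-7) del: One_nat_def)
  qed
  consider "b < d" | "b = d" | "f < a" | "f = a" | "d = a" "b = f" | "d = a" "b < f" | "d < a" "b = f" | "d < a" "b < f"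
    using o by linarith
  then show "c n a b \<otimes>\<^bsub>A n\<^esub> c n d f = c n d f \<otimes>\<^bsub>A n\<^esub> c n a b"
  proof cases
    case 1 then show ?thesis using comm3(1)[of a b d f] ab df by simp
  next
    case 2 then show ?thesis using ab df by (intro c2_comm[OF n, of a b f]) auto
  next
    case 3 then show ?thesis using comm3(1)[of d f a b] ab df by simp
  next
    case 4 then show ?thesis using ab df by (intro c2_comm[OF n, of d f b]) auto
  next
    case 5 then show ?thesis by simp
  next
    case 6 then show ?thesis using ab df by (intro c2_comm[OF n, of a b f]) auto
  next
    case 7 then show ?thesis using ab df by (intro c2_comm[OF n, of d a b]) auto
  next
    case 8 then show ?thesis using comm3(2)[of d a b f] ab df by simp
  qed
next
  fix a b d f assume p: "a < b" "b < d" "d < f" "f \<le> n"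
  obtain h where h: "h \<in> alg_hom (A 3) (A n)" "h (c 3 0 1) = c n a b" "h (c 3 0 2) = c n a d" "h (c 3 0 3) = c n a f"
    "h (c 3 1 2) = c n b d" "h (c 3 1 3) = c n b f" "h (c 3 2 3) = c n d f" using reindexing3[OF p] by blast
  note X = hom_X[OF h(1) _ n]
  have hP: "h P = rX (A n) (c n a d) (c n b f) (c n a b) (c n d f) (c n b d) (c n a f)"
    "h P' = rX (A n) (c n b f) (c n a d) (c n a b) (c n d f) (c n b d) (c n a f)"
    unfolding P_def P'_def by (subst X; simp add: h(2-7) del: One_nat_def)+
  have comm: "c n a b \<otimes>\<^bsub>A n\<^esub> c n d f = c n d f \<otimes>\<^bsub>A n\<^esub> c n a b"
    using arg_cong[OF c3_comm(1), of h] alg_homE(4)[OF h(1)] by (simp add: h(2-7) del: One_nat_def)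
  show "c n a d = rX (A n) (c n b f) (rX (A n) (c n a d) (c n b f) (c n a b) (c n d f) (c n b d) (c n a f)) (c n a b) (c n b d) (c n d f) (c n a f)"
    using arg_cong[OF c3_quad(1), of h] by (subst (asm) X; simp add: h(2-7) hP P_carrier del: One_nat_def)
  have "h P' = rX (A n) (c n b f) (c n a d) (c n d f) (c n a b) (c n b d) (c n a f)"
    unfolding hP rX_def comm ..
  then show "c n b f = rX (A n) (c n a d) (rX (A n) (c n b f) (c n a d) (c n d f) (c n a b) (c n b d) (c n a f)) (c n d f) (c n b d) (c n a b) (c n a f)"
    using arg_cong[OF c3_quad(2), of h] by (subst (asm) X; simp add: h(2-7) P_carrier del: One_nat_def)
qed

text \<open>Both sides of \<delta>_1 P = r_1 r_2 \<delta>_3 P are computed: the left from the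
  definition of P, the right by following every chord in \<delta>_3 P through the two
  twists.\<close>

lemma star_family_c: "star_family (A 4) (c 4)"
proof -
  have de1: "\<delta> 3 1 (c 3 0 1) = c 4 0 2" "\<delta> 3 1 (c 3 0 2) = c 4 0 3" "\<delta> 3 1 (c 3 0 3) = c 4 0 4"
      "\<delta> 3 1 (c 3 1 2) = c 4 2 3" "\<delta> 3 1 (c 3 1 3) = c 4 2 4" "\<delta> 3 1 (c 3 2 3) = c 4 3 4"
    and de2: "\<delta> 3 2 (c 3 0 1) = c 4 0 1" "\<delta> 3 2 (c 3 0 2) = c 4 0 3" "\<delta> 3 2 (c 3 0 3) = c 4 0 4"
      "\<delta> 3 2 (c 3 1 2) = c 4 1 3" "\<delta> 3 2 (c 3 1 3) = c 4 1 4" "\<delta> 3 2 (c 3 2 3) = c 4 3 4"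
    and de3: "\<delta> 3 3 (c 3 0 1) = c 4 0 1" "\<delta> 3 3 (c 3 0 2) = c 4 0 2" "\<delta> 3 3 (c 3 0 3) = c 4 0 4"
      "\<delta> 3 3 (c 3 1 2) = c 4 1 2" "\<delta> 3 3 (c 3 1 3) = c 4 1 4" "\<delta> 3 3 (c 3 2 3) = c 4 2 4"
    using delta_eval[of _ 4] by (simp_all add: skip_def del: One_nat_def)
  have dh: "\<delta> 3 t \<in> alg_hom (A 3) (A 4)" if "1 \<le> t" "t \<le> 3" for t using delta_hom[OF that] by simp
  have D1: "\<delta> 3 1 P = rX (A 4) (c 4 0 3) (c 4 2 4) (c 4 0 2) (c 4 3 4) (c 4 2 3) (c 4 0 4)"
    "\<delta> 3 1 P' = rX (A 4) (c 4 2 4) (c 4 0 3) (c 4 0 2) (c 4 3 4) (c 4 2 3) (c 4 0 4)"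
    unfolding P_def P'_def by (subst hom_X[OF dh]; simp add: de1 del: One_nat_def)+
  have D2: "\<delta> 3 2 P = rX (A 4) (c 4 0 3) (c 4 1 4) (c 4 0 1) (c 4 3 4) (c 4 1 3) (c 4 0 4)"
    "\<delta> 3 2 P' = rX (A 4) (c 4 1 4) (c 4 0 3) (c 4 0 1) (c 4 3 4) (c 4 1 3) (c 4 0 4)"
    unfolding P_def P'_def by (subst hom_X[OF dh]; simp add: de2 del: One_nat_def)+
  have D3: "\<delta> 3 3 P = rX (A 4) (c 4 0 2) (c 4 1 4) (c 4 0 1) (c 4 2 4) (c 4 1 2) (c 4 0 4)"
    "\<delta> 3 3 P' = rX (A 4) (c 4 1 4) (c 4 0 2) (c 4 0 1) (c 4 2 4) (c 4 1 2) (c 4 0 4)"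
    unfolding P_def P'_def by (subst hom_X[OF dh]; simp add: de3 del: One_nat_def)+
  have car: "c 3 1 3 \<in> carrier (A 3)" by simp
  have d14: "r 4 1 (c 4 1 4) = \<delta> 3 3 P" "rb 4 1 (c 4 1 4) = \<delta> 3 3 P'"
    using delta_rel(7,8)[OF car, of 1 3] by (simp_all add: de3 r_P del: One_nat_def)
  have d24: "r 4 1 (r 4 2 (c 4 2 4)) = \<delta> 3 2 P" "rb 4 1 (rb 4 2 (c 4 2 4)) = \<delta> 3 2 P'"
    using delta_rel(4,5)[OF car, of 1] by (simp_all add: de1 r_P del: One_nat_def)
  \<comment> \<open>Here the braiding identity is applied to C_23, whose image under \<delta>_2 is
    the chord from 1 to 4 that r_1 turns into \<delta>_3 P. As r_1 fixes the image of \<delta>_1, it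
    may be put in front.\<close>
  have "\<delta> 3 1 P = r 4 2 (\<delta> 3 3 P)" "\<delta> 3 1 P' = rb 4 2 (\<delta> 3 3 P')"
    using delta_rel(3,6)[OF car, of 1] by (simp_all add: de2 r_P d14 del: One_nat_def)
  moreover have "r 4 1 (\<delta> 3 1 P) = \<delta> 3 1 P" "rb 4 1 (\<delta> 3 1 P') = \<delta> 3 1 P'"
    using delta_rel(1)[OF P_carrier(1), of 1] delta_rel(2)[OF P_carrier(2), of 1] by (simp_all del: One_nat_def)
  ultimately have s: "\<delta> 3 1 P = r 4 1 (r 4 2 (\<delta> 3 3 P))" "\<delta> 3 1 P' = rb 4 1 (rb 4 2 (\<delta> 3 3 P'))" by simp_all
  have io: "r 4 i (\<iota> 3 x) = \<iota> 3 (r 3 i x)" if "1 \<le> i" "i < 3" "x \<in> carrier (A 3)" for i x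
    using r_iota[OF that] by simp
  have ie: "\<iota> 3 (c 3 0 2) = c 4 0 2" "\<iota> 3 (c 3 1 3) = c 4 1 3" using iota_eval[of 4] by (simp_all del: One_nat_def)
  have "r 4 1 (r 4 2 (c 4 0 2)) = c 4 1 3" "r 4 2 (r 4 1 (c 4 1 3)) = c 4 0 2"
    unfolding ie[symmetric] by (simp_all add: io r_P r3_orbit P_carrier del: One_nat_def)
  moreover from this(2) have "rb 4 2 (c 4 0 2) = r 4 1 (c 4 1 3)" by (intro r_cancel hom_carrier[OF r_hom]) simp_all
  moreover have "rb 4 1 (r 4 1 (c 4 1 3)) = c 4 1 3" by (rule r_inv) simp_all
  ultimately have d02: "r 4 1 (r 4 2 (c 4 0 2)) = c 4 1 3" "rb 4 1 (rb 4 2 (c 4 0 2)) = c 4 1 3" by simp_all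
  have fixed: "r 4 2 (c 4 1 4) = c 4 1 4" "r 4 2 (c 4 0 1) = c 4 0 1" "r 4 2 (c 4 0 4) = c 4 0 4"
     "r 4 1 (c 4 0 4) = c 4 0 4" "r 4 1 (c 4 2 3) = c 4 2 3"
     "rb 4 2 (c 4 1 4) = c 4 1 4" "rb 4 2 (c 4 0 1) = c 4 0 1" "rb 4 2 (c 4 0 4) = c 4 0 4"
     "rb 4 1 (c 4 0 4) = c 4 0 4" "rb 4 1 (c 4 2 3) = c 4 2 3"
    by (rule r_fixes; simp)+
  have h: "r 4 1 \<circ> r 4 2 \<in> alg_hom (A 4) (A 4)" "rb 4 1 \<circ> rb 4 2 \<in> alg_hom (A 4) (A 4)"
    by (rule alg_hom_trans; (rule r_hom rb_hom; simp))+
  \<comment> \<open>Entry by entry: 02 goes to 13, 14 to \<delta>_3 P, 01 to 12, 24 to \<delta>_2 P,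
    12 to 23, and 04 is fixed.\<close>
  have "(r 4 1 \<circ> r 4 2) (\<delta> 3 3 P) = rX (A 4) (c 4 1 3) (\<delta> 3 3 P) (c 4 1 2) (\<delta> 3 2 P) (c 4 2 3) (c 4 0 4)"
    by (subst D3(1), subst hom_X[OF h(1)]; simp add: fixed d02 d14 d24 r4_swap del: One_nat_def)
  then have 1: "\<delta> 3 1 P = rX (A 4) (c 4 1 3) (\<delta> 3 3 P) (c 4 1 2) (\<delta> 3 2 P) (c 4 2 3) (c 4 0 4)" using s by simp
  have "(rb 4 1 \<circ> rb 4 2) (\<delta> 3 3 P') = rX (A 4) (\<delta> 3 3 P') (c 4 1 3) (c 4 1 2) (\<delta> 3 2 P') (c 4 2 3) (c 4 0 4)"
    by (subst D3(2), subst hom_X[OF h(2)]; simp add: fixed d02 d14 d24 rb4_swap del: One_nat_def)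
  then have 2: "\<delta> 3 1 P' = rX (A 4) (\<delta> 3 3 P') (c 4 1 3) (c 4 1 2) (\<delta> 3 2 P') (c 4 2 3) (c 4 0 4)" using s by simp
  show ?thesis using 1 2 unfolding star_family_def D1 D2 D3 by simp
qed

lemma pent_family_4: "pent_family 4 (A 4) (c 4)"
proof -
  have c: "c 4 = (\<lambda>a b. C 4 (ival a b))" by (intro ext) (simp add: c_def)
  have "assoc_algebra (A 4)" by (rule assoc) simp
  then show ?thesis using quad_family_c[of 4] star_family_c star_imp_pent[of "A 4" "C 4"] unfolding c by simp
qed

text \<open>Relation (iii) involves five points, so its instance in the fourth algebra suffices
  after reindexing.\<close>

lemma chord_family_c: assumes n: "1 \<le> n" shows "chord_family n (A n) (c n)"
  unfolding chord_family_split
proof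
  show "quad_family n (A n) (c n)" by (rule quad_family_c[OF n])
  show "pent_family n (A n) (c n)"
    unfolding pent_family_def
  proof (intro allI impI, elim conjE)
    fix a b d f g assume p: "a < b" "b < d" "d < f" "f < g" "g \<le> n"
    define e where "e i = (if i = 0 then a else if i = 1 then b else if i = 2 then d else if i = 3 then f else g)" for i :: nat
    obtain h where h: "h \<in> alg_hom (A 4) (A n)" "\<And>a b. a < b \<Longrightarrow> b \<le> 4 \<Longrightarrow> h (c 4 a b) = c n (e a) (e b)"
      by (rule reindexing[of 4 e n]) (use p in \<open>auto simp: e_def less_Suc_eq numeral_eq_Suc\<close>)
    interpret h: alg_morphism "A 4" "A n" h using assoc[of 4] assoc[OF n] h(1) by unfold_locales simp_all
    have he: "h (c 4 0 1) = c n a b" "h (c 4 0 2) = c n a d" "h (c 4 0 3) = c n a f" "h (c 4 0 4) = c n a g"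
      "h (c 4 1 2) = c n b d" "h (c 4 1 3) = c n b f" "h (c 4 1 4) = c n b g"
      "h (c 4 2 3) = c n d f" "h (c 4 2 4) = c n d g" "h (c 4 3 4) = c n f g"
      by (simp_all add: h(2) e_def)
    note e4 = pent_family_4[unfolded pent_family_def, rule_format, of 0 1 2 3 4, simplified]
    show "rX (A n) (c n a f) (c n b g) (c n a b) (c n f g) (c n b f) (c n a g) =
          rX (A n) (rX (A n) (c n a d) (c n b f) (c n a b) (c n d f) (c n b d) (c n a f)) (c n d g) (c n a b) (c n f g)
            (c n d f) (rX (A n) (c n a d) (c n b g) (c n a b) (c n d g) (c n b d) (c n a g)) \<and>
        rX (A n) (c n b g) (c n a f) (c n f g) (c n a b) (c n b f) (c n a g) =
          rX (A n) (rX (A n) (c n d g) (c n b f) (c n f g) (c n b d) (c n d f) (c n b g)) (c n a d) (c n f g) (c n a b)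
            (c n b d) (rX (A n) (c n d g) (c n a f) (c n f g) (c n a d) (c n d f) (c n a g))"
      using arg_cong[OF e4[THEN conjunct1], of h] arg_cong[OF e4[THEN conjunct2], of h]
      by (simp add: h.hom_rX he[simplified])
  qed
qed

lemma aw_quotient:
  assumes n: "1 \<le> n"
  shows "\<exists>\<phi>\<in>alg_hom (aw n) (A n). \<phi> ` carrier (aw n) = carrier (A n) \<and> (\<forall>I\<in>conn n. \<phi> (aw_gen n I) = C n I)"
proof -
  have "c n = (\<lambda>a b. C n (ival a b))" by (intro ext) (simp add: c_def)
  then obtain \<phi> where \<phi>: "\<phi> \<in> alg_hom (aw n) (A n)" "\<And>I. I \<in> conn n \<Longrightarrow> \<phi> (aw_gen n I) = C n I"
    using aw_hom[OF assoc[OF n], of n "C n"] chord_family_c[OF n] by auto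
  interpret alg_morphism "aw n" "A n" \<phi> using assoc_algebra_aw assoc[OF n] \<phi>(1) by unfold_locales
  have "aw_gen n I \<in> carrier (aw n)" if "I \<in> conn n" for I
    using aw_generated[of n] that unfolding generated_by_def by blast
  then have "C n ` conn n \<subseteq> \<phi> ` carrier (aw n)" using \<phi>(2) by force
  moreover have "generated_by (A n) (C n ` conn n)" using alg n unfolding algebra_sequence_def by blast
  ultimately show ?thesis using \<phi> surjective_if_generated by blast
qed

end

theorem proposition4p4:
  shows "(algebra_sequence aw aw_gen \<and> requirements aw aw_gen) \<and>
    (\<forall>(A :: nat \<Rightarrow> (Cq, 'a) module) (C :: nat \<Rightarrow> nat set \<Rightarrow> 'a).
       algebra_sequence A C \<longrightarrow> requirements A C \<longrightarrow>
       (\<forall>n\<ge>1. \<exists>\<phi>\<in>alg_hom (aw n) (A n).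
          \<phi> ` carrier (aw n) = carrier (A n) \<and>
          (\<forall>I\<in>conn n. \<phi> (aw_gen n I) = C n I)))"
proof (intro conjI allI impI)
  show "algebra_sequence aw aw_gen" "requirements aw aw_gen" by (fact aw_requirements)+
next
  fix A :: "nat \<Rightarrow> (Cq, 'a) module" and C :: "nat \<Rightarrow> nat set \<Rightarrow> 'a" and n :: nat
  assume alg: "algebra_sequence A C" and "requirements A C" and n: "1 \<le> n"
  then obtain \<iota> \<delta> r rb where "requirement1 A C \<iota> \<delta>" "requirement2 A \<iota> \<delta> r rb" "requirement3 A C r" "requirement4 A C r rb"
    unfolding requirements_def by blast
  with alg interpret aw_sequence A C \<iota> \<delta> r rb by unfold_locales
  show "\<exists>\<phi>\<in>alg_hom (aw n) (A n). \<phi> ` carrier (aw n) = carrier (A n) \<and> (\<forall>I\<in>conn n. \<phi> (aw_gen n I) = C n I)"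
    by (rule aw_quotient[OF n])
qed

end
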